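(* Let $\mathcal{A}\in Sp(2d,\mathbb{R})$ have the block decomposition $$\mathcal{A}=\begin{pmatrix}A_1 & A_2\\ 0 & A_1^{-T}\end{pmatrix},$$ where $A_1,A_2$ are real $2d\times2d$ matrices, and let $K\subset\mathbb{R}^{2d}$ be compact. Let $M\in GL(d,\mathbb{R})$ be symmetric positive definite and let $\varphi_M(t)=2^{d/4}e^{-\pi t\cdot Mt}$, $t\in\mathbb{R}^d$, be the corresponding generalised Gaussian. Then the space $$\mathcal{P}_{\mathcal{A},K}:=\{T\in\mathcal{HS}:\ \mathrm{supp}(\sigma_T^{\mathcal{A}})\subset K\}$$ is identifiable on any lattice $\Lambda\subset\mathbb{R}^{2d}$ with respect to the window $S=\mu(\mathcal{A})^*(\varphi_M\otimes\varphi_M)$.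
   Context: Lattices are full-rank. $\mathcal{HS}$ denotes the Hilbert-Schmidt operators on $L^2(\mathbb{R}^d)$. For $f,g\in L^2(\mathbb{R}^d)$, $f\otimes g:=\langle\cdot,g\rangle f$. The Weyl symbol $\sigma_T$ of an operator $T$ is determined by linear (and duality) extension from $\sigma_{f\otimes g}(x,\omega)=\int_{\mathbb{R}^d}f(x+\tfrac t2)\overline{g(x-\tfrac t2)}e^{-2\pi it\cdot\omega}dt$; the map $T\mapsto\sigma_T$ is unitary from $\mathcal{HS}$ onto $L^2(\mathbb{R}^{2d})$. $L_\sigma$ is the operator with Weyl symbol $\sigma$. $\mathfrak{S}$ (resp. $\mathfrak{S}'$) is the set of operators with Weyl symbol in $\mathscr{S}(\mathbb{R}^{2d})$ (resp. $\mathscr{S}'(\mathbb{R}^{2d})$). For $z=(x,\omega)$, $\rho(z)f(t)=e^{-\pi i\omega\cdot x}e^{2\pi i\omega\cdot t}f(t-x)$ (same notation on any $\mathbb{R}^n$), and $\alpha_z(S)=\rho(z)S\rho(z)^*$, so $\sigma_{\alpha_z(S)}(\cdot)=\sigma_S(\cdot-z)$. The diagonal of the polarised Cohen's class of $T$ with window $S$ is $Q_ST(z,z)=\langle T,\alpha_z(S)\rangle=\langle\sigma_T,\sigma_S(\cdot-z)\rangle$. Identifiability: a set of operators $\mathcal{T}\subset\mathfrak{S}'$ is identifiable on the lattice $\Lambda$ with respect to the window $S\in\mathfrak{S}$ if the map $T\mapsto\{Q_ST(\lambda,\lambda)\}_{\lambda\in\Lambda}$ is injective from $\mathcal{T}$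 to $\ell^\infty(\Lambda)$. $Sp(2d,\mathbb{R})$ is the group of real $4d\times4d$ matrices with $\mathcal{A}^TJ\mathcal{A}=J$, $J=\begin{pmatrix}0&I_{2d}\\-I_{2d}&0\end{pmatrix}$. For $\mathcal{A}\in Sp(2d,\mathbb{R})$, $\mu(\mathcal{A})$ is the unitary operator on $L^2(\mathbb{R}^{2d})$, unique up to a unimodular constant (fix any choice), with $\mu(\mathcal{A})\rho(\xi)\mu(\mathcal{A})^*=\rho(\mathcal{A}\xi)$ for $\xi\in\mathbb{R}^{4d}$; it extends to $\mathscr{S}'(\mathbb{R}^{2d})$. The $\mathcal{A}$-Weyl symbol is $\sigma_T^{\mathcal{A}}:=\mu(\mathcal{A})\sigma_T$, and on operators $\mu(\mathcal{A})^*T:=L_{\mu(\mathcal{A})^*\sigma_T}$. *)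

theory Defs
  imports "HOL-Analysis.Analysis"
begin

section \<open>The Hilbert space of square-integrable functions modulo null sets\<close>

definition square_integrable :: "('a::euclidean_space \<Rightarrow> complex) \<Rightarrow> bool" where
  "square_integrable f \<longleftrightarrow>
     f \<in> borel_measurable lborel \<and> integrable lborel (\<lambda>x. (cmod (f x))\<^sup>2)"

definition l2_rel :: "('a::euclidean_space \<Rightarrow> complex) \<Rightarrow> ('a \<Rightarrow> complex) \<Rightarrow> bool" where
  "l2_rel f g \<longleftrightarrow> square_integrable f \<and> square_integrable g \<and> (AE x in lborel. f x = g x)"

lemma square_integrable_zero: "square_integrable (\<lambda>x. 0)"
  by (simp add: square_integrable_def)

lemma square_integrable_cmult:
  assumes "square_integrable f" shows "square_integrable (\<lambda>x. c * f x)"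
  using assms by (auto simp: square_integrable_def norm_mult power_mult_distrib)

lemma square_integrable_add:
  assumes "square_integrable f" "square_integrable g"
  shows "square_integrable (\<lambda>x. f x + g x)"
proof -
  have meas [measurable]: "f \<in> borel_measurable lborel" "g \<in> borel_measurable lborel"
    using assms by (auto simp: square_integrable_def)
  have bound: "(cmod (f x + g x))\<^sup>2 \<le> 2 * (cmod (f x))\<^sup>2 + 2 * (cmod (g x))\<^sup>2" for x
  proof -
    have "(cmod (f x + g x))\<^sup>2 \<le> (cmod (f x) + cmod (g x))\<^sup>2"
      by (intro power_mono norm_triangle_ineq norm_ge_zero)
    also have "\<dots> \<le> 2 * (cmod (f x))\<^sup>2 + 2 * (cmod (g x))\<^sup>2"
      using zero_le_power2[of "cmod (f x) - cmod (g x)"]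
      by (simp add: power2_sum power2_diff)
    finally show ?thesis .
  qed
  have "integrable lborel (\<lambda>x. (cmod (f x + g x))\<^sup>2)"
  proof (rule Bochner_Integration.integrable_bound)
    show "integrable lborel (\<lambda>x. 2 * (cmod (f x))\<^sup>2 + 2 * (cmod (g x))\<^sup>2)"
      using assms by (auto simp: square_integrable_def)
  qed (use bound in auto)
  then show ?thesis
    by (simp add: square_integrable_def)
qed

lemma square_integrable_mult_cnj:
  assumes "square_integrable f" "square_integrable g"
  shows "integrable lborel (\<lambda>x. f x * cnj (g x))"
proof -
  have meas [measurable]: "f \<in> borel_measurable lborel" "g \<in> borel_measurable lborel"
    using assms by (auto simp: square_integrable_def)
  have bound: "cmod (f x * cnj (g x)) \<le> (cmod (f x))\<^sup>2 + (cmod (g x))\<^sup>2" for x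
  proof -
    have "2 * (cmod (f x) * cmod (g x)) \<le> (cmod (f x))\<^sup>2 + (cmod (g x))\<^sup>2"
      using zero_le_power2[of "cmod (f x) - cmod (g x)"] by (simp add: power2_diff)
    moreover have "0 \<le> cmod (f x) * cmod (g x)" by simp
    ultimately have "cmod (f x) * cmod (g x) \<le> (cmod (f x))\<^sup>2 + (cmod (g x))\<^sup>2" by linarith
    then show ?thesis by (simp add: norm_mult)
  qed
  show ?thesis
  proof (rule Bochner_Integration.integrable_bound)
    show "integrable lborel (\<lambda>x. (cmod (f x))\<^sup>2 + (cmod (g x))\<^sup>2)"
      using assms by (auto simp: square_integrable_def)
    show "(\<lambda>x. f x * cnj (g x)) \<in> borel_measurable lborel"
      by (intro borel_measurable_times meas(1) borel_measurable_continuous_on[OF _ meas(2)])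
         (auto intro: continuous_intros)
  qed (use bound in auto)
qed

lemma l2_rel_add:
  assumes "l2_rel f f'" "l2_rel g g'"
  shows "l2_rel (\<lambda>x. f x + g x) (\<lambda>x. f' x + g' x)"
  using assms by (auto simp: l2_rel_def square_integrable_add elim!: eventually_elim2)

lemma l2_rel_cmult:
  assumes "l2_rel f f'" shows "l2_rel (\<lambda>x. c * f x) (\<lambda>x. c * f' x)"
  using assms by (auto simp: l2_rel_def square_integrable_cmult elim!: eventually_mono)

quotient_type (overloaded) 'a l2 = "'a::euclidean_space \<Rightarrow> complex" / partial: l2_rel
proof (rule part_equivpI)
  show "\<exists>f. l2_rel f (f :: 'a \<Rightarrow> complex)"
    by (auto simp: l2_rel_def intro: square_integrable_zero)
  show "symp (l2_rel :: ('a \<Rightarrow> complex) \<Rightarrow> _)"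
    by (auto intro!: sympI simp: l2_rel_def elim!: eventually_mono)
  show "transp (l2_rel :: ('a \<Rightarrow> complex) \<Rightarrow> _)"
    by (auto intro!: transpI simp: l2_rel_def elim!: eventually_elim2)
qed

lift_definition cscale :: "complex \<Rightarrow> 'a::euclidean_space l2 \<Rightarrow> 'a l2"
  is "\<lambda>c f x. c * f x"
  by (rule l2_rel_cmult)

text \<open>The inner product is linear in its first argument.\<close>

lift_definition cinner :: "'a::euclidean_space l2 \<Rightarrow> 'a l2 \<Rightarrow> complex"
  is "\<lambda>f g. LINT x|lborel. f x * cnj (g x)"
proof -
  fix f f' g g' :: "'a \<Rightarrow> complex"
  assume *: "l2_rel f f'" "l2_rel g g'"
  then have "AE x in lborel. f x = f' x" "AE x in lborel. g x = g' x"
    by (auto simp: l2_rel_def)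
  then have "AE x in lborel. f x * cnj (g x) = f' x * cnj (g' x)"
    by eventually_elim simp
  then show "(LINT x|lborel. f x * cnj (g x)) = (LINT x|lborel. f' x * cnj (g' x))"
    using * unfolding l2_rel_def
    by (intro integral_cong_AE borel_measurable_integrable square_integrable_mult_cnj) auto
qed

instantiation l2 :: (euclidean_space) real_vector
begin

lift_definition zero_l2 :: "'a l2" is "\<lambda>x. 0"
  by (simp add: l2_rel_def square_integrable_zero)

lift_definition plus_l2 :: "'a l2 \<Rightarrow> 'a l2 \<Rightarrow> 'a l2" is "\<lambda>f g x. f x + g x"
  by (rule l2_rel_add)

definition uminus_l2 :: "'a l2 \<Rightarrow> 'a l2" where "uminus_l2 f = cscale (-1) f"

definition minus_l2 :: "'a l2 \<Rightarrow> 'a l2 \<Rightarrow> 'a l2" where "minus_l2 f g = f + - (g :: 'a l2)"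

definition scaleR_l2 :: "real \<Rightarrow> 'a l2 \<Rightarrow> 'a l2" where
  "scaleR_l2 r f = cscale (complex_of_real r) f"

instance
proof
  fix a b c :: "'a l2" and r s :: real
  show "a + b + c = a + (b + c)"
    by transfer (auto simp: l2_rel_def add.assoc intro!: square_integrable_add)
  show "a + b = b + a"
    by transfer (auto simp: l2_rel_def add.commute intro!: square_integrable_add)
  show "0 + a = a"
    by transfer (auto simp: l2_rel_def)
  show "- a + a = 0"
    unfolding uminus_l2_def
    by transfer (auto simp: l2_rel_def square_integrable_zero)
  show "a - b = a + - b"
    by (simp add: minus_l2_def)
  show "r *\<^sub>R (a + b) = r *\<^sub>R a + r *\<^sub>R b"
    unfolding scaleR_l2_def
    by transfer (auto simp: l2_rel_def distrib_left distrib_right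
        intro!: square_integrable_add square_integrable_cmult)
  show "(r + s) *\<^sub>R a = r *\<^sub>R a + s *\<^sub>R a"
    unfolding scaleR_l2_def
    by transfer (auto simp: l2_rel_def distrib_left distrib_right
        intro!: square_integrable_add square_integrable_cmult)
  show "r *\<^sub>R s *\<^sub>R a = (r * s) *\<^sub>R a"
    unfolding scaleR_l2_def
    by transfer (auto simp: l2_rel_def mult.assoc intro!: square_integrable_cmult)
  show "1 *\<^sub>R a = a"
    unfolding scaleR_l2_def by transfer (auto simp: l2_rel_def)
qed

end

lemma cinner_add_left: "cinner (f + g) h = cinner f h + cinner g h"
  by transfer (simp add: l2_rel_def distrib_right square_integrable_mult_cnj)

lemma cinner_cscale_left: "cinner (cscale c f) h = c * cinner f h"
  by transfer (simp add: mult.assoc)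

lemma cinner_commute: "cinner f g = cnj (cinner g f)"
proof transfer
  fix f g :: "'a \<Rightarrow> complex"
  have "cnj (LINT x|lborel. g x * cnj (f x)) = (LINT x|lborel. cnj (g x * cnj (f x)))"
    by (rule Bochner_Integration.integral_cnj[symmetric])
  then show "(LINT x|lborel. f x * cnj (g x)) = cnj (LINT x|lborel. g x * cnj (f x))"
    by (simp add: mult.commute)
qed

lemma mult_cnj_cmod2: "z * cnj z = complex_of_real ((cmod z)\<^sup>2)"
  using complex_norm_square[of z] by simp

lemma cinner_self_nonneg: "0 \<le> Re (cinner f f)"
  by transfer (simp add: mult_cnj_cmod2 del: of_real_power)

lemma cinner_self_eq_0: "Re (cinner f f) = 0 \<longleftrightarrow> f = 0"
proof transfer
  fix f :: "'a \<Rightarrow> complex" assume "l2_rel f f"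
  then have f: "square_integrable f" by (simp add: l2_rel_def)
  have "Re (LINT x|lborel. f x * cnj (f x)) = (LINT x|lborel. (cmod (f x))\<^sup>2)"
    by (simp add: mult_cnj_cmod2 del: of_real_power)
  also have "\<dots> = 0 \<longleftrightarrow> (AE x in lborel. (cmod (f x))\<^sup>2 = 0)"
    using f by (intro integral_nonneg_eq_0_iff_AE) (auto simp: square_integrable_def)
  also have "\<dots> \<longleftrightarrow> l2_rel f (\<lambda>x. 0)"
    using f by (simp add: l2_rel_def square_integrable_zero)
  finally show "(Re (LINT x|lborel. f x * cnj (f x)) = 0) = l2_rel f (\<lambda>x. 0)" .
qed

instantiation l2 :: (euclidean_space) real_inner
begin

definition inner_l2 :: "'a l2 \<Rightarrow> 'a l2 \<Rightarrow> real" where "inner_l2 f g = Re (cinner f g)"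
definition norm_l2 :: "'a l2 \<Rightarrow> real" where "norm_l2 f = sqrt (inner f f)"
definition sgn_l2 :: "'a l2 \<Rightarrow> 'a l2" where "sgn_l2 f = f /\<^sub>R norm f"
definition dist_l2 :: "'a l2 \<Rightarrow> 'a l2 \<Rightarrow> real" where "dist_l2 f g = norm (f - g)"
definition uniformity_l2 :: "('a l2 \<times> 'a l2) filter" where
  "uniformity_l2 = (INF e\<in>{0<..}. principal {(x, y). dist x y < e})"
definition open_l2 :: "'a l2 set \<Rightarrow> bool" where
  "open_l2 U \<longleftrightarrow> (\<forall>x\<in>U. eventually (\<lambda>(x', y). x' = x \<longrightarrow> y \<in> U) uniformity)"

instance
proof
  fix f g h :: "'a l2" and r :: real
  show "inner f g = inner g f"
    using cinner_commute[of f g] by (simp add: inner_l2_def)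
  show "inner (f + g) h = inner f h + inner g h"
    by (simp add: inner_l2_def cinner_add_left)
  show "inner (r *\<^sub>R f) g = r * inner f g"
    by (simp add: inner_l2_def scaleR_l2_def cinner_cscale_left)
  show "0 \<le> inner f f"
    by (simp add: inner_l2_def cinner_self_nonneg)
  show "inner f f = 0 \<longleftrightarrow> f = 0"
    by (simp add: inner_l2_def cinner_self_eq_0)
qed (rule dist_l2_def sgn_l2_def uniformity_l2_def norm_l2_def open_l2_def)+

end

text \<open>Support of a class: the complement of the largest open set on which it vanishes
  almost everywhere, i.e. its support as a distribution.\<close>

definition l2_support :: "'a::euclidean_space l2 \<Rightarrow> 'a set" where
  "l2_support F =
     {x. \<forall>V. open V \<and> x \<in> V \<longrightarrow> \<not> (AE y in lborel. y \<in> V \<longrightarrow> rep_l2 F y = 0)}"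


section \<open>Operators\<close>

definition bounded_clinear :: "('a::euclidean_space l2 \<Rightarrow> 'b::euclidean_space l2) \<Rightarrow> bool" where
  "bounded_clinear T \<longleftrightarrow> bounded_linear T \<and> (\<forall>c f. T (cscale c f) = cscale c (T f))"

definition cadjoint ::
  "('a::euclidean_space l2 \<Rightarrow> 'b::euclidean_space l2) \<Rightarrow> 'b l2 \<Rightarrow> 'a l2" where
  "cadjoint T = (THE T'. \<forall>f g. cinner (T f) g = cinner f (T' g))"

definition unitary :: "('a::euclidean_space l2 \<Rightarrow> 'b::euclidean_space l2) \<Rightarrow> bool" where
  "unitary U \<longleftrightarrow> bounded_clinear U \<and> surj U \<and> (\<forall>f g. cinner (U f) (U g) = cinner f g)"

definition orthonormal_basis :: "'a::euclidean_space l2 set \<Rightarrow> bool" where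
  "orthonormal_basis B \<longleftrightarrow>
     (\<forall>e\<in>B. \<forall>e'\<in>B. cinner e e' = (if e = e' then 1 else 0)) \<and>
     (\<forall>f. (\<forall>e\<in>B. cinner f e = 0) \<longrightarrow> f = 0)"

definition HS :: "('a::euclidean_space l2 \<Rightarrow> 'a l2) set" where
  "HS = {T. bounded_clinear T \<and>
            (\<exists>B. orthonormal_basis B \<and> (\<lambda>e. (norm (T e))\<^sup>2) summable_on B)}"

text \<open>The value does not depend on the orthonormal basis that is chosen.\<close>

definition hs_inner ::
  "('a::euclidean_space l2 \<Rightarrow> 'a l2) \<Rightarrow> ('a l2 \<Rightarrow> 'a l2) \<Rightarrow> complex" where
  "hs_inner T S = (\<Sum>\<^sub>\<infinity>e\<in>(SOME B. orthonormal_basis B). cinner (T e) (S e))"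

definition rank_one :: "'a::euclidean_space l2 \<Rightarrow> 'a l2 \<Rightarrow> 'a l2 \<Rightarrow> 'a l2" (infix "\<otimes>\<^sub>o" 70) where
  "f \<otimes>\<^sub>o g = (\<lambda>h. cscale (cinner h g) f)"


section \<open>Phase space\<close>

text \<open>A point \<open>(x, \<omega>)\<close> of the phase space over \<open>real ^ 'm\<close> is a vector of type \<open>real ^ ('m + 'm)\<close>;
  the components with index \<open>Inl i\<close> form \<open>x\<close>, those with index \<open>Inr i\<close> form \<open>\<omega>\<close>.\<close>

definition position :: "real ^ ('m::finite + 'm) \<Rightarrow> real ^ 'm" where
  "position z = (\<chi> i. z $ Inl i)"

definition frequency :: "real ^ ('m::finite + 'm) \<Rightarrow> real ^ 'm" where
  "frequency z = (\<chi> i. z $ Inr i)"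

definition block_matrix ::
  "real ^ 'm ^ 'm \<Rightarrow> real ^ 'm ^ 'm \<Rightarrow> real ^ 'm ^ 'm \<Rightarrow> real ^ 'm ^ 'm
     \<Rightarrow> real ^ ('m::finite + 'm) ^ ('m + 'm)" where
  "block_matrix A B C D =
     (\<chi> i j. case i of
        Inl a \<Rightarrow> (case j of Inl b \<Rightarrow> A $ a $ b | Inr b \<Rightarrow> B $ a $ b)
      | Inr a \<Rightarrow> (case j of Inl b \<Rightarrow> C $ a $ b | Inr b \<Rightarrow> D $ a $ b))"

definition symplectic :: "real ^ ('m::finite + 'm) ^ ('m + 'm) \<Rightarrow> bool" where
  "symplectic A \<longleftrightarrow>
     (let J = block_matrix 0 (mat 1) (- mat 1) 0 in transpose A ** J ** A = J)"

definition full_rank_lattice :: "(real ^ 'k::finite) set \<Rightarrow> bool" where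
  "full_rank_lattice \<Lambda> \<longleftrightarrow>
     (\<exists>B :: real ^ 'k ^ 'k. invertible B \<and>
        \<Lambda> = range (\<lambda>n :: int ^ 'k. B *v (\<chi> i. of_int (n $ i))))"

definition rho :: "real ^ ('m::finite + 'm) \<Rightarrow> (real ^ 'm) l2 \<Rightarrow> (real ^ 'm) l2" where
  "rho z f = abs_l2 (\<lambda>t. cis (- pi * (frequency z \<bullet> position z)) * cis (2 * pi * (frequency z \<bullet> t))
                          * rep_l2 f (t - position z))"

definition alpha :: "real ^ ('m::finite + 'm) \<Rightarrow> ((real ^ 'm) l2 \<Rightarrow> (real ^ 'm) l2)
     \<Rightarrow> (real ^ 'm) l2 \<Rightarrow> (real ^ 'm) l2" where
  "alpha z S = rho z \<circ> S \<circ> cadjoint (rho z)"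

text \<open>\<open>U\<close> is a choice of \<open>\<mu>(A)\<close>.\<close>

definition metaplectic ::
  "real ^ ('m::finite + 'm) ^ ('m + 'm) \<Rightarrow> ((real ^ 'm) l2 \<Rightarrow> (real ^ 'm) l2) \<Rightarrow> bool" where
  "metaplectic A U \<longleftrightarrow> unitary U \<and> (\<forall>\<xi>. U \<circ> rho \<xi> \<circ> cadjoint U = rho (A *v \<xi>))"


section \<open>Weyl calculus\<close>

definition cross_wigner ::
  "(real ^ 'n::finite) l2 \<Rightarrow> (real ^ 'n) l2 \<Rightarrow> real ^ ('n + 'n) \<Rightarrow> complex" where
  "cross_wigner f g z =
     (LINT t|lborel. rep_l2 f (position z + (1/2) *\<^sub>R t) * cnj (rep_l2 g (position z - (1/2) *\<^sub>R t))
                      * cis (- 2 * pi * (t \<bullet> frequency z)))"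

definition weyl_map ::
  "(((real ^ 'n::finite) l2 \<Rightarrow> (real ^ 'n) l2) \<Rightarrow> (real ^ ('n + 'n)) l2) \<Rightarrow> bool" where
  "weyl_map W \<longleftrightarrow>
     (\<forall>S\<in>HS. \<forall>T\<in>HS. W (\<lambda>f. S f + T f) = W S + W T) \<and>
     (\<forall>c. \<forall>T\<in>HS. W (\<lambda>f. cscale c (T f)) = cscale c (W T)) \<and>
     (\<forall>S\<in>HS. \<forall>T\<in>HS. cinner (W S) (W T) = hs_inner S T) \<and>
     W ` HS = UNIV \<and>
     (\<forall>f g. W (f \<otimes>\<^sub>o g) = abs_l2 (cross_wigner f g))"

text \<open>Only the values on \<open>HS\<close> matter. There they are determined by \<open>weyl_map\<close>, since the
  operators of finite rank are dense in \<open>HS\<close>.\<close>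

definition weyl_symbol ::
  "((real ^ 'n::finite) l2 \<Rightarrow> (real ^ 'n) l2) \<Rightarrow> (real ^ ('n + 'n)) l2" where
  "weyl_symbol = (SOME W. weyl_map W)"

definition weyl_op ::
  "(real ^ ('n::finite + 'n)) l2 \<Rightarrow> (real ^ 'n) l2 \<Rightarrow> (real ^ 'n) l2" where
  "weyl_op \<sigma> = (THE T. T \<in> HS \<and> weyl_symbol T = \<sigma>)"

text \<open>With \<open>V = \<mu>(A)\<close>, \<open>A_weyl_symbol V T\<close> is the \<open>A\<close>-Weyl symbol of \<open>T\<close>; with
  \<open>V = \<mu>(A)\<^sup>*\<close>, \<open>symbol_action V T\<close> is the operator \<open>\<mu>(A)\<^sup>* T\<close>.\<close>

definition A_weyl_symbol :: "((real ^ ('n::finite + 'n)) l2 \<Rightarrow> (real ^ ('n + 'n)) l2)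
     \<Rightarrow> ((real ^ 'n) l2 \<Rightarrow> (real ^ 'n) l2) \<Rightarrow> (real ^ ('n + 'n)) l2" where
  "A_weyl_symbol V T = V (weyl_symbol T)"

definition symbol_action :: "((real ^ ('n::finite + 'n)) l2 \<Rightarrow> (real ^ ('n + 'n)) l2)
     \<Rightarrow> ((real ^ 'n) l2 \<Rightarrow> (real ^ 'n) l2) \<Rightarrow> (real ^ 'n) l2 \<Rightarrow> (real ^ 'n) l2" where
  "symbol_action V T = weyl_op (V (weyl_symbol T))"


section \<open>Identifiability\<close>

primrec iterated_derivative ::
  "'a::euclidean_space list \<Rightarrow> ('a \<Rightarrow> complex) \<Rightarrow> 'a \<Rightarrow> complex" where
  "iterated_derivative [] f = f"
| "iterated_derivative (v # vs) f = (\<lambda>x. frechet_derivative (iterated_derivative vs f) (at x) v)"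

definition schwartz_function :: "('a::euclidean_space \<Rightarrow> complex) \<Rightarrow> bool" where
  "schwartz_function f \<longleftrightarrow>
     (\<forall>vs. iterated_derivative vs f differentiable_on UNIV \<and>
           (\<forall>k::nat. bounded (range (\<lambda>x. norm x ^ k *\<^sub>R iterated_derivative vs f x))))"

definition schwartz_operators :: "((real ^ 'n::finite) l2 \<Rightarrow> (real ^ 'n) l2) set" where
  "schwartz_operators =
     {S \<in> HS. \<exists>\<phi>. schwartz_function \<phi> \<and> weyl_symbol S = abs_l2 \<phi>}"

text \<open>The diagonal of the polarised Cohen's class of \<open>T\<close> with window \<open>S\<close>, for \<open>T\<close> and \<open>S\<close> in
  \<open>HS\<close>.\<close>

definition cohen_diag :: "((real ^ 'n::finite) l2 \<Rightarrow> (real ^ 'n) l2)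
     \<Rightarrow> ((real ^ 'n) l2 \<Rightarrow> (real ^ 'n) l2) \<Rightarrow> real ^ ('n + 'n) \<Rightarrow> complex" where
  "cohen_diag S T z = hs_inner T (alpha z S)"

text \<open>For sets of Hilbert-Schmidt operators, on which the pairing of operators with tempered
  symbols against Schwartz windows is the Hilbert-Schmidt inner product. The first three
  conjuncts say that the sampling map is well defined with values in the bounded functions
  on the lattice.\<close>

definition identifiable :: "((real ^ 'n::finite) l2 \<Rightarrow> (real ^ 'n) l2) set
     \<Rightarrow> (real ^ ('n + 'n)) set \<Rightarrow> ((real ^ 'n) l2 \<Rightarrow> (real ^ 'n) l2) \<Rightarrow> bool" where
  "identifiable \<T> \<Lambda> S \<longleftrightarrow>
     \<T> \<subseteq> HS \<and> S \<in> schwartz_operators \<and>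
     (\<forall>T\<in>\<T>. bounded (cohen_diag S T ` \<Lambda>)) \<and>
     inj_on (\<lambda>T. restrict (cohen_diag S T) \<Lambda>) \<T>"

definition gaussian :: "real ^ 'n ^ 'n \<Rightarrow> real ^ 'n::finite \<Rightarrow> complex" where
  "gaussian M t = complex_of_real (2 powr (real CARD('n) / 4) * exp (- pi * (t \<bullet> (M *v t))))"

definition P_space :: "((real ^ ('n::finite + 'n)) l2 \<Rightarrow> (real ^ ('n + 'n)) l2)
     \<Rightarrow> (real ^ ('n + 'n)) set \<Rightarrow> ((real ^ 'n) l2 \<Rightarrow> (real ^ 'n) l2) set" where
  "P_space U K = {T \<in> HS. l2_support (A_weyl_symbol U T) \<subseteq> K}"

end

theory Submission
  imports Defs "HOL-Probability.Distributions" "HOL-Complex_Analysis.Conformal_Mappings"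
begin

text \<open>
  The Weyl symbol turns the samples of \<open>T\<close> into \<open>\<langle>\<sigma>\<^sub>T, \<rho>(\<lambda>, 0) \<sigma>\<^sub>S\<rangle>\<close>. Applying \<open>\<mu>(A)\<close>, which maps
  shifts by \<open>(\<lambda>, 0)\<close> to shifts by \<open>(A1 \<lambda>, 0)\<close> because \<open>A\<close> is block upper triangular, these become the
  pairings of \<open>F = \<mu>(A) \<sigma>\<^sub>T\<close> with translates of the Gaussian \<open>\<mu>(A) \<sigma>\<^sub>S\<close>, that is, up to nonzero
  factors, values of the Laplace transform of \<open>F\<close> times that Gaussian on a lattice of real
  exponents. Since \<open>F\<close> has compact support and the exponentials with exponents in the lattice span
  a point-separating algebra, Stone-Weierstrass and Plancherel give \<open>F = 0\<close>.

  The existence of the Weyl correspondence rests on Moyal's identity, which Plancherel's theorem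
  yields one variable at a time. Moyal's identity also identifies \<open>\<mu>(A)\<^sup>* \<sigma>\<close> for a Gaussian \<open>\<sigma>\<close>
  without an explicit formula for \<open>\<mu>(A)\<close>: its ambiguity function is that of a chirped Gaussian.
\<close>

section \<open>The Hilbert space of square-integrable functions\<close>

text \<open>Any lattice suffices, however sparse: pairing with a Gaussian translated by
  \<open>v\<close> produces, after completing the square, the real exponential
  \<open>exp (2 * pi * (z \<bullet> R v))\<close>. Closure of the lattice under addition keeps
  products of such exponentials in the family, full rank makes them separate points, and compactness
  of \<open>K\<close> replaces any density of the lattice.

  Two obstacles shape the rest. The Weyl symbol, the Weyl operator and the basis in the
  Hilbert-Schmidt product are picked by \<open>SOME\<close> or \<open>THE\<close>, so nothing can be
  computed before a concrete correspondence with the required properties has been constructed; the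
  construction reads an operator off its pairings with Wigner functions. And \<open>U\<close> is
  known only as a unitary that intertwines phase-space shifts. For injectivity this is enough, since
  \<open>U\<close> turns the symbol of the window back into a plain Gaussian. An explicit form of
  that symbol is required for membership in \<open>schwartz_operators\<close>, where square
  integrability does not suffice.\<close>

lemma l2_rel_rep: "l2_rel (rep_l2 f) (rep_l2 f)"
  by (rule Quotient3_rep_reflp[OF Quotient3_l2])

lemma square_integrable_rep: "square_integrable (rep_l2 f)"
  using l2_rel_rep[of f] by (simp add: l2_rel_def)

lemma abs_rep_l2: "abs_l2 (rep_l2 f) = f"
  by (rule Quotient3_abs_rep[OF Quotient3_l2])

lemma abs_l2_eqI:
  assumes "square_integrable f" "square_integrable g" "AE x in lborel. f x = g x"
  shows "abs_l2 f = abs_l2 g"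
  using assms Quotient3_rel_abs[OF Quotient3_l2, of f g] by (simp add: l2_rel_def)

lemma rep_abs_l2:
  assumes "square_integrable f" shows "AE x in lborel. rep_l2 (abs_l2 f) x = f x"
proof -
  have "l2_rel f f" using assms by (simp add: l2_rel_def)
  then have "l2_rel (rep_l2 (abs_l2 f)) f"
    by (rule rep_abs_rsp_left[OF Quotient3_l2])
  then show ?thesis by (simp add: l2_rel_def)
qed

lemma l2_eqI: "AE x in lborel. rep_l2 f x = rep_l2 g x \<Longrightarrow> f = g"
  using abs_l2_eqI[OF square_integrable_rep[of f] square_integrable_rep[of g]]
  by (simp add: abs_rep_l2)

lemma rep_l2_measurable [measurable]: "rep_l2 f \<in> borel_measurable borel"
  using square_integrable_rep[of f] by (simp add: square_integrable_def)

lemma cinner_abs: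
  assumes "square_integrable f" "square_integrable g"
  shows "cinner (abs_l2 f) (abs_l2 g) = (LINT x|lborel. f x * cnj (g x))"
  using assms by (intro cinner.abs_eq) (auto simp: l2_rel_def)

lemma cinner_rep: "cinner f g = (LINT x|lborel. rep_l2 f x * cnj (rep_l2 g x))"
  using cinner_abs[OF square_integrable_rep square_integrable_rep, of f g]
  by (simp add: abs_rep_l2)

lemma plus_abs:
  assumes "square_integrable f" "square_integrable g"
  shows "abs_l2 f + abs_l2 g = abs_l2 (\<lambda>x. f x + g x)"
  using assms by (intro plus_l2.abs_eq) (auto simp: l2_rel_def)

lemma cscale_abs:
  assumes "square_integrable f"
  shows "cscale c (abs_l2 f) = abs_l2 (\<lambda>x. c * f x)"
  using assms by (intro cscale.abs_eq) (auto simp: l2_rel_def)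

lemma rep_plus: "AE x in lborel. rep_l2 (f + g) x = rep_l2 f x + rep_l2 g x"
  using rep_abs_l2[OF square_integrable_add[OF square_integrable_rep[of f] square_integrable_rep[of g]]]
  by (simp add: plus_abs[symmetric] square_integrable_rep abs_rep_l2)

lemma rep_cscale: "AE x in lborel. rep_l2 (cscale c f) x = c * rep_l2 f x"
  using rep_abs_l2[OF square_integrable_cmult[OF square_integrable_rep[of f], of c]]
  by (simp add: cscale_abs[symmetric] square_integrable_rep abs_rep_l2)

lemma rep_minus: "AE x in lborel. rep_l2 (f - g) x = rep_l2 f x - rep_l2 g x"
  using rep_plus[of f "-g"] rep_cscale[of "-1" g]
  by eventually_elim (simp add: minus_l2_def uminus_l2_def)

lemma rep_zero: "AE x in lborel. rep_l2 0 x = 0"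
  using rep_abs_l2[OF square_integrable_zero] by (simp add: zero_l2_def)

lemma cscale_cscale [simp]: "cscale c (cscale d f) = cscale (c * d) f"
  by transfer (auto simp: l2_rel_def mult.assoc intro!: square_integrable_cmult)

lemma cscale_one [simp]: "cscale 1 f = f"
  by transfer (auto simp: l2_rel_def)

lemma cscale_zero_left [simp]: "cscale 0 f = 0"
  by transfer (auto simp: l2_rel_def square_integrable_zero)

lemma cscale_minus_one: "cscale (-1) f = - f"
  by (simp add: uminus_l2_def)

lemma cscale_of_real: "cscale (of_real r) f = r *\<^sub>R f"
  by (simp add: scaleR_l2_def)

lemma cinner_add_right: "cinner h (f + g) = cinner h f + cinner h g"
  by (subst (1 2 3) cinner_commute) (simp add: cinner_add_left)

lemma cinner_cscale_right: "cinner h (cscale c f) = cnj c * cinner h f"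
  by (subst (1 2) cinner_commute) (simp add: cinner_cscale_left)

lemma cinner_zero_left [simp]: "cinner 0 f = 0"
  using cinner_cscale_left[of 0 f f] by simp

lemma cinner_zero_right [simp]: "cinner f 0 = 0"
  using cinner_cscale_right[of f 0 f] by simp

lemma cinner_minus_left: "cinner (- f) g = - cinner f g"
  using cinner_cscale_left[of "-1" f g] by (simp add: cscale_minus_one)

lemma cinner_minus_right: "cinner f (- g) = - cinner f g"
  using cinner_cscale_right[of f "-1" g] by (simp add: cscale_minus_one)

lemma cinner_diff_left: "cinner (f - g) h = cinner f h - cinner g h"
  using cinner_add_left[of f "- g" h] by (simp add: cinner_minus_left)

lemma cinner_diff_right: "cinner h (f - g) = cinner h f - cinner h g"
  using cinner_add_right[of h f "- g"] by (simp add: cinner_minus_right)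

lemma Re_cinner: "Re (cinner f g) = inner f g"
  by (simp add: inner_l2_def)

lemma cinner_self: "cinner f f = of_real ((norm f)\<^sup>2)"
proof -
  have "Im (cinner f f) = 0"
    using arg_cong[OF cinner_commute[of f f], of Im] by simp
  then show ?thesis
    by (auto simp: complex_eq_iff power2_norm_eq_inner Re_cinner simp flip: of_real_power)
qed

lemma norm_eqI:
  assumes "cinner f f = of_real (r\<^sup>2)" "r \<ge> 0"
  shows "norm f = r"
proof -
  have "(norm f)\<^sup>2 = r\<^sup>2"
    using assms(1) of_real_eq_iff unfolding cinner_self by blast
  then show ?thesis using assms(2) by (simp add: power2_eq_iff_nonneg)
qed

lemma norm_cscale: "norm (cscale c f) = cmod c * norm f"
proof (rule norm_eqI)
  show "cinner (cscale c f) (cscale c f) = of_real ((cmod c * norm f)\<^sup>2)"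
    unfolding cinner_cscale_left cinner_cscale_right cinner_self[of f] power_mult_distrib of_real_mult complex_norm_square
    by (simp only: mult_ac)
qed simp

lemma cmod_cinner_le: "cmod (cinner f g) \<le> norm f * norm g"
proof -
  \<comment> \<open>A phase that makes the pairing real and nonnegative, so that the real
    Cauchy-Schwarz inequality applies. If the pairing is 0, division by 0 gives
    \<open>c = 0\<close>; hence only \<open>cmod c \<le> 1\<close>.\<close>
  define c where "c = cnj (cinner f g) / of_real (cmod (cinner f g))"
  have "cmod c \<le> 1" by (simp add: c_def norm_divide)
  have "c * cinner f g = of_real (cmod (cinner f g))"
  proof (cases "cinner f g = 0")
    case False
    have "cnj (cinner f g) * cinner f g = of_real (cmod (cinner f g)) * of_real (cmod (cinner f g))"
      by (metis complex_norm_square mult.commute of_real_mult power2_eq_square)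
    with False show ?thesis by (simp add: c_def)
  qed (simp add: c_def)
  then have "cmod (cinner f g) = inner (cscale c f) g"
    by (simp add: Re_cinner[symmetric] cinner_cscale_left)
  also have "\<dots> \<le> norm (cscale c f) * norm g"
    by (rule norm_cauchy_schwarz)
  also have "\<dots> \<le> norm f * norm g"
    using \<open>cmod c \<le> 1\<close> by (auto simp: norm_cscale intro!: mult_right_mono mult_left_le_one_le)
  finally show ?thesis .
qed

lemma bounded_linear_cinner_left: "bounded_linear (\<lambda>f. cinner f g)"
  by (rule bounded_linear_intro[where K = "norm g"])
     (auto simp: cinner_add_left cscale_of_real[symmetric] cinner_cscale_left scaleR_conv_of_real cmod_cinner_le)

lemma bounded_linear_cinner_right: "bounded_linear (\<lambda>g. cinner f g)"
  by (rule bounded_linear_intro[where K = "norm f"])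
     (auto simp: cinner_add_right cscale_of_real[symmetric] cinner_cscale_right scaleR_conv_of_real
       intro: order_trans[OF cmod_cinner_le] simp: mult.commute)

lemma cinner_ext_right: "(\<And>g. cinner g f = cinner g f') \<Longrightarrow> f = f'"
  using cinner_self_eq_0[of "f - f'"] by (simp add: cinner_diff_right)

section \<open>Squared norms as extended-valued integrals, and completeness\<close>

abbreviation l2_mass :: "('a::euclidean_space \<Rightarrow> complex) \<Rightarrow> ennreal" where
  "l2_mass f \<equiv> (\<integral>\<^sup>+x. ennreal ((cmod (f x))\<^sup>2) \<partial>lborel)"

lemma norm_l2_abs:
  assumes "square_integrable f"
  shows "ennreal ((norm (abs_l2 f))\<^sup>2) = l2_mass f"
proof -
  have "(norm (abs_l2 f))\<^sup>2 = (LINT x|lborel. (cmod (f x))\<^sup>2)"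
    using cinner_abs[OF assms assms]
    by (simp add: cinner_self mult_cnj_cmod2 del: of_real_power)
  then show ?thesis
    using assms by (simp add: nn_integral_eq_integral square_integrable_def)
qed

lemma norm_l2_rep: "ennreal ((norm f)\<^sup>2) = l2_mass (rep_l2 f)"
  using norm_l2_abs[OF square_integrable_rep[of f]] by (simp add: abs_rep_l2)

lemma square_integrableI:
  assumes "f \<in> borel_measurable borel" "l2_mass f < \<infinity>"
  shows "square_integrable f"
  using assms by (auto simp: square_integrable_def intro!: integrableI_nonneg)

text \<open>A rapidly convergent subsequence converges almost everywhere, and Fatou's lemma shows
  that its pointwise limit is square integrable and is the limit in norm.\<close>

lemma Cauchy_l2_convergent:
  fixes X :: "nat \<Rightarrow> 'a::euclidean_space l2"
  assumes "Cauchy X"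
  shows "convergent X"
proof -
  have "\<forall>k. \<exists>N. \<forall>m\<ge>N. \<forall>n\<ge>N. dist (X m) (X n) < (1/2) ^ k"
    using metric_CauchyD[OF assms] by simp
  then obtain N where N: "\<And>k m n. m \<ge> N k \<Longrightarrow> n \<ge> N k \<Longrightarrow> dist (X m) (X n) < (1/2) ^ k"
    by metis
  \<comment> \<open>Summing the thresholds gives an index \<open>r j\<close> that lies beyond
    \<open>N k\<close> for every \<open>k \<le> j\<close>.\<close>
  define r where "r k = (\<Sum>j\<le>k. N j)" for k
  have r: "N k \<le> r j" if "k \<le> j" for k j
    unfolding r_def using that by (intro member_le_sum) auto
  define Y where "Y k = X (r k)" for k
  have Y: "dist (Y j) (Y k) < (1/2) ^ k" if "k \<le> j" for j k
    unfolding Y_def using N[of k "r j" "r k"] r[of k j] r[of k k] that by simp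
  \<comment> \<open>The increments. Their squared norms are at most \<open>(1/4) ^ k\<close>, so
    even with the weight \<open>2 ^ k\<close> the sum has a finite integral. Almost everywhere
    \<open>2 ^ k * (cmod (a k x))\<^sup>2\<close> is therefore bounded, and \<open>a k x\<close> is
    dominated by a geometric sequence of ratio \<open>sqrt (1/2)\<close>.\<close>
  define a where "a k x = rep_l2 (Y (Suc k)) x - rep_l2 (Y k) x" for k x
  have [measurable]: "a k \<in> borel_measurable borel" for k
    unfolding a_def by simp
  have dist2: "(\<integral>\<^sup>+x. ennreal ((cmod (rep_l2 f x - rep_l2 g x))\<^sup>2) \<partial>lborel) = ennreal ((dist f g)\<^sup>2)"
    for f g :: "'a l2"
  proof -
    have "AE x in lborel. ennreal ((cmod (rep_l2 f x - rep_l2 g x))\<^sup>2) = ennreal ((cmod (rep_l2 (f - g) x))\<^sup>2)"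
      using rep_minus[of f g] by eventually_elim simp
    then show ?thesis
      unfolding dist_norm norm_l2_rep by (rule nn_integral_cong_AE)
  qed
  have "(\<integral>\<^sup>+x. (\<Sum>k. ennreal (2 ^ k * (cmod (a k x))\<^sup>2)) \<partial>lborel)
      = (\<Sum>k. \<integral>\<^sup>+x. ennreal (2 ^ k * (cmod (a k x))\<^sup>2) \<partial>lborel)"
    by (intro nn_integral_suminf) simp
  also have "\<dots> = (\<Sum>k. ennreal (2 ^ k * (dist (Y (Suc k)) (Y k))\<^sup>2))"
    by (simp add: ennreal_mult nn_integral_cmult a_def dist2)
  also have "\<dots> \<le> (\<Sum>k. ennreal ((1/2) ^ k))"
  proof (intro suminf_le allI ennreal_leI)
    fix k
    have "2 ^ k * (dist (Y (Suc k)) (Y k))\<^sup>2 \<le> 2 ^ k * ((1/2) ^ k)\<^sup>2"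
      using Y[of k "Suc k"] by (intro mult_left_mono power_mono) auto
    also have "\<dots> = (1/2 :: real) ^ k"
      by (simp add: power2_eq_square power_mult_distrib[symmetric] mult.assoc[symmetric])
    finally show "2 ^ k * (dist (Y (Suc k)) (Y k))\<^sup>2 \<le> (1/2) ^ k" .
  qed auto
  also have "\<dots> < \<infinity>"
    by (subst suminf_ennreal2) (auto intro: summable_geometric)
  finally have "AE x in lborel. (\<Sum>k. ennreal (2 ^ k * (cmod (a k x))\<^sup>2)) \<noteq> \<infinity>"
    by (intro nn_integral_PInf_AE) (auto simp: less_top)
  then have conv: "AE x in lborel. convergent (\<lambda>k. rep_l2 (Y k) x)"
  proof eventually_elim
    fix x assume fin: "(\<Sum>k. ennreal (2 ^ k * (cmod (a k x))\<^sup>2)) \<noteq> \<infinity>"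
    have "summable (\<lambda>k. 2 ^ k * (cmod (a k x))\<^sup>2)"
      by (rule summable_suminf_not_top) (use fin in auto)
    then have "Bseq (\<lambda>k. 2 ^ k * (cmod (a k x))\<^sup>2)"
      by (intro convergent_imp_Bseq convergentI[OF summable_LIMSEQ_zero])
    then obtain C where C: "C > 0" "\<And>k. 2 ^ k * (cmod (a k x))\<^sup>2 \<le> C"
      by (auto simp: Bseq_def)
    have bound: "cmod (a k x) \<le> sqrt C * sqrt (1/2) ^ k" for k
    proof (rule power2_le_imp_le)
      have "(cmod (a k x))\<^sup>2 \<le> C / 2 ^ k" using C(2)[of k] by (simp add: field_simps)
      also have "\<dots> = (sqrt C * sqrt (1/2) ^ k)\<^sup>2"
      proof -
        have "(sqrt (1/2) ^ k)\<^sup>2 = (sqrt (1/2) * sqrt (1/2)) ^ k"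
          by (simp only: power2_eq_square power_mult_distrib)
        then show ?thesis using C(1) by (simp add: power_mult_distrib power_divide)
      qed
      finally show "(cmod (a k x))\<^sup>2 \<le> (sqrt C * sqrt (1/2) ^ k)\<^sup>2" .
    qed (use C(1) in simp)
    have "sqrt (1/2) < (1::real)" by simp
    then have "summable (\<lambda>k. sqrt C * sqrt (1/2) ^ k)"
      by (intro summable_mult summable_geometric) simp
    then have "summable (\<lambda>k. a k x)"
      by (rule summable_comparison_test') (use bound in auto)
    then have "convergent (\<lambda>n. rep_l2 (Y 0) x + (\<Sum>k<n. a k x))"
      by (intro convergent_add convergent_const) (simp add: summable_iff_convergent)
    then show "convergent (\<lambda>k. rep_l2 (Y k) x)"
      using sum_lessThan_telescope[of "\<lambda>k. rep_l2 (Y k) x"] by (simp add: a_def)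
  qed
  define F where "F x = lim (\<lambda>k. rep_l2 (Y k) x)" for x
  have [measurable]: "F \<in> borel_measurable borel"
    unfolding F_def by measurable
  have lim: "AE x in lborel. (\<lambda>k. rep_l2 (Y k) x) \<longlonglongrightarrow> F x"
    using conv by eventually_elim (simp add: F_def convergent_LIMSEQ_iff)
  \<comment> \<open>This one estimate yields both the square integrability of \<open>F\<close> and
    its distance to \<open>Y k\<close>.\<close>
  have Fatou: "(\<integral>\<^sup>+x. ennreal ((cmod (F x - rep_l2 (Y k) x))\<^sup>2) \<partial>lborel) \<le> ennreal (((1/2) ^ k)\<^sup>2)" for k
  proof -
    have "(\<integral>\<^sup>+x. ennreal ((cmod (F x - rep_l2 (Y k) x))\<^sup>2) \<partial>lborel)
       = (\<integral>\<^sup>+x. liminf (\<lambda>j. ennreal ((cmod (rep_l2 (Y j) x - rep_l2 (Y k) x))\<^sup>2)) \<partial>lborel)"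
    proof (rule nn_integral_cong_AE)
      show "AE x in lborel. ennreal ((cmod (F x - rep_l2 (Y k) x))\<^sup>2)
        = liminf (\<lambda>j. ennreal ((cmod (rep_l2 (Y j) x - rep_l2 (Y k) x))\<^sup>2))"
        using lim
      proof eventually_elim
        fix x assume "(\<lambda>k. rep_l2 (Y k) x) \<longlonglongrightarrow> F x"
        then have "(\<lambda>j. ennreal ((cmod (rep_l2 (Y j) x - rep_l2 (Y k) x))\<^sup>2)) \<longlonglongrightarrow> ennreal ((cmod (F x - rep_l2 (Y k) x))\<^sup>2)"
          by (intro tendsto_intros)
        then show "ennreal ((cmod (F x - rep_l2 (Y k) x))\<^sup>2)
          = liminf (\<lambda>j. ennreal ((cmod (rep_l2 (Y j) x - rep_l2 (Y k) x))\<^sup>2))"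
          by (intro lim_imp_Liminf[symmetric]) auto
      qed
    qed
    also have "\<dots> \<le> liminf (\<lambda>j. \<integral>\<^sup>+x. ennreal ((cmod (rep_l2 (Y j) x - rep_l2 (Y k) x))\<^sup>2) \<partial>lborel)"
      by (intro nn_integral_liminf) simp
    also have "\<dots> = liminf (\<lambda>j. ennreal ((dist (Y j) (Y k))\<^sup>2))"
      by (simp add: dist2)
    also have "\<dots> \<le> liminf (\<lambda>j. ennreal (((1/2) ^ k)\<^sup>2))"
      using Y[of k] by (intro Liminf_mono eventually_sequentiallyI[of k] ennreal_leI power_mono) (auto intro: less_imp_le)
    also have "\<dots> = ennreal (((1/2) ^ k)\<^sup>2)" by (intro lim_imp_Liminf) auto
    finally show ?thesis .
  qed
  have sq: "square_integrable (\<lambda>x. F x - rep_l2 (Y k) x)" for k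
    using Fatou[of k] by (intro square_integrableI) (auto intro: le_less_trans ennreal_less_top)
  have "square_integrable (\<lambda>x. (F x - rep_l2 (Y 0) x) + rep_l2 (Y 0) x)"
    by (intro square_integrable_add sq square_integrable_rep)
  then have sqF: "square_integrable F" by simp
  define G where "G = abs_l2 F"
  have GY: "dist G (Y k) \<le> (1/2) ^ k" for k
  proof -
    have "ennreal ((dist G (Y k))\<^sup>2) = (\<integral>\<^sup>+x. ennreal ((cmod (F x - rep_l2 (Y k) x))\<^sup>2) \<partial>lborel)"
      unfolding dist2[symmetric] G_def using rep_abs_l2[OF sqF]
      by (intro nn_integral_cong_AE) (auto elim!: eventually_mono)
    then have "ennreal ((dist G (Y k))\<^sup>2) \<le> ennreal (((1/2) ^ k)\<^sup>2)"
      using Fatou[of k] by simp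
    then have "(dist G (Y k))\<^sup>2 \<le> ((1/2) ^ k)\<^sup>2"
      by (subst (asm) ennreal_le_iff) auto
    then show ?thesis by (rule power2_le_imp_le) simp
  qed
  have "X \<longlonglongrightarrow> G"
  proof (rule metric_LIMSEQ_I)
    fix e :: real assume "e > 0"
    then obtain k where k: "(1/2) ^ k < e / 2"
      using real_arch_pow_inv[of "e/2" "1/2"] by auto
    show "\<exists>no. \<forall>n\<ge>no. dist (X n) G < e"
    proof (intro exI[of _ "N k"] allI impI)
      fix n assume "n \<ge> N k"
      then have "dist (X n) (Y k) < (1/2) ^ k"
        unfolding Y_def using N[of k n "r k"] r[of k k] by simp
      then show "dist (X n) G < e"
        using GY[of k] k dist_triangle[of "X n" G "Y k"] by (simp add: dist_commute)
    qed
  qed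
  then show ?thesis by (rule convergentI)
qed

instance l2 :: (euclidean_space) complete_space
  by standard (rule Cauchy_l2_convergent)

section \<open>Orthonormal systems, Parseval's equality and the Riesz representation theorem\<close>

definition orthonormal_on :: "('i \<Rightarrow> 'a::euclidean_space l2) \<Rightarrow> 'i set \<Rightarrow> bool" where
  "orthonormal_on e I \<longleftrightarrow> (\<forall>i\<in>I. \<forall>j\<in>I. cinner (e i) (e j) = (if i = j then 1 else 0))"

definition total_on :: "('i \<Rightarrow> 'a::euclidean_space l2) \<Rightarrow> 'i set \<Rightarrow> bool" where
  "total_on e I \<longleftrightarrow> (\<forall>f. (\<forall>i\<in>I. cinner f (e i) = 0) \<longrightarrow> f = 0)"

lemma orthonormal_basis_iff:
  "orthonormal_basis B \<longleftrightarrow> orthonormal_on (\<lambda>e. e) B \<and> total_on (\<lambda>e. e) B"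
  by (simp add: orthonormal_basis_def orthonormal_on_def total_on_def)

lemma cinner_sum_left: "cinner (\<Sum>i\<in>F. f i) g = (\<Sum>i\<in>F. cinner (f i) g)"
  by (rule linear_sum[OF bounded_linear.linear[OF bounded_linear_cinner_left]])

lemma cinner_sum_right: "cinner g (\<Sum>i\<in>F. f i) = (\<Sum>i\<in>F. cinner g (f i))"
  by (rule linear_sum[OF bounded_linear.linear[OF bounded_linear_cinner_right]])

lemma cinner_combination:
  assumes "orthonormal_on e I" "finite F" "F \<subseteq> I" "j \<in> I"
  shows "cinner (\<Sum>i\<in>F. cscale (c i) (e i)) (e j) = (if j \<in> F then c j else 0)"
proof -
  have "cinner (\<Sum>i\<in>F. cscale (c i) (e i)) (e j) = (\<Sum>i\<in>F. if i = j then c j else 0)"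
    unfolding cinner_sum_left cinner_cscale_left
    using assms by (intro sum.cong) (auto simp: orthonormal_on_def)
  then show ?thesis using assms(2) by simp
qed

lemma norm_combination:
  assumes "orthonormal_on e I" "finite F" "F \<subseteq> I"
  shows "(norm (\<Sum>i\<in>F. cscale (c i) (e i)))\<^sup>2 = (\<Sum>i\<in>F. (cmod (c i))\<^sup>2)"
proof -
  let ?v = "\<Sum>i\<in>F. cscale (c i) (e i)"
  have "cinner ?v ?v = (\<Sum>j\<in>F. cnj (c j) * cinner ?v (e j))"
    by (simp add: cinner_sum_right cinner_cscale_right)
  also have "\<dots> = (\<Sum>j\<in>F. of_real ((cmod (c j))\<^sup>2))"
    using assms by (intro sum.cong refl) (subst cinner_combination[of e I], auto simp: mult.commute[of "cnj _"] mult_cnj_cmod2 simp del: of_real_power)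
  finally have "complex_of_real ((norm ?v)\<^sup>2) = of_real (\<Sum>j\<in>F. (cmod (c j))\<^sup>2)"
    unfolding cinner_self of_real_sum .
  then show ?thesis using of_real_eq_iff by blast
qed

lemma norm_residual:
  assumes "orthonormal_on e I" "finite F" "F \<subseteq> I"
  shows "(norm (f - (\<Sum>i\<in>F. cscale (cinner f (e i)) (e i))))\<^sup>2
       = (norm f)\<^sup>2 - (\<Sum>i\<in>F. (cmod (cinner f (e i)))\<^sup>2)"
proof -
  let ?v = "\<Sum>i\<in>F. cscale (cinner f (e i)) (e i)"
  have "cinner f ?v = (\<Sum>i\<in>F. of_real ((cmod (cinner f (e i)))\<^sup>2))"
    by (simp add: cinner_sum_right cinner_cscale_right mult_cnj_cmod2 mult.commute[of "cnj _"] del: of_real_power)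
  then have "inner f ?v = (\<Sum>i\<in>F. (cmod (cinner f (e i)))\<^sup>2)"
    by (simp add: Re_cinner[symmetric] del: of_real_power)
  moreover have "(norm (f - ?v))\<^sup>2 = (norm f)\<^sup>2 - 2 * inner f ?v + (norm ?v)\<^sup>2"
    by (simp add: power2_norm_eq_inner inner_diff_left inner_diff_right inner_commute)
  ultimately show ?thesis
    by (simp add: norm_combination[OF assms])
qed

lemma Bessel_finite:
  assumes "orthonormal_on e I" "finite F" "F \<subseteq> I"
  shows "(\<Sum>i\<in>F. (cmod (cinner f (e i)))\<^sup>2) \<le> (norm f)\<^sup>2"
  using norm_residual[OF assms, of f] zero_le_power2 by (metis diff_ge_0_iff_ge)

lemma Bessel_summable:
  assumes "orthonormal_on e I"
  shows "(\<lambda>i. (cmod (cinner f (e i)))\<^sup>2) summable_on I"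
  using Bessel_finite[OF assms, of _ f]
  by (intro nonneg_bdd_above_summable_on) (auto simp: bdd_above_def)

text \<open>The index set is arbitrary, so the finite partial sums form a net. Increasing finite
  sets \<open>F n\<close> that miss less than \<open>(1/2)^n\<close> of the total mass replace it by
  a Cauchy sequence.\<close>

lemma Riesz_Fischer:
  assumes on: "orthonormal_on e I" and sm: "(\<lambda>i. (cmod (c i))\<^sup>2) summable_on I"
  obtains h where "\<And>i. i \<in> I \<Longrightarrow> cinner h (e i) = c i"
    and "(norm h)\<^sup>2 = (\<Sum>\<^sub>\<infinity>i\<in>I. (cmod (c i))\<^sup>2)"
proof -
  let ?s = "\<Sum>\<^sub>\<infinity>i\<in>I. (cmod (c i))\<^sup>2"
  have "((\<lambda>i. (cmod (c i))\<^sup>2) has_sum ?s) I" using sm by simp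
  have "\<exists>F. finite F \<and> F \<subseteq> I \<and> dist (\<Sum>i\<in>F. (cmod (c i))\<^sup>2) ?s < (1/2)^n" for n
  proof -
    obtain F where F: "finite F" "F \<subseteq> I" "dist (\<Sum>i\<in>F. (cmod (c i))\<^sup>2) ?s \<le> (1/2)^Suc n"
      using infsum_finite_approximation[OF sm, of "(1/2)^Suc n"] by auto
    have "(1/2)^Suc n < (1/2 :: real)^n" by simp
    with F show ?thesis by (meson le_less_trans)
  qed
  then obtain F0 where F0: "\<And>n. finite (F0 n)" "\<And>n. F0 n \<subseteq> I"
      "\<And>n. dist (\<Sum>i\<in>F0 n. (cmod (c i))\<^sup>2) ?s < (1/2)^n"
    by metis
  define F where "F n = (\<Union>k\<le>n. F0 k)" for n
  have F: "finite (F n)" "F n \<subseteq> I" for n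
    using F0 by (auto simp: F_def)
  have le_s: "(\<Sum>i\<in>G. (cmod (c i))\<^sup>2) \<le> ?s" if "finite G" "G \<subseteq> I" for G
    using that by (intro finite_sum_le_infsum sm) auto
  have Fs: "?s - (1/2)^n < (\<Sum>i\<in>F n. (cmod (c i))\<^sup>2)" for n
  proof -
    have "(\<Sum>i\<in>F0 n. (cmod (c i))\<^sup>2) \<le> (\<Sum>i\<in>F n. (cmod (c i))\<^sup>2)"
      using F by (intro sum_mono2) (auto simp: F_def)
    then show ?thesis using F0(3)[of n] by (simp add: dist_real_def)
  qed
  define S where "S n = (\<Sum>i\<in>F n. cscale (c i) (e i))" for n
  have diff: "(norm (S n - S m))\<^sup>2 \<le> (1/2)^m" if "m \<le> n" for m n
  proof -
    have sub: "F m \<subseteq> F n" unfolding F_def using that by (intro UN_mono) auto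
    have "S n - S m = (\<Sum>i\<in>F n - F m. cscale (c i) (e i))"
      unfolding S_def using F sub by (simp add: sum_diff)
    moreover have "(norm (\<Sum>i\<in>F n - F m. cscale (c i) (e i)))\<^sup>2 = (\<Sum>i\<in>F n - F m. (cmod (c i))\<^sup>2)"
      using F[of n] by (intro norm_combination[OF on]) auto
    moreover have "\<dots> = (\<Sum>i\<in>F n. (cmod (c i))\<^sup>2) - (\<Sum>i\<in>F m. (cmod (c i))\<^sup>2)"
      using F sub by (simp add: sum_diff)
    ultimately show ?thesis using Fs[of m] le_s[OF F, of n] by simp
  qed
  have "Cauchy S"
  proof (rule metric_CauchyI)
    fix d :: real assume "d > 0"
    then obtain m where m: "(1/2)^m < (d/2)\<^sup>2"
      using real_arch_pow_inv[of "(d/2)\<^sup>2" "1/2"] by auto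
    have close: "dist (S n) (S m) < d / 2" if "n \<ge> m" for n
    proof -
      have "(norm (S n - S m))\<^sup>2 < (d/2)\<^sup>2" by (rule le_less_trans[OF diff[OF that] m])
      then show ?thesis unfolding dist_norm by (rule power2_less_imp_less) (use \<open>d > 0\<close> in simp)
    qed
    show "\<exists>M. \<forall>k\<ge>M. \<forall>n\<ge>M. dist (S k) (S n) < d"
    proof (intro exI[of _ m] allI impI)
      fix k n assume "k \<ge> m" "n \<ge> m"
      then show "dist (S k) (S n) < d"
        using close[of k] close[of n] dist_triangle2[of "S k" "S n" "S m"] by linarith
    qed
  qed
  then obtain h where h: "S \<longlonglongrightarrow> h"
    using Cauchy_convergent convergent_def by blast
  show thesis
  proof
    fix j assume j: "j \<in> I"
    have "(\<lambda>n. cinner (S n) (e j)) \<longlonglongrightarrow> cinner h (e j)"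
      by (rule bounded_linear.tendsto[OF bounded_linear_cinner_left h])
    moreover have "(\<lambda>n. cinner (S n) (e j)) \<longlonglongrightarrow> c j"
    proof (rule metric_LIMSEQ_I)
      fix d :: real assume "d > 0"
      then obtain m where m: "(1/2)^m < d\<^sup>2"
        using real_arch_pow_inv[of "d\<^sup>2" "1/2"] by auto
      show "\<exists>m. \<forall>n\<ge>m. dist (cinner (S n) (e j)) (c j) < d"
      proof (intro exI[of _ m] allI impI)
        fix n assume n: "n \<ge> m"
        show "dist (cinner (S n) (e j)) (c j) < d"
        proof (cases "j \<in> F n")
          case True
          then show ?thesis unfolding S_def using F \<open>d > 0\<close> j
            by (subst cinner_combination[OF on]) auto
        next
          case False
          \<comment> \<open>An index outside \<open>F n\<close> contributes to the missing mass
            only, which bounds its coefficient; the sets \<open>F n\<close> need not exhaust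
            \<open>I\<close>.\<close>
          have "(\<Sum>i\<in>insert j (F n). (cmod (c i))\<^sup>2) \<le> ?s" using F j by (intro le_s) auto
          then have "(cmod (c j))\<^sup>2 < (1/2)^n" using Fs[of n] F False by simp
          also have "\<dots> \<le> (1/2)^m" using n by (intro power_decreasing) auto
          finally have "(cmod (c j))\<^sup>2 < d\<^sup>2" using m by simp
          then have "cmod (c j) < d" by (rule power2_less_imp_less) (use \<open>d > 0\<close> in simp)
          then show ?thesis unfolding S_def using F j False
            by (subst cinner_combination[OF on]) auto
        qed
      qed
    qed
    ultimately show "cinner h (e j) = c j" by (rule LIMSEQ_unique)
  next
    have "(\<lambda>n. (norm (S n))\<^sup>2) \<longlonglongrightarrow> (norm h)\<^sup>2" using h by (intro tendsto_intros)
    moreover have "(\<lambda>n. (norm (S n))\<^sup>2) \<longlonglongrightarrow> ?s"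
    proof (rule tendsto_sandwich)
      show "(\<lambda>n. ?s - (1/2)^n) \<longlonglongrightarrow> ?s" by (rule tendsto_eq_intros LIMSEQ_power_zero | simp)+
      show "\<forall>\<^sub>F n in sequentially. ?s - (1/2)^n \<le> (norm (S n))\<^sup>2"
        unfolding S_def norm_combination[OF on F] by (intro always_eventually allI less_imp_le Fs)
      show "\<forall>\<^sub>F n in sequentially. (norm (S n))\<^sup>2 \<le> ?s"
        unfolding S_def norm_combination[OF on F] by (intro always_eventually allI le_s F)
    qed simp
    ultimately show "(norm h)\<^sup>2 = ?s" by (rule LIMSEQ_unique)
  qed
qed

text \<open>Riesz-Fischer applied to the coefficients of \<open>f\<close> gives a vector with the
  same coefficients, which totality identifies with \<open>f\<close>. Its norm formula is Parseval's
  equality, and \<open>norm_residual\<close> turns that into convergence of the partial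
  sums.\<close>

lemma Fourier_expansion:
  assumes on: "orthonormal_on e I" and tot: "total_on e I"
  shows "((\<lambda>i. cscale (cinner f (e i)) (e i)) has_sum f) I"
proof -
  obtain h where h: "\<And>i. i \<in> I \<Longrightarrow> cinner h (e i) = cinner f (e i)"
    "(norm h)\<^sup>2 = (\<Sum>\<^sub>\<infinity>i\<in>I. (cmod (cinner f (e i)))\<^sup>2)"
    using Riesz_Fischer[OF on Bessel_summable[OF on, of f]] by blast
  have "h - f = 0"
    using tot h(1) unfolding total_on_def by (metis cinner_diff_left diff_self)
  then have "((\<lambda>i. (cmod (cinner f (e i)))\<^sup>2) has_sum (norm f)\<^sup>2) I"
    using Bessel_summable[OF on, of f] h(2) by (simp add: has_sum_infsum)
  then have "((\<lambda>F. (norm f)\<^sup>2 - (\<Sum>i\<in>F. (cmod (cinner f (e i)))\<^sup>2)) \<longlongrightarrow> (norm f)\<^sup>2 - (norm f)\<^sup>2) (finite_subsets_at_top I)"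
    unfolding has_sum_def by (intro tendsto_intros)
  then have "((\<lambda>F. sqrt ((norm f)\<^sup>2 - (\<Sum>i\<in>F. (cmod (cinner f (e i)))\<^sup>2))) \<longlongrightarrow> sqrt 0) (finite_subsets_at_top I)"
    by (intro tendsto_intros) simp
  moreover have "\<forall>\<^sub>F F in finite_subsets_at_top I. sqrt ((norm f)\<^sup>2 - (\<Sum>i\<in>F. (cmod (cinner f (e i)))\<^sup>2))
      = norm (f - (\<Sum>i\<in>F. cscale (cinner f (e i)) (e i)))"
    by (rule eventually_finite_subsets_at_top_weakI) (simp add: norm_residual[OF on, symmetric])
  ultimately have "((\<lambda>F. norm (f - (\<Sum>i\<in>F. cscale (cinner f (e i)) (e i)))) \<longlongrightarrow> 0) (finite_subsets_at_top I)"
    using tendsto_cong by force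
  then have "((\<lambda>F. f - (\<Sum>i\<in>F. cscale (cinner f (e i)) (e i))) \<longlongrightarrow> 0) (finite_subsets_at_top I)"
    by (rule tendsto_norm_zero_cancel)
  then have "((\<lambda>F. f - (f - (\<Sum>i\<in>F. cscale (cinner f (e i)) (e i)))) \<longlongrightarrow> f - 0) (finite_subsets_at_top I)"
    by (intro tendsto_intros)
  then show ?thesis by (simp add: has_sum_def)
qed

lemma Parseval:
  assumes "orthonormal_on e I" "total_on e I"
  shows "((\<lambda>i. cinner f (e i) * cinner (e i) g) has_sum cinner f g) I"
  using has_sum_bounded_linear[OF bounded_linear_cinner_left Fourier_expansion[OF assms, of f], of g]
  by (simp add: o_def cinner_cscale_left)

lemma Parseval_norm:
  assumes "orthonormal_on e I" "total_on e I"
  shows "((\<lambda>i. (cmod (cinner f (e i)))\<^sup>2) has_sum (norm f)\<^sup>2) I"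
proof -
  have "((\<lambda>i. Re (cinner f (e i) * cinner (e i) f)) has_sum Re (cinner f f)) I"
    by (rule has_sum_Re[OF Parseval[OF assms]])
  moreover have "Re (cinner f (e i) * cinner (e i) f) = (cmod (cinner f (e i)))\<^sup>2" for i
    by (subst (2) cinner_commute) (simp add: mult_cnj_cmod2 del: of_real_power)
  ultimately show ?thesis by (simp add: cinner_self del: of_real_power)
qed

text \<open>Zorn's lemma: a maximal orthonormal set is total, since a normalised vector orthogonal
  to it could be added. \<open>hs_inner\<close> selects a basis by \<open>SOME\<close>, so its value
  rests on this existence.\<close>

lemma orthonormal_basis_exists: "\<exists>B :: 'a::euclidean_space l2 set. orthonormal_basis B"
proof -
  let ?A = "{B :: 'a l2 set. orthonormal_on (\<lambda>e. e) B}"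
  have "\<exists>M\<in>?A. \<forall>X\<in>?A. M \<subseteq> X \<longrightarrow> X = M"
  proof (rule subset_Zorn_nonempty)
    show "?A \<noteq> {}" by (auto simp: orthonormal_on_def intro!: exI[of _ "{}"])
    fix C assume C: "C \<noteq> {}" "subset.chain ?A C"
    show "\<Union>C \<in> ?A"
      unfolding mem_Collect_eq orthonormal_on_def
    proof (intro ballI)
      fix e e' assume "e \<in> \<Union>C" "e' \<in> \<Union>C"
      then obtain X Y where "X \<in> C" "Y \<in> C" "e \<in> X" "e' \<in> Y" by auto
      then obtain Z where "Z \<in> C" "e \<in> Z" "e' \<in> Z"
        using C(2) unfolding subset_chain_def by (metis subset_iff)
      then show "cinner e e' = (if e = e' then 1 else 0)"
        using C(2) unfolding subset_chain_def orthonormal_on_def by blast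
    qed
  qed
  then obtain M :: "'a l2 set" where M: "orthonormal_on (\<lambda>e. e) M" and max: "\<forall>X. orthonormal_on (\<lambda>e. e) X \<longrightarrow> M \<subseteq> X \<longrightarrow> X = M"
    by auto
  have "total_on (\<lambda>e. e) M"
    unfolding total_on_def
  proof (intro allI impI)
    fix f assume f: "\<forall>i\<in>M. cinner f i = 0"
    show "f = 0"
    proof (rule ccontr)
      assume "f \<noteq> 0"
      define u where "u = cscale (of_real (1 / norm f)) f"
      have u1: "cinner u u = 1"
        using \<open>f \<noteq> 0\<close> by (simp add: cinner_self u_def norm_cscale norm_divide)
      have u0: "cinner u i = 0" "cinner i u = 0" if "i \<in> M" for i
      proof -
        show "cinner u i = 0" using f that by (simp add: u_def cinner_cscale_left)
        then show "cinner i u = 0" by (subst cinner_commute) simp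
      qed
      have "orthonormal_on (\<lambda>e. e) (insert u M)"
        using M u0 u1 by (auto simp: orthonormal_on_def)
      then have "u \<in> M" using max by (metis insertI1 subset_insertI)
      then show False using u0 u1 by auto
    qed
  qed
  with M show ?thesis unfolding orthonormal_basis_iff by blast
qed

text \<open>In an orthonormal basis the representing vector must have the coefficients
  \<open>cnj (\<phi> e)\<close>; boundedness of the functional makes them square summable.\<close>

lemma Riesz_representation:
  assumes bl: "bounded_linear \<phi>" and cl: "\<And>c f. \<phi> (cscale c f) = c * \<phi> f"
  obtains h where "\<And>f. \<phi> f = cinner f h"
proof -
  obtain B :: "'a l2 set" where B: "orthonormal_on (\<lambda>e. e) B" "total_on (\<lambda>e. e) B"
    using orthonormal_basis_exists orthonormal_basis_iff by blast
  obtain K where K: "K > 0" "\<And>f. norm (\<phi> f) \<le> norm f * K"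
    using bounded_linear.pos_bounded[OF bl] by blast
  have "(\<Sum>e\<in>F. (cmod (cnj (\<phi> e)))\<^sup>2) \<le> K\<^sup>2" if F: "finite F" "F \<subseteq> B" for F
  proof -
    let ?v = "\<Sum>e\<in>F. cscale (cnj (\<phi> e)) e" and ?s = "\<Sum>e\<in>F. (cmod (cnj (\<phi> e)))\<^sup>2"
    have nv: "(norm ?v)\<^sup>2 = ?s" by (rule norm_combination[OF B(1) F])
    \<comment> \<open>On its own coefficient vector the functional returns the squared norm, so
      \<open>(norm ?v)\<^sup>2 \<le> norm ?v * K\<close>.\<close>
    have "\<phi> ?v = (\<Sum>e\<in>F. cnj (\<phi> e) * \<phi> e)"
      unfolding linear_sum[OF bounded_linear.linear[OF bl]] cl ..
    also have "\<dots> = of_real ?s"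
      unfolding of_real_sum complex_norm_square complex_cnj_cnj ..
    finally have "norm (\<phi> ?v) = \<bar>?s\<bar>" by (simp only: norm_of_real)
    then have "?s = norm (\<phi> ?v)" by (simp add: sum_nonneg)
    also have "\<dots> \<le> norm ?v * K" by (rule K)
    finally have "norm ?v * norm ?v \<le> norm ?v * K" using nv by (simp add: power2_eq_square)
    then have "norm ?v \<le> K" using K(1) by (cases "norm ?v = 0") auto
    then have "(norm ?v)\<^sup>2 \<le> K\<^sup>2" by (rule power_mono) simp
    then show ?thesis unfolding nv .
  qed
  then have "(\<lambda>e. (cmod (cnj (\<phi> e)))\<^sup>2) summable_on B"
    by (intro nonneg_bdd_above_summable_on) (auto simp: bdd_above_def)
  then obtain h where h: "\<And>e. e \<in> B \<Longrightarrow> cinner h e = cnj (\<phi> e)"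
    using Riesz_Fischer[OF B(1)] by metis
  have "\<phi> f = cinner f h" for f
  proof -
    have "((\<lambda>e. cinner f e * \<phi> e) has_sum \<phi> f) B"
      using has_sum_bounded_linear[OF bl Fourier_expansion[OF B, of f]] by (simp add: o_def cl)
    moreover have "((\<lambda>e. cinner f e * \<phi> e) has_sum cinner f h) B"
    proof -
      have "cinner e h = \<phi> e" if "e \<in> B" for e
        using h[OF that] by (subst cinner_commute) simp
      then show ?thesis using Parseval[OF B, of f h] by (simp cong: has_sum_cong)
    qed
    ultimately show ?thesis by (rule has_sum_unique)
  qed
  then show thesis by (rule that)
qed

lemma bounded_clinear_eqI:
  assumes "orthonormal_basis B" "bounded_clinear S" "bounded_clinear T" "\<And>e. e \<in> B \<Longrightarrow> S e = T e"
  shows "S = T"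
proof
  fix f
  have *: "((\<lambda>e. cscale (cinner f e) (R e)) has_sum R f) B" if "bounded_clinear R" for R :: "'a l2 \<Rightarrow> 'b l2"
    using has_sum_bounded_linear[OF _ Fourier_expansion[of "\<lambda>e. e" B f], of R] assms(1) that
    by (simp add: o_def bounded_clinear_def orthonormal_basis_iff)
  have "((\<lambda>e. cscale (cinner f e) (T e)) has_sum S f) B"
    using *[OF assms(2)] assms(4) by (simp cong: has_sum_cong)
  then show "S f = T f" using *[OF assms(3)] has_sum_unique by blast
qed

section \<open>Lebesgue measure on phase space\<close>

definition join :: "real ^ 'm \<Rightarrow> real ^ 'm \<Rightarrow> real ^ ('m::finite + 'm)" where
  "join x w = (\<chi> i. case i of Inl a \<Rightarrow> x $ a | Inr b \<Rightarrow> w $ b)"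

lemma position_join [simp]: "position (join x w) = x"
  and frequency_join [simp]: "frequency (join x w) = w"
  by (simp_all add: position_def frequency_def join_def vec_eq_iff)

lemma join_position_frequency [simp]: "join (position z) (frequency z) = z"
  by (auto simp: position_def frequency_def join_def vec_eq_iff split: sum.split)

lemma phase_space_eq_iff: "z = z' \<longleftrightarrow> position z = position z' \<and> frequency z = frequency z'"
  by (metis join_position_frequency)

lemma linear_position: "linear position"
  by (rule linearI) (simp_all add: position_def vec_eq_iff)

lemma linear_frequency: "linear frequency"
  by (rule linearI) (simp_all add: frequency_def vec_eq_iff)

lemmas position_simps [simp] =
  linear_add[OF linear_position] linear_diff[OF linear_position] linear_cmul[OF linear_position]
  linear_0[OF linear_position] linear_neg[OF linear_position]

lemmas frequency_simps [simp] =
  linear_add[OF linear_frequency] linear_diff[OF linear_frequency] linear_cmul[OF linear_frequency]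
  linear_0[OF linear_frequency] linear_neg[OF linear_frequency]

lemma inner_phase_space: "z \<bullet> z' = position z \<bullet> position z' + frequency z \<bullet> frequency z'"
  by (simp add: inner_vec_def position_def frequency_def UNIV_Plus_UNIV[symmetric] sum.Plus del: UNIV_Plus_UNIV)

lemma inner_join [simp]: "join x w \<bullet> join x' w' = x \<bullet> x' + w \<bullet> w'"
  by (simp add: inner_phase_space)

lemma position_measurable [measurable]: "position \<in> borel_measurable borel"
  and frequency_measurable [measurable]: "frequency \<in> borel_measurable borel"
  by (auto intro!: borel_measurable_continuous_onI linear_continuous_on
      simp: linear_conv_bounded_linear[symmetric] linear_position linear_frequency)

lemma join_measurable [measurable]: "case_prod join \<in> borel_measurable (borel \<Otimes>\<^sub>M borel)"
proof -
  have "linear (case_prod join)"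
    by (rule linearI) (auto simp: phase_space_eq_iff)
  then show ?thesis
    unfolding borel_prod
    by (intro borel_measurable_continuous_onI linear_continuous_on) (simp add: linear_conv_bounded_linear)
qed

lemma prod_Basis_vec:
  fixes f :: "real ^ 'k \<Rightarrow> 'b::comm_monoid_mult"
  shows "(\<Prod>b\<in>Basis. f b) = (\<Prod>i\<in>UNIV. f (axis i 1))"
proof -
  have *: "(Basis :: (real ^ 'k) set) = range (\<lambda>i. axis i 1)"
    by (auto simp: Basis_vec_def)
  have "inj (\<lambda>i :: 'k. axis i (1::real))"
    by (auto simp: inj_on_def axis_eq_axis)
  then show ?thesis unfolding * by (subst prod.reindex) auto
qed

text \<open>Lebesgue measure is determined by its values on boxes, and a box in phase space is the
  product of a position box and a frequency box. This permits integration over position and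
  frequency separately.\<close>

lemma lborel_join:
  "(lborel :: (real ^ ('m::finite + 'm)) measure) = distr (lborel \<Otimes>\<^sub>M lborel) borel (case_prod join)"
proof (rule lborel_eqI)
  fix l u :: "real ^ ('m + 'm)"
  assume le: "\<And>b. b \<in> Basis \<Longrightarrow> l \<bullet> b \<le> u \<bullet> b"
  have le': "l $ i \<le> u $ i" for i
    using le[of "axis i 1"] by (simp add: inner_axis axis_in_Basis_iff)
  have leP: "position l \<bullet> b \<le> position u \<bullet> b" "frequency l \<bullet> b \<le> frequency u \<bullet> b" if "b \<in> Basis" for b
    using that le' by (auto simp: Basis_vec_def inner_axis position_def frequency_def)
  have mem: "join x w \<in> box l u \<longleftrightarrow> x \<in> box (position l) (position u) \<and> w \<in> box (frequency l) (frequency u)" for x w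
    by (auto simp: mem_box_cart position_def frequency_def join_def split: sum.split)
  have "emeasure (distr (lborel \<Otimes>\<^sub>M lborel) borel (case_prod join)) (box l u)
      = emeasure (lborel \<Otimes>\<^sub>M lborel) (box (position l) (position u) \<times> box (frequency l) (frequency u))"
    by (subst emeasure_distr) (auto simp: space_pair_measure mem intro!: arg_cong[where f = "emeasure _"])
  also have "\<dots> = emeasure lborel (box (position l) (position u)) * emeasure lborel (box (frequency l) (frequency u))"
    by (rule lborel.emeasure_pair_measure_Times) auto
  also have "emeasure lborel (box (position l) (position u)) = (\<Prod>i\<in>UNIV. ennreal (u $ Inl i - l $ Inl i))"
    using le' by (subst emeasure_lborel_box[OF leP(1)])
      (auto simp: inner_axis position_def prod_Basis_vec prod_ennreal)
  also have "emeasure lborel (box (frequency l) (frequency u)) = (\<Prod>i\<in>UNIV. ennreal (u $ Inr i - l $ Inr i))"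
    using le' by (subst emeasure_lborel_box[OF leP(2)])
      (auto simp: inner_axis frequency_def prod_Basis_vec prod_ennreal)
  also have "(\<Prod>i\<in>UNIV. ennreal (u $ Inl i - l $ Inl i)) * (\<Prod>i\<in>UNIV. ennreal (u $ Inr i - l $ Inr i))
     = (\<Prod>i\<in>UNIV. ennreal (u $ i - l $ i))"
    by (simp add: UNIV_Plus_UNIV[symmetric] prod.Plus del: UNIV_Plus_UNIV)
  also have "\<dots> = ennreal (\<Prod>b\<in>Basis. (u - l) \<bullet> b)"
    using le' by (simp add: prod_Basis_vec inner_axis prod_ennreal)
  finally show "emeasure (distr (lborel \<Otimes>\<^sub>M lborel) borel (case_prod join)) (box l u) = (\<Prod>b\<in>Basis. (u - l) \<bullet> b)" .
qed simp

lemma nn_integral_join: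
  assumes [measurable]: "f \<in> borel_measurable borel"
  shows "(\<integral>\<^sup>+z. f z \<partial>lborel) = (\<integral>\<^sup>+x. \<integral>\<^sup>+w. f (join x w) \<partial>lborel \<partial>lborel)"
  by (subst lborel_join) (simp add: nn_integral_distr lborel.nn_integral_fst[symmetric] case_prod_unfold)

section \<open>Affine changes of variables and normalised Gaussian integrals\<close>

lemma nn_integral_affine:
  fixes t :: "'a::euclidean_space"
  assumes [measurable]: "f \<in> borel_measurable borel" and c: "c \<noteq> 0"
  shows "(\<integral>\<^sup>+x. f (t + c *\<^sub>R x) \<partial>lborel) = ennreal ((1 / \<bar>c\<bar>) ^ DIM('a)) * (\<integral>\<^sup>+x. f x \<partial>lborel)"
proof -
  have "(\<integral>\<^sup>+x. f x \<partial>lborel) = ennreal (\<bar>c\<bar> ^ DIM('a)) * (\<integral>\<^sup>+x. f (t + c *\<^sub>R x) \<partial>lborel)"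
    by (subst lborel_affine[OF c, of t]) (simp add: nn_integral_density nn_integral_distr nn_integral_cmult)
  then have "ennreal ((1 / \<bar>c\<bar>) ^ DIM('a)) * (\<integral>\<^sup>+x. f x \<partial>lborel)
      = ennreal ((1 / \<bar>c\<bar>) ^ DIM('a) * \<bar>c\<bar> ^ DIM('a)) * (\<integral>\<^sup>+x. f (t + c *\<^sub>R x) \<partial>lborel)"
    by (simp only: ennreal_mult zero_le_power abs_ge_zero zero_le_divide_1_iff mult.assoc)
  also have "(1 / \<bar>c\<bar>) ^ DIM('a) * \<bar>c\<bar> ^ DIM('a) = 1"
    using c by (simp add: power_mult_distrib[symmetric])
  finally show ?thesis by simp
qed

lemma distr_lborel_affine:
  fixes t :: "'a::euclidean_space"
  assumes "c \<noteq> 0"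
  shows "distr lborel borel (\<lambda>x. t + c *\<^sub>R x) = density lborel (\<lambda>_. ennreal ((1 / \<bar>c\<bar>) ^ DIM('a)))"
proof (rule measure_eqI)
  fix A assume "A \<in> sets (distr lborel borel (\<lambda>x. t + c *\<^sub>R x))"
  then have [measurable]: "A \<in> sets borel" by simp
  have "emeasure (distr lborel borel (\<lambda>x. t + c *\<^sub>R x)) A = (\<integral>\<^sup>+x. indicator A (t + c *\<^sub>R x) \<partial>lborel)"
    by (subst nn_integral_indicator[symmetric], simp, subst nn_integral_distr) auto
  also have "\<dots> = emeasure (density lborel (\<lambda>_. ennreal ((1 / \<bar>c\<bar>) ^ DIM('a)))) A"
    by (subst nn_integral_affine[OF _ assms]) (simp_all add: emeasure_density nn_integral_cmult)
  finally show "emeasure (distr lborel borel (\<lambda>x. t + c *\<^sub>R x)) A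
      = emeasure (density lborel (\<lambda>_. ennreal ((1 / \<bar>c\<bar>) ^ DIM('a)))) A" .
qed simp

lemma integrable_affine:
  fixes t :: "'a::euclidean_space" and f :: "'a \<Rightarrow> 'b::{banach, second_countable_topology}"
  assumes "integrable lborel f" "c \<noteq> 0"
  shows "integrable lborel (\<lambda>x. f (t + c *\<^sub>R x))"
proof -
  have [measurable]: "f \<in> borel_measurable borel"
    using borel_measurable_integrable[OF assms(1)] by simp
  show ?thesis
    using assms(1) unfolding integrable_iff_bounded
    by (auto simp: nn_integral_affine[OF _ assms(2), of "\<lambda>x. ennreal (norm (f x))"] ennreal_mult_less_top)
qed

lemma integral_affine:
  fixes t :: "'a::euclidean_space" and f :: "'a \<Rightarrow> 'b::{banach, second_countable_topology}"
  assumes [measurable]: "f \<in> borel_measurable borel" and c: "c \<noteq> 0"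
  shows "(LINT x|lborel. f (t + c *\<^sub>R x)) = (1 / \<bar>c\<bar>) ^ DIM('a) *\<^sub>R (LINT x|lborel. f x)"
proof -
  have "(LINT x|lborel. f (t + c *\<^sub>R x)) = (LINT x|distr lborel borel (\<lambda>x. t + c *\<^sub>R x). f x)"
    by (simp add: integral_distr)
  then show ?thesis
    using assms(2) by (simp add: distr_lborel_affine integral_density)
qed

lemma AE_affine:
  fixes t :: "'a::euclidean_space"
  assumes "AE x in lborel. P x" "c \<noteq> 0"
  shows "AE x in lborel. P (t + c *\<^sub>R x)"
proof -
  have "AE x in distr lborel borel (\<lambda>x. t + c *\<^sub>R x). P x"
    unfolding distr_lborel_affine[OF assms(2)] by (subst AE_density) (use assms(1) in auto)
  then show ?thesis
    by (rule AE_distrD[rotated]) simp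
qed

lemmas integrable_translate = integrable_affine[where c = 1, simplified]
lemmas integral_translate = integral_affine[where c = 1, simplified]
lemmas AE_translate = AE_affine[where c = 1, simplified]

lemma gaussian_integral_1: "(\<integral>\<^sup>+x. ennreal (exp (- (pi * x\<^sup>2))) \<partial>lborel) = 1"
proof -
  \<comment> \<open>The standard deviation \<open>1 / sqrt (2 * pi)\<close> is the one for which the
    normal density has normalising factor 1.\<close>
  have *: "exp (- (pi * x\<^sup>2)) = normal_density 0 (1 / sqrt (2 * pi)) x" for x
    by (simp add: normal_density_def real_sqrt_divide power_divide field_simps)
  show ?thesis
    unfolding * by (subst nn_integral_eq_integral) auto
qed

lemma gaussian_nn_integral:
  "(\<integral>\<^sup>+x. ennreal (exp (- (pi * (norm x)\<^sup>2))) \<partial>(lborel :: 'a::euclidean_space measure)) = 1"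
proof -
  have "ennreal (exp (- (pi * (norm x)\<^sup>2))) = (\<Prod>b\<in>Basis. ennreal (exp (- (pi * (x \<bullet> b)\<^sup>2))))" for x :: 'a
  proof -
    have "(norm x)\<^sup>2 = (\<Sum>b\<in>Basis. (x \<bullet> b)\<^sup>2)"
      by (subst power2_norm_eq_inner, subst euclidean_inner) (simp add: power2_eq_square)
    then show ?thesis
      by (simp add: prod_ennreal exp_sum[symmetric] sum_distrib_left sum_negf)
  qed
  then show ?thesis
    using nn_integral_lborel_prod[where 'a = 'a and f = "\<lambda>_ x. ennreal (exp (- (pi * x\<^sup>2)))"]
    by (simp add: gaussian_integral_1)
qed

lemma gaussian_integrable:
  assumes "c > 0"
  shows "integrable lborel (\<lambda>x::'a::euclidean_space. exp (- (c * (norm x)\<^sup>2)))"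
proof -
  have "integrable lborel (\<lambda>x::'a. exp (- (pi * (norm x)\<^sup>2)))"
    by (rule integrableI_nonneg) (auto simp: gaussian_nn_integral)
  from integrable_affine[OF this, of "sqrt (c / pi)" 0] show ?thesis
    using assms by (simp add: power_mult_distrib)
qed

lemma gaussian_integral: "(LINT x|lborel. exp (- (pi * (norm (x::'a::euclidean_space))\<^sup>2))) = 1"
  by (subst integral_eq_nn_integral) (auto simp: gaussian_nn_integral)

section \<open>Gaussians and Plancherel's theorem\<close>

definition fourier :: "('a::euclidean_space \<Rightarrow> complex) \<Rightarrow> 'a \<Rightarrow> complex" where
  "fourier f w = (LINT t|lborel. f t * cis (- 2 * pi * (t \<bullet> w)))"

lemma cis_measurable [measurable]: "f \<in> borel_measurable M \<Longrightarrow> (\<lambda>x. cis (f x)) \<in> borel_measurable M"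
  unfolding cis_conv_exp by measurable

lemma integrable_mult_cis:
  assumes "integrable M f" "\<phi> \<in> borel_measurable M"
  shows "integrable M (\<lambda>x. f x * cis (\<phi> x))"
  using assms by (intro Bochner_Integration.integrable_bound[OF assms(1)]) (auto simp: norm_mult)

text \<open>Stated for linear maps instead of matrices: the forms that arise are inverses,
  compositions and direct sums over phase space, which then need no matrix calculus.\<close>

definition pos_def :: "('a::euclidean_space \<Rightarrow> 'a) \<Rightarrow> bool" where
  "pos_def P \<longleftrightarrow> linear P \<and> (\<forall>x y. P x \<bullet> y = x \<bullet> P y) \<and> (\<forall>x. x \<noteq> 0 \<longrightarrow> x \<bullet> P x > 0)"

text \<open>The quadratic form attains a positive minimum on the unit sphere and is homogeneous of
  degree two. The bound compares every Gaussian with an isotropic one.\<close>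

lemma pos_def_lower:
  assumes "pos_def P"
  obtains c where "c > 0" "\<And>x. c * (norm x)\<^sup>2 \<le> x \<bullet> P x"
proof -
  have lin: "linear P" and pos: "\<And>x. x \<noteq> 0 \<Longrightarrow> x \<bullet> P x > 0"
    using assms by (auto simp: pos_def_def)
  let ?S = "sphere (0::'a) 1"
  have "?S \<noteq> {}" using vector_choose_size[of 1] by (auto simp: dist_norm)
  moreover have "continuous_on ?S (\<lambda>x. x \<bullet> P x)"
    using lin by (intro continuous_intros linear_continuous_on) (simp add: linear_conv_bounded_linear)
  ultimately obtain x0 where x0: "x0 \<in> ?S" "\<And>x. x \<in> ?S \<Longrightarrow> x0 \<bullet> P x0 \<le> x \<bullet> P x"
    using continuous_attains_inf[of ?S "\<lambda>x. x \<bullet> P x"] by auto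
  show thesis
  proof
    have "x0 \<noteq> 0" using x0(1) by auto
    then show "x0 \<bullet> P x0 > 0" by (rule pos)
    fix x :: 'a
    show "x0 \<bullet> P x0 * (norm x)\<^sup>2 \<le> x \<bullet> P x"
    proof (cases "x = 0")
      case False
      then have "(1 / norm x) *\<^sub>R x \<in> ?S" by simp
      from x0(2)[OF this] have "x0 \<bullet> P x0 \<le> x \<bullet> P x / (norm x)\<^sup>2"
        by (simp add: linear_cmul[OF lin] power2_eq_square)
      then show ?thesis using False by (simp add: pos_le_divide_eq)
    qed (simp add: linear_0[OF lin])
  qed
qed

lemma pos_def_measurable: "pos_def P \<Longrightarrow> P \<in> borel_measurable borel"
  by (intro borel_measurable_continuous_onI linear_continuous_on)
     (simp add: pos_def_def linear_conv_bounded_linear)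

lemma pos_def_gaussian_integrable:
  assumes P: "pos_def P"
  shows "integrable lborel (\<lambda>x. exp (- pi * (x \<bullet> P x)))"
proof -
  obtain c where c: "c > 0" "\<And>x. c * (norm x)\<^sup>2 \<le> x \<bullet> P x"
    using pos_def_lower[OF P] by blast
  note [measurable] = pos_def_measurable[OF P]
  show ?thesis
  proof (rule Bochner_Integration.integrable_bound)
    show "integrable lborel (\<lambda>x::'a. exp (- ((pi * c) * (norm x)\<^sup>2)))"
      using c by (intro gaussian_integrable) simp
  qed (use c in \<open>auto simp: mult.assoc\<close>)
qed

text \<open>The linear term is written with \<open>P v\<close> instead of a free vector, so that the
  new centre is \<open>a *\<^sub>R v\<close> and no inverse of \<open>P\<close> enters.\<close>

lemma gaussian_complete_square:
  assumes "pos_def P"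
  shows "- pi * (x \<bullet> P x) + 2 * pi * a * (x \<bullet> P v)
       = pi * a\<^sup>2 * (v \<bullet> P v) - pi * ((x - a *\<^sub>R v) \<bullet> P (x - a *\<^sub>R v))"
proof -
  have lin: "linear P" and sym: "P x \<bullet> v = x \<bullet> P v"
    using assms by (auto simp: pos_def_def)
  show ?thesis
    by (simp add: linear_diff[OF lin] linear_cmul[OF lin] inner_diff_left inner_diff_right
        sym[unfolded inner_commute[of "P x"]] power2_eq_square algebra_simps)
qed

lemma gaussian_real_exponential:
  assumes P: "pos_def P"
  shows "integrable lborel (\<lambda>x. exp (- pi * (x \<bullet> P x)) * exp (2 * pi * a * (x \<bullet> P v)))" (is "integrable _ ?f")
    and "(LINT x|lborel. exp (- pi * (x \<bullet> P x)) * exp (2 * pi * a * (x \<bullet> P v)))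
       = exp (pi * a\<^sup>2 * (v \<bullet> P v)) * (LINT x|lborel. exp (- pi * (x \<bullet> P x)))"
proof -
  note [measurable] = pos_def_measurable[OF P]
  have eq: "?f = (\<lambda>x. exp (pi * a\<^sup>2 * (v \<bullet> P v)) * exp (- pi * ((- a *\<^sub>R v + x) \<bullet> P (- a *\<^sub>R v + x))))"
    unfolding exp_add[symmetric] gaussian_complete_square[OF P] by (simp add: algebra_simps)
  show "integrable lborel ?f"
    unfolding eq by (intro integrable_mult_right integrable_translate pos_def_gaussian_integrable P)
  show "integral\<^sup>L lborel ?f = exp (pi * a\<^sup>2 * (v \<bullet> P v)) * (LINT x|lborel. exp (- pi * (x \<bullet> P x)))"
    unfolding eq using integral_translate[of "\<lambda>x. exp (- pi * (x \<bullet> P x))" "- a *\<^sub>R v"] by simp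
qed

text \<open>Both sides are entire in \<open>z\<close>, and for real \<open>z\<close> they agree by completing the square.\<close>

lemma gaussian_complex_exponential:
  fixes z :: complex
  assumes P: "pos_def P"
  shows "(LINT x|lborel. of_real (exp (- pi * (x \<bullet> P x))) * exp (z * of_real (2 * pi * (x \<bullet> P v))))
       = exp (of_real (pi * (v \<bullet> P v)) * z\<^sup>2) * of_real (LINT x|lborel. exp (- pi * (x \<bullet> P x)))"
proof -
  note [measurable] = pos_def_measurable[OF P]
  define g where "g x = exp (- pi * (x \<bullet> P x))" for x
  define s where "s x = 2 * pi * (x \<bullet> P v)" for x
  have [measurable]: "g \<in> borel_measurable borel" "s \<in> borel_measurable borel"
    unfolding g_def s_def by measurable
  define a where "a k = (LINT x|lborel. complex_of_real (g x * s x ^ k / fact k))" for k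
  define h where "h z = (LINT x|lborel. of_real (g x) * exp (z * of_real (s x)))" for z :: complex
  \<comment> \<open>\<open>exp (R * \<bar>s x\<bar>)\<close> is at most the sum of the exponentials
    with \<open>R\<close> and with \<open>- R\<close>, so the real case supplies an integrable
    majorant of the exponential series for \<open>cmod z = R\<close>.\<close>
  have dom: "integrable lborel (\<lambda>x. g x * exp (R * \<bar>s x\<bar>))" for R
  proof (rule Bochner_Integration.integrable_bound)
    show "integrable lborel (\<lambda>x. g x * exp (R * s x) + g x * exp (- R * s x))"
      using gaussian_real_exponential(1)[OF P, of R v] gaussian_real_exponential(1)[OF P, of "- R" v]
      by (intro Bochner_Integration.integrable_add) (auto simp: g_def s_def mult_ac)
    show "AE x in lborel. norm (g x * exp (R * \<bar>s x\<bar>)) \<le> norm (g x * exp (R * s x) + g x * exp (- R * s x))"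
    proof (rule AE_I2)
      fix x
      have "exp (R * \<bar>s x\<bar>) \<le> exp (R * s x) + exp (- R * s x)"
        by (cases "s x \<ge> 0") auto
      then have "g x * exp (R * \<bar>s x\<bar>) \<le> g x * (exp (R * s x) + exp (- R * s x))"
        by (intro mult_left_mono) (simp_all add: g_def)
      moreover have "0 \<le> g x * exp (R * \<bar>s x\<bar>)" by (simp add: g_def)
      ultimately show "norm (g x * exp (R * \<bar>s x\<bar>)) \<le> norm (g x * exp (R * s x) + g x * exp (- R * s x))"
        by (simp add: distrib_left)
    qed
  qed simp
  \<comment> \<open>Integrating the exponential series term by term exhibits \<open>h\<close> as an
    everywhere convergent power series, hence as an entire function.\<close>
  have sums: "(\<lambda>k. a k * (z - 0) ^ k) sums h z" for z
  proof -
    define f where "f k x = complex_of_real (g x * s x ^ k / fact k) * z ^ k" for k x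
    have nf: "norm (f k x) = g x * ((cmod z * \<bar>s x\<bar>) ^ k / fact k)" for k x
      by (simp add: f_def norm_mult norm_divide norm_power power_mult_distrib g_def power_abs)
    have fs: "(\<lambda>k. norm (f k x)) sums (g x * exp (cmod z * \<bar>s x\<bar>))" for x
      unfolding nf using exp_converges[of "cmod z * \<bar>s x\<bar>"]
      by (intro sums_mult) (simp add: field_simps)
    have le: "(\<Sum>k<n. norm (f k x)) \<le> g x * exp (cmod z * \<bar>s x\<bar>)" for n x
      using sum_le_suminf[OF sums_summable[OF fs[of x]], of "{..<n}"] sums_unique[OF fs[of x]] by simp
    have int: "integrable lborel (f k)" for k
    proof (rule Bochner_Integration.integrable_bound[OF dom[of "cmod z"]])
      show "AE x in lborel. norm (f k x) \<le> norm (g x * exp (cmod z * \<bar>s x\<bar>))"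
      proof (rule AE_I2)
        fix x
        have "norm (f k x) \<le> (\<Sum>j<Suc k. norm (f j x))" by (rule member_le_sum) auto
        also note le
        finally show "norm (f k x) \<le> norm (g x * exp (cmod z * \<bar>s x\<bar>))" by simp
      qed
    qed (unfold f_def, measurable)
    have "(\<lambda>k. integral\<^sup>L lborel (f k)) sums (LINT x|lborel. (\<Sum>k. f k x))"
    proof (rule sums_integral[OF int])
      show "AE x in lborel. summable (\<lambda>k. norm (f k x))" using fs by (auto simp: summable_def)
      show "summable (\<lambda>k. LINT x|lborel. norm (f k x))"
      proof (rule summableI_nonneg_bounded)
        fix n
        have "(\<Sum>k<n. LINT x|lborel. norm (f k x)) = (LINT x|lborel. (\<Sum>k<n. norm (f k x)))"
          by (rule Bochner_Integration.integral_sum[symmetric]) (intro integrable_norm int)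
        also have "\<dots> \<le> (LINT x|lborel. g x * exp (cmod z * \<bar>s x\<bar>))"
          by (intro integral_mono Bochner_Integration.integrable_sum integrable_norm int dom le)
        finally show "(\<Sum>k<n. LINT x|lborel. norm (f k x)) \<le> (LINT x|lborel. g x * exp (cmod z * \<bar>s x\<bar>))" .
      qed auto
    qed
    moreover have "(\<Sum>k. f k x) = of_real (g x) * exp (z * of_real (s x))" for x
    proof -
      have "(\<lambda>k. of_real (g x) * ((z * of_real (s x)) ^ k /\<^sub>R fact k)) sums (of_real (g x) * exp (z * of_real (s x)))"
        by (intro sums_mult exp_converges)
      moreover have "of_real (g x) * ((z * of_real (s x)) ^ k /\<^sub>R fact k) = f k x" for k
        by (simp add: f_def scaleR_conv_of_real power_mult_distrib field_simps)
      ultimately show ?thesis by (simp add: sums_iff)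
    qed
    moreover have "integral\<^sup>L lborel (f k) = a k * (z - 0) ^ k" for k
      unfolding a_def f_def[abs_def] diff_zero by (rule integral_mult_left_zero)
    ultimately show ?thesis by (simp add: h_def)
  qed
  define r where "r z = h z - exp (of_real (pi * (v \<bullet> P v)) * z\<^sup>2) * of_real (LINT x|lborel. exp (- pi * (x \<bullet> P x)))" for z
  \<comment> \<open>The radius \<open>cmod z + 1\<close> makes the disc contain both
    \<open>z\<close> and a real neighbourhood of 0, where the zeros of \<open>r\<close>
    accumulate.\<close>
  have hol: "r holomorphic_on ball 0 (cmod z + 1)" for z
    unfolding r_def
    by (intro holomorphic_intros power_series_holomorphic[where a = a] sums)
  have zero: "r w = 0" if w: "w \<in> \<real>" for w
  proof -
    obtain x where x: "w = of_real x" using w by (rule Reals_cases)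
    have "h w = (LINT y|lborel. complex_of_real (g y * exp (x * s y)))"
      by (simp add: h_def x exp_of_real[symmetric])
    also have "\<dots> = of_real (LINT y|lborel. g y * exp (x * s y))" by (rule integral_complex_of_real)
    also have "(LINT y|lborel. g y * exp (x * s y)) = exp (pi * x\<^sup>2 * (v \<bullet> P v)) * (LINT x|lborel. exp (- pi * (x \<bullet> P x)))"
      using gaussian_real_exponential(2)[OF P, of x v] by (simp add: g_def s_def mult_ac)
    finally show ?thesis
      by (simp add: r_def x exp_of_real[symmetric] mult_ac)
  qed
  have "r z = 0"
  proof (rule analytic_continuation[of r "ball 0 (cmod z + 1)" "\<real> \<inter> ball 0 (cmod z + 1)" 0])
    show "(0::complex) islimpt \<real> \<inter> ball 0 (cmod z + 1)"
      unfolding islimpt_approachable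
    proof (intro allI impI)
      fix e :: real assume "e > 0"
      with norm_ge_zero[of z] show "\<exists>x'\<in>\<real> \<inter> ball 0 (cmod z + 1). x' \<noteq> 0 \<and> dist x' (0::complex) < e"
        by (intro bexI[of _ "of_real (min (e/2) (1/2))"]) (auto simp: dist_norm min_def simp del: norm_ge_zero)
    qed
  qed (use hol zero add_nonneg_pos[OF norm_ge_zero[of z] zero_less_one] in auto)
  then show ?thesis by (simp add: r_def h_def g_def s_def)
qed

text \<open>\<open>gaussian_complex_exponential\<close> at \<open>z = - \<i>\<close>, where
  \<open>z\<^sup>2 = -1\<close> turns the growing factor into a decaying one.\<close>

lemma fourier_gaussian:
  assumes P: "pos_def P"
  shows "fourier (\<lambda>x. of_real (exp (- pi * (x \<bullet> P x)))) (P v)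
       = of_real ((LINT x|lborel. exp (- pi * (x \<bullet> P x))) * exp (- pi * (v \<bullet> P v)))"
proof -
  have "fourier (\<lambda>x. of_real (exp (- pi * (x \<bullet> P x)))) (P v)
      = (LINT x|lborel. of_real (exp (- pi * (x \<bullet> P x))) * exp (- \<i> * of_real (2 * pi * (x \<bullet> P v))))"
    unfolding fourier_def cis_conv_exp by (simp add: mult_ac)
  also have "\<dots> = of_real ((LINT x|lborel. exp (- pi * (x \<bullet> P x))) * exp (- pi * (v \<bullet> P v)))"
    unfolding gaussian_complex_exponential[OF P] by (simp add: exp_of_real[symmetric] mult_ac)
  finally show ?thesis .
qed

section \<open>Continuity of translations in L1 and L2\<close>

abbreviation shift_distance :: "('a::euclidean_space \<Rightarrow> real) \<Rightarrow> 'a \<Rightarrow> real" where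
  "shift_distance f r \<equiv> (LINT x|lborel. \<bar>f (r + x) - f x\<bar>)"

definition translation_continuous :: "('a::euclidean_space \<Rightarrow> real) \<Rightarrow> bool" where
  "translation_continuous f \<longleftrightarrow>
     (\<forall>r. r \<longlonglongrightarrow> 0 \<longrightarrow> (\<lambda>n. shift_distance f (r n)) \<longlonglongrightarrow> 0)"

lemma abs_diff_translate_integrable:
  fixes f :: "'a::euclidean_space \<Rightarrow> real"
  assumes "integrable lborel f"
  shows "integrable lborel (\<lambda>x. \<bar>f (r + x) - f x\<bar>)"
  using assms by (intro integrable_abs Bochner_Integration.integrable_diff integrable_translate)

text \<open>Translation preserves the L1 norm, so replacing \<open>f\<close> by \<open>g\<close>
  changes the shift distance by at most twice the distance of \<open>f\<close> and
  \<open>g\<close>.\<close>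

lemma translation_continuous_limit:
  fixes f :: "'a::euclidean_space \<Rightarrow> real"
  assumes f: "integrable lborel f"
    and approx: "\<And>e. e > 0 \<Longrightarrow> \<exists>g. integrable lborel g \<and> translation_continuous g \<and> (LINT x|lborel. \<bar>f x - g x\<bar>) < e"
  shows "translation_continuous f"
  unfolding translation_continuous_def
proof (intro allI impI LIMSEQ_I)
  fix r :: "nat \<Rightarrow> 'a" and e :: real assume r: "r \<longlonglongrightarrow> 0" and e: "e > 0"
  obtain g where g: "integrable lborel g" "translation_continuous g" "(LINT x|lborel. \<bar>f x - g x\<bar>) < e / 4"
    using approx[of "e / 4"] e by auto
  obtain N where N: "\<And>n. n \<ge> N \<Longrightarrow> norm (shift_distance g (r n)) < e / 4"
    using g(2) r e LIMSEQ_D[of "\<lambda>n. LINT x|lborel. \<bar>g (r n + x) - g x\<bar>" 0 "e / 4"]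
    unfolding translation_continuous_def by auto
  have fg: "integrable lborel (\<lambda>x. \<bar>f x - g x\<bar>)" using f g(1) by simp
  show "\<exists>N. \<forall>n\<ge>N. norm ((shift_distance f (r n)) - 0) < e"
  proof (intro exI[of _ N] allI impI)
    fix n assume "n \<ge> N"
    have "(shift_distance f (r n))
       \<le> (LINT x|lborel. \<bar>f (r n + x) - g (r n + x)\<bar> + \<bar>g (r n + x) - g x\<bar> + \<bar>f x - g x\<bar>)"
      by (intro integral_mono Bochner_Integration.integrable_add abs_diff_translate_integrable f g fg
           integrable_translate[OF fg]) auto
    also have "\<dots> = (LINT x|lborel. \<bar>f (r n + x) - g (r n + x)\<bar>) + (shift_distance g (r n)) + (LINT x|lborel. \<bar>f x - g x\<bar>)"
      using integrable_translate[OF fg, of "r n"] abs_diff_translate_integrable[OF g(1), of "r n"] fg by simp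
    also have "(LINT x|lborel. \<bar>f (r n + x) - g (r n + x)\<bar>) = (LINT x|lborel. \<bar>f x - g x\<bar>)"
      using integral_translate[of "\<lambda>x. \<bar>f x - g x\<bar>" "r n"] borel_measurable_integrable[OF fg] by simp
    finally show "norm ((shift_distance f (r n)) - 0) < e"
      using N[OF \<open>n \<ge> N\<close>] g(3) e by simp
  qed
qed

text \<open>Lower semicontinuity of the indicator makes the positive part of
  \<open>indicator U - indicator U (r n + \<cdot>)\<close> tend to 0; both indicators have the same integral, so
  the negative part does the same.\<close>

lemma translation_continuous_open:
  fixes U :: "'a::euclidean_space set"
  assumes "open U" and fin: "emeasure lborel U < \<infinity>"
  shows "translation_continuous (indicator U)"
  unfolding translation_continuous_def
proof (intro allI impI)
  fix r :: "nat \<Rightarrow> 'a" assume r: "r \<longlonglongrightarrow> 0"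
  have [measurable]: "U \<in> sets borel" using assms(1) by simp
  let ?i = "indicator U :: 'a \<Rightarrow> real"
  have int: "integrable lborel ?i" using fin by (intro integrable_real_indicator) auto
  define p where "p n x = max 0 (?i x - ?i (r n + x))" for n x
  have [measurable]: "p n \<in> borel_measurable borel" for n unfolding p_def by measurable
  have "(\<lambda>n. integral\<^sup>L lborel (p n)) \<longlonglongrightarrow> (LINT x|(lborel::'a measure). 0)"
  proof (rule integral_dominated_convergence[where w = ?i])
    show "AE x in lborel. (\<lambda>n. p n x) \<longlonglongrightarrow> 0"
    proof (intro AE_I2)
      fix x
      show "(\<lambda>n. p n x) \<longlonglongrightarrow> 0"
      proof (cases "x \<in> U")
        case True
        have "(\<lambda>n. r n + x) \<longlonglongrightarrow> x" using tendsto_add[OF r tendsto_const[of x]] by simp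
        then have "\<forall>\<^sub>F n in sequentially. r n + x \<in> U"
          using assms(1) True by (rule topological_tendstoD)
        then show ?thesis
          by (intro tendsto_eventually) (auto elim!: eventually_mono simp: p_def)
      qed (simp add: p_def)
    qed
    show "AE x in lborel. norm (p n x) \<le> ?i x" for n
      by (auto simp: p_def indicator_def)
  qed (use int in simp_all)
  then have lim: "(\<lambda>n. 2 * integral\<^sup>L lborel (p n)) \<longlonglongrightarrow> 0"
    by (auto intro: tendsto_mult_right_zero)
  have "(shift_distance ?i (r n)) = 2 * integral\<^sup>L lborel (p n)" for n
  proof -
    have it: "integrable lborel (\<lambda>x. ?i (r n + x))" by (rule integrable_translate[OF int])
    have ip: "integrable lborel (p n)"
      unfolding p_def by (intro integrable_max Bochner_Integration.integrable_diff int it) simp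
    have "(shift_distance ?i (r n)) = (LINT x|lborel. 2 * p n x + (?i (r n + x) - ?i x))"
      by (intro Bochner_Integration.integral_cong) (auto simp: p_def indicator_def)
    also have "\<dots> = 2 * integral\<^sup>L lborel (p n) + ((LINT x|lborel. ?i (r n + x)) - integral\<^sup>L lborel ?i)"
      using ip it int by simp
    also have "(LINT x|lborel. ?i (r n + x)) = integral\<^sup>L lborel ?i"
      by (rule integral_translate) simp
    finally show ?thesis by simp
  qed
  then show "(\<lambda>n. LINT x|lborel. \<bar>?i (r n + x) - ?i x\<bar>) \<longlonglongrightarrow> 0"
    using lim by simp
qed

text \<open>Outer regularity approximates \<open>A\<close> in L1 by open sets of finite
  measure.\<close>

lemma translation_continuous_indicator:
  fixes A :: "'a::euclidean_space set"
  assumes A: "A \<in> sets lborel" and fin: "emeasure lborel A < \<infinity>"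
  shows "translation_continuous (indicator A)"
proof (rule translation_continuous_limit)
  have [measurable]: "A \<in> sets borel" using A by simp
  show "integrable lborel (indicator A :: 'a \<Rightarrow> real)"
    using assms by (intro integrable_real_indicator) auto
  fix e :: real assume "e > 0"
  have "A \<in> sets lebesgue" using A by simp
  then obtain U where U: "open U" "A \<subseteq> U" "emeasure lebesgue (U - A) < ennreal e"
    by (rule sets_lebesgue_outer_open[OF _ \<open>e > 0\<close>])
  have [measurable]: "U \<in> sets borel" using U(1) by simp
  have UA: "emeasure lborel (U - A) < ennreal e" using U(3) by simp
  have "emeasure lborel U = emeasure lborel A + emeasure lborel (U - A)"
    using U(2) by (subst plus_emeasure) (auto simp: Un_absorb1)
  also have "\<dots> < \<infinity>"
  proof -
    have "emeasure lborel (U - A) < \<infinity>" using UA by (rule less_trans) simp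
    with fin show ?thesis by simp
  qed
  finally have finU: "emeasure lborel U < \<infinity>" .
  have "(LINT x|lborel. \<bar>indicator A x - indicator U x :: real\<bar>) = (LINT x|lborel. indicator (U - A) x)"
    using U(2) by (intro Bochner_Integration.integral_cong) (auto simp: indicator_def)
  also have "\<dots> = measure lborel (U - A)" by simp
  also have "\<dots> < e"
  proof -
    have "emeasure lborel (U - A) \<noteq> top" using UA by auto
    then show ?thesis using UA by (simp add: emeasure_eq_ennreal_measure ennreal_less_iff)
  qed
  finally show "\<exists>g. integrable lborel g \<and> translation_continuous g \<and> (LINT x|lborel. \<bar>indicator A x - g x :: real\<bar>) < e"
    using translation_continuous_open[OF U(1) finU] finU
    by (intro exI[of _ "indicator U"]) (auto intro!: integrable_real_indicator)
qed

lemma integrable_translation_continuous: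
  fixes f :: "'a::euclidean_space \<Rightarrow> real"
  assumes "integrable lborel f"
  shows "translation_continuous f"
  using assms
proof (induct rule: integrable_induct)
  case (base A c)
  have "(LINT x|lborel. \<bar>indicator A (r + x) *\<^sub>R c - indicator A x *\<^sub>R c\<bar>)
      = \<bar>c\<bar> * (LINT x|lborel. \<bar>indicator A (r + x) - indicator A x :: real\<bar>)" for r :: 'a
    by (subst integral_mult_right_zero[symmetric])
       (auto intro!: Bochner_Integration.integral_cong simp: abs_mult[symmetric] algebra_simps)
  then show ?case
    using translation_continuous_indicator[OF base(1)] base(2)
    by (auto simp: translation_continuous_def intro!: tendsto_mult_right_zero)
next
  case (add f g)
  show ?case
    unfolding translation_continuous_def
  proof (intro allI impI)
    fix r :: "nat \<Rightarrow> 'a" assume r: "r \<longlonglongrightarrow> 0"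
    have lim: "(\<lambda>n. (shift_distance f (r n)) + (shift_distance g (r n))) \<longlonglongrightarrow> 0"
      using add(2,4) r unfolding translation_continuous_def by (auto intro!: tendsto_add_zero)
    show "(\<lambda>n. LINT x|lborel. \<bar>f (r n + x) + g (r n + x) - (f x + g x)\<bar>) \<longlonglongrightarrow> 0"
    proof (rule tendsto_sandwich[OF _ _ tendsto_const lim])
      show "\<forall>\<^sub>F n in sequentially. (LINT x|lborel. \<bar>f (r n + x) + g (r n + x) - (f x + g x)\<bar>)
         \<le> (shift_distance f (r n)) + (shift_distance g (r n))"
      proof (intro always_eventually allI)
        fix n
        have "(LINT x|lborel. \<bar>f (r n + x) + g (r n + x) - (f x + g x)\<bar>)
          \<le> (LINT x|lborel. \<bar>f (r n + x) - f x\<bar> + \<bar>g (r n + x) - g x\<bar>)"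
          using add(1,3) abs_diff_translate_integrable[of "\<lambda>x. f x + g x" "r n"]
          by (intro integral_mono Bochner_Integration.integrable_add abs_diff_translate_integrable) auto
        also have "\<dots> = (shift_distance f (r n)) + (shift_distance g (r n))"
          using abs_diff_translate_integrable[OF add(1)] abs_diff_translate_integrable[OF add(3)]
          by (rule Bochner_Integration.integral_add)
        finally show "(LINT x|lborel. \<bar>f (r n + x) + g (r n + x) - (f x + g x)\<bar>) \<le> \<dots>" .
      qed
    qed (intro always_eventually allI integral_nonneg_AE AE_I2 abs_ge_zero)
  qed
next
  case (lim f s)
  show ?case
  proof (rule translation_continuous_limit)
    fix e :: real assume "e > 0"
    have "(\<lambda>i. LINT x|lborel. \<bar>f x - s i x\<bar>) \<longlonglongrightarrow> (LINT x|(lborel::'a measure). 0)"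
    proof (rule integral_dominated_convergence[where w = "\<lambda>x. 3 * norm (f x)"])
      show "AE x in lborel. (\<lambda>i. \<bar>f x - s i x\<bar>) \<longlonglongrightarrow> 0"
      proof (intro AE_I2 tendsto_rabs_zero)
        fix x show "(\<lambda>i. f x - s i x) \<longlonglongrightarrow> 0"
          using tendsto_diff[OF tendsto_const[of "f x"] lim(3)[of x]] by simp
      qed
      show "AE x in lborel. norm \<bar>f x - s i x\<bar> \<le> 3 * norm (f x)" for i
      proof (intro AE_I2)
        fix x show "norm \<bar>f x - s i x\<bar> \<le> 3 * norm (f x)"
          using lim(4)[of x i] by simp
      qed
    qed (use lim(1,5) borel_measurable_integrable[OF lim(1)] borel_measurable_integrable[OF lim(5)] in auto)
    then obtain i where "norm (LINT x|lborel. \<bar>f x - s i x\<bar>) < e"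
      using LIMSEQ_D[of _ _ e] \<open>e > 0\<close> by (auto dest!: LIMSEQ_D[of _ _ e])
    then show "\<exists>g. integrable lborel g \<and> translation_continuous g \<and> (LINT x|lborel. \<bar>f x - g x\<bar>) < e"
      using lim(1,2) by (intro exI[of _ "s i"]) auto
  qed (rule lim(5))
qed

text \<open>For nonnegative numbers
  \<open>(a - b)\<^sup>2 \<le> \<bar>a\<^sup>2 - b\<^sup>2\<bar>\<close>. The claim thus reduces to
  L1 continuity of the four functions \<open>p k\<close>, the squares of the positive and negative
  parts of the real and imaginary parts of \<open>u\<close>.\<close>

lemma translation_continuous_L2:
  fixes u :: "'a::euclidean_space \<Rightarrow> complex"
  assumes u: "square_integrable u" and r: "r \<longlonglongrightarrow> 0"
  shows "(\<lambda>n. LINT x|lborel. (cmod (u (r n + x) - u x))\<^sup>2) \<longlonglongrightarrow> 0"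
proof -
  have [measurable]: "u \<in> borel_measurable borel" and int: "integrable lborel (\<lambda>x. (cmod (u x))\<^sup>2)"
    using u by (auto simp: square_integrable_def)
  define p where "p k x = (max 0 ((if k < 2 then Re (u x) else Im (u x)) * (if even k then 1 else - 1)))\<^sup>2" for k :: nat and x
  have ip: "integrable lborel (p k)" for k
  proof (rule Bochner_Integration.integrable_bound[OF int])
    have "(max 0 y)\<^sup>2 \<le> (cmod z)\<^sup>2" if "\<bar>y\<bar> \<le> cmod z" for y :: real and z
      using that by (intro power_mono) auto
    then show "AE x in lborel. norm (p k x) \<le> norm ((cmod (u x))\<^sup>2)"
      by (auto simp: p_def abs_Re_le_cmod abs_Im_le_cmod)
    show "p k \<in> borel_measurable lborel"
      unfolding p_def by (cases "k < 2"; cases "even k") auto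
  qed
  have sq: "(max 0 a - max 0 b)\<^sup>2 \<le> \<bar>(max 0 a)\<^sup>2 - (max 0 b)\<^sup>2\<bar>" for a b :: real
  proof -
    have "\<bar>max 0 a - max 0 b\<bar> * \<bar>max 0 a - max 0 b\<bar> \<le> \<bar>max 0 a - max 0 b\<bar> * (max 0 a + max 0 b)"
      by (intro mult_left_mono) auto
    also have "\<dots> = \<bar>max 0 a - max 0 b\<bar> * \<bar>max 0 a + max 0 b\<bar>" by simp
    also have "\<dots> = \<bar>(max 0 a)\<^sup>2 - (max 0 b)\<^sup>2\<bar>"
      unfolding abs_mult[symmetric] by (simp add: power2_eq_square algebra_simps)
    finally show ?thesis by (simp add: power2_eq_square abs_mult[symmetric])
  qed
  have one: "(a - b)\<^sup>2 \<le> 2 * (\<bar>(max 0 a)\<^sup>2 - (max 0 b)\<^sup>2\<bar> + \<bar>(max 0 (- a))\<^sup>2 - (max 0 (- b))\<^sup>2\<bar>)" for a b :: real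
  proof -
    have "a - b = (max 0 a - max 0 b) - (max 0 (- a) - max 0 (- b))" by (simp add: max_def)
    moreover have "(x - y)\<^sup>2 \<le> 2 * (x\<^sup>2 + y\<^sup>2)" for x y :: real
      using zero_le_power2[of "x + y"] by (simp add: power2_eq_square algebra_simps)
    ultimately have "(a - b)\<^sup>2 \<le> 2 * ((max 0 a - max 0 b)\<^sup>2 + (max 0 (- a) - max 0 (- b))\<^sup>2)"
      by metis
    also have "\<dots> \<le> 2 * (\<bar>(max 0 a)\<^sup>2 - (max 0 b)\<^sup>2\<bar> + \<bar>(max 0 (- a))\<^sup>2 - (max 0 (- b))\<^sup>2\<bar>)"
      by (intro mult_left_mono add_mono sq) simp
    finally show ?thesis .
  qed
  have bound: "(cmod (u y - u x))\<^sup>2 \<le> (\<Sum>k<4. 2 * \<bar>p k y - p k x\<bar>)" for x y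
  proof -
    have "{..<4} = {0, 1, 2, 3 :: nat}" by auto
    then have "(\<Sum>k<4. 2 * \<bar>p k y - p k x\<bar>)
      = 2 * (\<bar>(max 0 (Re (u y)))\<^sup>2 - (max 0 (Re (u x)))\<^sup>2\<bar> + \<bar>(max 0 (- Re (u y)))\<^sup>2 - (max 0 (- Re (u x)))\<^sup>2\<bar>)
      + 2 * (\<bar>(max 0 (Im (u y)))\<^sup>2 - (max 0 (Im (u x)))\<^sup>2\<bar> + \<bar>(max 0 (- Im (u y)))\<^sup>2 - (max 0 (- Im (u x)))\<^sup>2\<bar>)"
      by (simp add: p_def)
    moreover have "(cmod (u y - u x))\<^sup>2 = (Re (u y) - Re (u x))\<^sup>2 + (Im (u y) - Im (u x))\<^sup>2"
      by (simp add: cmod_power2)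
    ultimately show ?thesis
      using add_mono[OF one[of "Re (u y)" "Re (u x)"] one[of "Im (u y)" "Im (u x)"]] by (simp only:)
  qed
  have lim: "(\<lambda>n. \<Sum>k<4. 2 * (shift_distance (p k) (r n))) \<longlonglongrightarrow> 0"
    using integrable_translation_continuous[OF ip] r
    by (intro tendsto_null_sum tendsto_mult_right_zero) (auto simp: translation_continuous_def)
  show ?thesis
  proof (rule tendsto_sandwich[OF _ _ tendsto_const lim])
    show "\<forall>\<^sub>F n in sequentially. (LINT x|lborel. (cmod (u (r n + x) - u x))\<^sup>2)
        \<le> (\<Sum>k<4. 2 * (shift_distance (p k) (r n)))"
    proof (intro always_eventually allI)
      fix n
      have i: "integrable lborel (\<lambda>x. \<Sum>k<4. 2 * \<bar>p k (r n + x) - p k x\<bar>)"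
        by (intro Bochner_Integration.integrable_sum integrable_mult_right abs_diff_translate_integrable ip)
      have "(LINT x|lborel. (cmod (u (r n + x) - u x))\<^sup>2) \<le> (LINT x|lborel. (\<Sum>k<4. 2 * \<bar>p k (r n + x) - p k x\<bar>))"
        by (intro integral_mono i bound Bochner_Integration.integrable_bound[OF i]) (use bound in \<open>auto intro: order_trans[OF _ abs_ge_self]\<close>)
      also have "\<dots> = (\<Sum>k<4. 2 * (shift_distance (p k) (r n)))"
        by (subst Bochner_Integration.integral_sum) (auto intro!: abs_diff_translate_integrable ip)
      finally show "(LINT x|lborel. (cmod (u (r n + x) - u x))\<^sup>2)
        \<le> (\<Sum>k<4. 2 * (shift_distance (p k) (r n)))" .
    qed
  qed (intro always_eventually allI integral_nonneg_AE AE_I2 zero_le_power2)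
qed

section \<open>The multiplication formula, autocorrelations and Plancherel's theorem\<close>

lemma fourier_measurable [measurable]:
  assumes [measurable]: "f \<in> borel_measurable borel"
  shows "fourier f \<in> borel_measurable borel"
  unfolding fourier_def[abs_def] by (rule lborel.borel_measurable_lebesgue_integral) measurable

lemma cmod_fourier_le:
  assumes "integrable lborel f"
  shows "cmod (fourier f w) \<le> (LINT t|lborel. cmod (f t))"
  unfolding fourier_def by (rule order_trans[OF integral_norm_bound]) (simp add: norm_mult)

lemma fourier_multiplication_integrable:
  fixes f g :: "'a::euclidean_space \<Rightarrow> complex"
  assumes f: "integrable lborel f" and g: "integrable lborel g"
  shows "integrable (lborel \<Otimes>\<^sub>M lborel) (\<lambda>(w, t). f w * (g t * cis (- 2 * pi * (t \<bullet> w))))"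
proof -
  have [measurable]: "f \<in> borel_measurable borel" "g \<in> borel_measurable borel"
    using f g by (auto dest: borel_measurable_integrable)
  have "(LINT t|lborel. norm (f w * (g t * cis (- 2 * pi * (t \<bullet> w))))) = cmod (f w) * (LINT t|lborel. cmod (g t))" for w
    by (simp add: norm_mult)
  moreover have "AE w in lborel. integrable lborel (\<lambda>t. f w * (g t * cis (- 2 * pi * (t \<bullet> w))))"
    by (intro AE_I2 integrable_mult_right integrable_mult_cis g) measurable
  ultimately show ?thesis
    using f by (intro lborel_pair.Fubini_integrable) auto
qed

text \<open>Fubini's theorem. In the proof of Plancherel's theorem it moves the transform from the
  autocorrelation onto a Gaussian.\<close>

lemma fourier_multiplication:
  fixes f g :: "'a::euclidean_space \<Rightarrow> complex"
  assumes f: "integrable lborel f" and g: "integrable lborel g"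
  shows "(LINT w|lborel. f w * fourier g w) = (LINT t|lborel. fourier f t * g t)"
proof -
  have "(LINT w|lborel. f w * fourier g w) = (LINT w|lborel. LINT t|lborel. f w * (g t * cis (- 2 * pi * (t \<bullet> w))))"
    by (simp add: fourier_def)
  also have "\<dots> = (LINT t|lborel. LINT w|lborel. f w * (g t * cis (- 2 * pi * (t \<bullet> w))))"
    by (rule lborel_pair.Fubini_integral[symmetric]) (rule fourier_multiplication_integrable[OF f g])
  also have "\<dots> = (LINT t|lborel. fourier f t * g t)"
  proof (intro Bochner_Integration.integral_cong refl)
    fix t
    have "(LINT w|lborel. f w * (g t * cis (- 2 * pi * (t \<bullet> w)))) = (LINT w|lborel. (f w * cis (- 2 * pi * (w \<bullet> t))) * g t)"
      by (simp add: inner_commute mult_ac)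
    then show "(LINT w|lborel. f w * (g t * cis (- 2 * pi * (t \<bullet> w)))) = fourier f t * g t"
      by (simp add: fourier_def)
  qed
  finally show ?thesis .
qed

text \<open>The convolution of \<open>u\<close> with its conjugate reflection. It connects both
  sides of Plancherel's theorem: its Fourier transform is the squared modulus of
  \<open>fourier u\<close>, and its value at 0 is the squared norm of \<open>u\<close>.\<close>

definition autocorrelation :: "('a::euclidean_space \<Rightarrow> complex) \<Rightarrow> 'a \<Rightarrow> complex" where
  "autocorrelation u r = (LINT t|lborel. u (r + t) * cnj (u t))"

lemma cnj_measurable [measurable]: "f \<in> borel_measurable M \<Longrightarrow> (\<lambda>x. cnj (f x)) \<in> borel_measurable M"
  by (rule borel_measurable_continuous_on[of cnj]) (auto intro: continuous_intros)

lemma autocorrelation_product_integrable: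
  fixes u :: "'a::euclidean_space \<Rightarrow> complex"
  assumes u: "integrable lborel u"
  shows "integrable (lborel \<Otimes>\<^sub>M lborel) (\<lambda>(t, r). u (t + r) * cis (- 2 * pi * (r \<bullet> w)) * cnj (u t))"
proof -
  have [measurable]: "u \<in> borel_measurable borel"
    using u by (auto dest: borel_measurable_integrable)
  have "(LINT r|lborel. norm (u (t + r) * cis (- 2 * pi * (r \<bullet> w)) * cnj (u t))) = (LINT r|lborel. cmod (u r)) * cmod (u t)" for t
    using integral_translate[of "\<lambda>x. cmod (u x)" t] by (simp add: norm_mult)
  moreover have "AE t in lborel. integrable lborel (\<lambda>r. u (t + r) * cis (- 2 * pi * (r \<bullet> w)) * cnj (u t))"
    by (intro AE_I2 integrable_mult_left integrable_mult_cis integrable_translate u) measurable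
  ultimately show ?thesis
    using u by (intro lborel_pair.Fubini_integrable) auto
qed

lemma fourier_translate:
  fixes u :: "'a::euclidean_space \<Rightarrow> complex"
  assumes [measurable]: "u \<in> borel_measurable borel"
  shows "(LINT r|lborel. u (t + r) * cis (- 2 * pi * (r \<bullet> w))) = fourier u w * cis (2 * pi * (t \<bullet> w))"
proof -
  have "(LINT r|lborel. u (t + r) * cis (- 2 * pi * (r \<bullet> w)))
      = (LINT r|lborel. (u (t + r) * cis (- 2 * pi * ((t + r) \<bullet> w))) * cis (2 * pi * (t \<bullet> w)))"
    by (intro Bochner_Integration.integral_cong) (auto simp: inner_add_left cis_mult mult.assoc algebra_simps)
  also have "\<dots> = (LINT r|lborel. u (t + r) * cis (- 2 * pi * ((t + r) \<bullet> w))) * cis (2 * pi * (t \<bullet> w))"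
    by (rule integral_mult_left_zero)
  also have "(LINT r|lborel. u (t + r) * cis (- 2 * pi * ((t + r) \<bullet> w))) = fourier u w"
    unfolding fourier_def by (rule integral_translate[of "\<lambda>r. u r * cis (- 2 * pi * (r \<bullet> w))"]) measurable
  finally show ?thesis .
qed

lemma cnj_fourier: "cnj (fourier u w) = (LINT t|lborel. cnj (u t) * cis (2 * pi * (t \<bullet> w)))"
  unfolding fourier_def by (subst Bochner_Integration.integral_cnj[symmetric]) (simp add: cis_cnj)

lemma autocorrelation_integrable:
  assumes "integrable lborel u"
  shows "integrable lborel (autocorrelation u)"
  using lborel_pair.integrable_snd[OF autocorrelation_product_integrable[OF assms, of 0]]
  by (simp add: autocorrelation_def[abs_def] add.commute)

lemma fourier_autocorrelation:
  fixes u :: "'a::euclidean_space \<Rightarrow> complex"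
  assumes u: "integrable lborel u"
  shows "fourier (autocorrelation u) w = of_real ((cmod (fourier u w))\<^sup>2)"
proof -
  have [measurable]: "u \<in> borel_measurable borel"
    using u by (auto dest: borel_measurable_integrable)
  have "fourier (autocorrelation u) w
      = (LINT r|lborel. LINT t|lborel. u (t + r) * cis (- 2 * pi * (r \<bullet> w)) * cnj (u t))"
    unfolding fourier_def autocorrelation_def
    by (subst integral_mult_left_zero[symmetric]) (simp add: mult_ac add.commute)
  also have "\<dots> = (LINT t|lborel. LINT r|lborel. u (t + r) * cis (- 2 * pi * (r \<bullet> w)) * cnj (u t))"
    by (rule lborel_pair.Fubini_integral) (rule autocorrelation_product_integrable[OF u])
  also have "\<dots> = (LINT t|lborel. fourier u w * (cnj (u t) * cis (2 * pi * (t \<bullet> w))))"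
    unfolding integral_mult_left_zero fourier_translate[OF \<open>u \<in> borel_measurable borel\<close>]
    by (simp add: mult_ac)
  also have "\<dots> = fourier u w * cnj (fourier u w)"
    by (simp add: cnj_fourier)
  finally show ?thesis by (simp add: mult_cnj_cmod2 del: of_real_power)
qed

lemma square_integrable_translate:
  assumes "square_integrable u" shows "square_integrable (\<lambda>x. u (r + x))"
proof -
  have "u \<in> borel_measurable borel" "integrable lborel (\<lambda>x. (cmod (u x))\<^sup>2)"
    using assms by (auto simp: square_integrable_def)
  then show ?thesis
    using integrable_translate[of "\<lambda>x. (cmod (u x))\<^sup>2" r] by (auto simp: square_integrable_def)
qed

lemma minus_abs:
  assumes "square_integrable f" "square_integrable g"
  shows "abs_l2 f - abs_l2 g = abs_l2 (\<lambda>x. f x - g x)"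
  using plus_abs[OF assms(1) square_integrable_cmult[OF assms(2), of "-1"]]
  by (simp add: minus_l2_def uminus_l2_def cscale_abs[OF assms(2)])

lemma norm2_abs:
  assumes "square_integrable f"
  shows "(norm (abs_l2 f))\<^sup>2 = (LINT x|lborel. (cmod (f x))\<^sup>2)"
proof -
  have "complex_of_real ((norm (abs_l2 f))\<^sup>2) = of_real (LINT x|lborel. (cmod (f x))\<^sup>2)"
    unfolding cinner_self[symmetric] cinner_abs[OF assms assms] mult_cnj_cmod2 by (rule integral_complex_of_real)
  then show ?thesis using of_real_eq_iff by blast
qed

lemma autocorrelation_cinner:
  assumes u: "square_integrable u"
  shows "autocorrelation u r = cinner (abs_l2 (\<lambda>t. u (r + t))) (abs_l2 u)"
  unfolding autocorrelation_def by (rule cinner_abs[symmetric]) (intro square_integrable_translate u)+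

lemma norm_translate:
  assumes u: "square_integrable u"
  shows "norm (abs_l2 (\<lambda>t. u (r + t))) = norm (abs_l2 u)"
proof -
  have "u \<in> borel_measurable borel" using u by (simp add: square_integrable_def)
  then have "(norm (abs_l2 (\<lambda>t. u (r + t))))\<^sup>2 = (norm (abs_l2 u))\<^sup>2"
    using integral_translate[of "\<lambda>x. (cmod (u x))\<^sup>2" r]
    by (simp add: norm2_abs square_integrable_translate u)
  then show ?thesis by simp
qed

lemma autocorrelation_bound:
  assumes u: "square_integrable u"
  shows "cmod (autocorrelation u r) \<le> (norm (abs_l2 u))\<^sup>2"
  unfolding autocorrelation_cinner[OF u]
  by (rule order_trans[OF cmod_cinner_le]) (simp add: norm_translate[OF u] power2_eq_square)

lemma autocorrelation_tendsto:
  assumes u: "square_integrable u" and r: "r \<longlonglongrightarrow> 0"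
  shows "(\<lambda>n. autocorrelation u (r n)) \<longlonglongrightarrow> of_real ((norm (abs_l2 u))\<^sup>2)"
proof -
  have "(\<lambda>n. (norm (abs_l2 (\<lambda>t. u (r n + t)) - abs_l2 u))\<^sup>2) \<longlonglongrightarrow> 0"
  proof -
    have "square_integrable (\<lambda>t. u (r n + t) - u t)" for n
      using square_integrable_add[OF square_integrable_translate[OF u] square_integrable_cmult[OF u, of "-1"]]
      by simp
    then show ?thesis
      using translation_continuous_L2[OF u r]
      unfolding minus_abs[OF square_integrable_translate[OF u] u] by (simp only: norm2_abs)
  qed
  then have "(\<lambda>n. sqrt ((norm (abs_l2 (\<lambda>t. u (r n + t)) - abs_l2 u))\<^sup>2)) \<longlonglongrightarrow> sqrt 0"
    by (rule tendsto_real_sqrt)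
  then have "(\<lambda>n. norm (abs_l2 (\<lambda>t. u (r n + t)) - abs_l2 u)) \<longlonglongrightarrow> 0"
    by simp
  then have "(\<lambda>n. abs_l2 (\<lambda>t. u (r n + t)) - abs_l2 u) \<longlonglongrightarrow> 0"
    by (rule tendsto_norm_zero_cancel)
  then have "(\<lambda>n. abs_l2 (\<lambda>t. u (r n + t))) \<longlonglongrightarrow> abs_l2 u"
    by (simp add: LIM_zero_iff)
  from bounded_linear.tendsto[OF bounded_linear_cinner_left this, of "abs_l2 u"]
  show ?thesis unfolding autocorrelation_cinner[OF u] cinner_self .
qed

lemma pos_def_scaleR: "c > 0 \<Longrightarrow> pos_def (\<lambda>x. c *\<^sub>R x)"
  by (auto simp: pos_def_def algebra_simps intro!: linearI)

lemma gaussian_scaled_integral: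
  assumes "d > 0"
  shows "(LINT w|(lborel :: 'a::euclidean_space measure). exp (- pi * (w \<bullet> (d\<^sup>2 *\<^sub>R w)))) = (1 / d) ^ DIM('a)"
  using integral_affine[of "\<lambda>w::'a. exp (- (pi * (norm w)\<^sup>2))" d 0] assms gaussian_integral[where 'a = 'a]
  by (simp add: power_mult_distrib power2_norm_eq_inner mult_ac)

lemma fourier_gaussian_scaled:
  fixes r :: "'a::euclidean_space"
  assumes "d > 0"
  shows "fourier (\<lambda>w. of_real (exp (- pi * (w \<bullet> (d\<^sup>2 *\<^sub>R w))))) r
      = of_real ((1 / d) ^ DIM('a) * exp (- (pi * (norm ((1 / d) *\<^sub>R r))\<^sup>2)))"
proof -
  have "fourier (\<lambda>w. of_real (exp (- pi * (w \<bullet> (d\<^sup>2 *\<^sub>R w))))) (d\<^sup>2 *\<^sub>R ((1 / d\<^sup>2) *\<^sub>R r))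
     = of_real ((1 / d) ^ DIM('a) * exp (- pi * (((1 / d\<^sup>2) *\<^sub>R r) \<bullet> (d\<^sup>2 *\<^sub>R ((1 / d\<^sup>2) *\<^sub>R r)))))"
    using assms by (subst fourier_gaussian[OF pos_def_scaleR]) (simp_all only: gaussian_scaled_integral zero_less_power)
  moreover have "((1 / d\<^sup>2) *\<^sub>R r) \<bullet> r = (norm ((1 / d) *\<^sub>R r))\<^sup>2"
    using assms unfolding power2_norm_eq_inner by (simp add: power2_eq_square)
  moreover have "d\<^sup>2 *\<^sub>R ((1 / d\<^sup>2) *\<^sub>R r) = r"
    using assms by simp
  ultimately show ?thesis by (simp only: mult_minus_left)
qed

text \<open>Gaussian regularisation: \<open>\<integral> exp (- pi d\<^sup>2 |w|\<^sup>2) |fourier u w|\<^sup>2 dw\<close> is a Gaussian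
  average of the autocorrelation of \<open>u\<close> at scale \<open>d\<close>, which tends to its value at 0.\<close>

theorem Plancherel:
  fixes u :: "'a::euclidean_space \<Rightarrow> complex"
  assumes u1: "integrable lborel u" and u2: "square_integrable u"
  shows "l2_mass (fourier u) = l2_mass u"
proof -
  have [measurable]: "u \<in> borel_measurable borel"
    using u1 by (auto dest: borel_measurable_integrable)
  define d where "d n = inverse (real (Suc n))" for n
  have d: "d n > 0" "d \<longlonglongrightarrow> 0" for n
    unfolding d_def using LIMSEQ_inverse_real_of_nat by auto
  \<comment> \<open>Gaussian weights that tend to 1. They make the integral of the squared modulus
    of \<open>fourier u\<close> finite while square integrability of \<open>fourier u\<close> is
    still unknown.\<close>
  define E where "E n w = exp (- pi * (w \<bullet> ((d n)\<^sup>2 *\<^sub>R w)))" for n and w :: 'a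
  have [measurable]: "E n \<in> borel_measurable borel" for n unfolding E_def by measurable
  have E: "integrable lborel (E n)" for n
    unfolding E_def by (rule pos_def_gaussian_integrable[OF pos_def_scaleR[OF zero_less_power[OF d(1)]]])
  have E1: "E n w \<le> 1" "E n w \<ge> 0" for n w by (auto simp: E_def)
  let ?N = "(norm (abs_l2 u))\<^sup>2" and ?R = "autocorrelation u"
  note R = autocorrelation_integrable[OF u1]
  have [measurable]: "?R \<in> borel_measurable borel"
    using R by (auto dest: borel_measurable_integrable)
  define J where "J n = (LINT w|lborel. E n w * (cmod (fourier u w))\<^sup>2)" for n
  have intJ: "integrable lborel (\<lambda>w. E n w * (cmod (fourier u w))\<^sup>2)" for n
  proof (rule Bochner_Integration.integrable_bound)
    let ?c = "(LINT t|lborel. cmod (u t))\<^sup>2"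
    show "integrable lborel (\<lambda>w. E n w * ?c)" using E by simp
    have "(cmod (fourier u w))\<^sup>2 \<le> ?c" for w
      using cmod_fourier_le[OF u1] by (intro power_mono) auto
    then show "AE w in lborel. norm (E n w * (cmod (fourier u w))\<^sup>2) \<le> norm (E n w * ?c)"
      using E1 by (auto simp: abs_mult intro!: mult_left_mono)
  qed measurable
  have "complex_of_real (J n) = (LINT y|lborel. of_real (exp (- (pi * (norm y)\<^sup>2))) * ?R (d n *\<^sub>R y))" for n
  proof -
    let ?G = "\<lambda>r. of_real (exp (- (pi * (norm ((1 / d n) *\<^sub>R r))\<^sup>2))) * ?R r"
    have "complex_of_real (J n) = (LINT w|lborel. of_real (E n w) * fourier ?R w)"
      unfolding J_def integral_complex_of_real[symmetric] by (simp add: fourier_autocorrelation[OF u1])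
    also have "\<dots> = (LINT r|lborel. fourier (\<lambda>w. of_real (E n w)) r * ?R r)"
      by (rule fourier_multiplication[OF _ R]) (rule integrable_of_real[OF E])
    also have "\<dots> = (LINT r|lborel. of_real ((1 / d n) ^ DIM('a)) * ?G r)"
      unfolding E_def fourier_gaussian_scaled[OF d(1)] by (simp only: of_real_mult mult.assoc)
    also have "\<dots> = (1 / \<bar>d n\<bar>) ^ DIM('a) *\<^sub>R (LINT r|lborel. ?G r)"
      using d(1)[of n] by (simp add: scaleR_conv_of_real)
    also have "\<dots> = (LINT y|lborel. ?G (0 + d n *\<^sub>R y))"
      using d(1)[of n] by (intro integral_affine[symmetric]) auto
    finally show ?thesis using d(1)[of n] by simp
  qed
  moreover have "(\<lambda>n. LINT y|lborel. complex_of_real (exp (- (pi * (norm y)\<^sup>2))) * ?R (d n *\<^sub>R y))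
      \<longlonglongrightarrow> (LINT y|(lborel::'a measure). of_real (exp (- (pi * (norm y)\<^sup>2))) * of_real ?N)"
  proof (rule integral_dominated_convergence[where w = "\<lambda>y. exp (- (pi * (norm y)\<^sup>2)) * ?N"])
    show "integrable lborel (\<lambda>y::'a. exp (- (pi * (norm y)\<^sup>2)) * ?N)"
      by (intro integrable_mult_left gaussian_integrable) simp
    show "AE y in lborel. (\<lambda>n. complex_of_real (exp (- (pi * (norm y)\<^sup>2))) * ?R (d n *\<^sub>R y))
        \<longlonglongrightarrow> of_real (exp (- (pi * (norm y)\<^sup>2))) * of_real ?N"
    proof (intro AE_I2 tendsto_mult_left autocorrelation_tendsto[OF u2])
      fix y :: 'a show "(\<lambda>n. d n *\<^sub>R y) \<longlonglongrightarrow> 0"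
        using tendsto_scaleR[OF d(2) tendsto_const[of y]] by simp
    qed
    show "AE y in lborel. norm (complex_of_real (exp (- (pi * (norm y)\<^sup>2))) * ?R (d n *\<^sub>R y)) \<le> exp (- (pi * (norm y)\<^sup>2)) * ?N" for n
      using autocorrelation_bound[OF u2] by (intro AE_I2) (simp add: norm_mult)
  qed measurable
  moreover have "(LINT y|(lborel::'a measure). complex_of_real (exp (- (pi * (norm y)\<^sup>2))) * of_real ?N) = of_real ?N"
    using gaussian_integral[where 'a = 'a] by (simp add: integral_complex_of_real del: of_real_power)
  ultimately have "(\<lambda>n. complex_of_real (J n)) \<longlonglongrightarrow> of_real ?N" by (simp only:)
  then have J: "J \<longlonglongrightarrow> ?N" by (simp only: tendsto_of_real_iff)
  have nnJ: "ennreal (J n) = (\<integral>\<^sup>+w. ennreal (E n w * (cmod (fourier u w))\<^sup>2) \<partial>lborel)" for n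
    unfolding J_def using intJ E1 by (intro nn_integral_eq_integral[symmetric]) auto
  have "l2_mass (fourier u) = ennreal ?N"
  \<comment> \<open>Fatou's lemma gives one inequality because \<open>E n\<close> tends to 1; the
    bound \<open>E n w \<le> 1\<close> gives the other.\<close>
  proof (rule antisym)
    have "l2_mass (fourier u)
       = (\<integral>\<^sup>+w. liminf (\<lambda>n. ennreal (E n w * (cmod (fourier u w))\<^sup>2)) \<partial>lborel)"
    proof (intro nn_integral_cong)
      fix w :: 'a
      have "(\<lambda>n. E n w) \<longlonglongrightarrow> exp (- pi * (w \<bullet> (0\<^sup>2 *\<^sub>R w)))"
        unfolding E_def by (intro tendsto_intros d(2))
      then have "(\<lambda>n. ennreal (E n w * (cmod (fourier u w))\<^sup>2)) \<longlonglongrightarrow> ennreal (1 * (cmod (fourier u w))\<^sup>2)"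
        by (intro tendsto_intros) simp
      then show "ennreal ((cmod (fourier u w))\<^sup>2) = liminf (\<lambda>n. ennreal (E n w * (cmod (fourier u w))\<^sup>2))"
        by (intro lim_imp_Liminf[symmetric]) auto
    qed
    also have "\<dots> \<le> liminf (\<lambda>n. \<integral>\<^sup>+w. ennreal (E n w * (cmod (fourier u w))\<^sup>2) \<partial>lborel)"
      by (intro nn_integral_liminf) simp
    also have "\<dots> = ennreal ?N"
      unfolding nnJ[symmetric] using J by (intro lim_imp_Liminf tendsto_ennrealI) auto
    finally show "l2_mass (fourier u) \<le> ennreal ?N" .
    have "ennreal (J n) \<le> l2_mass (fourier u)" for n
      unfolding nnJ using E1 by (intro nn_integral_mono ennreal_leI mult_left_le_one_le) auto
    then show "ennreal ?N \<le> l2_mass (fourier u)"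
      using tendsto_ennrealI[OF J] by (intro LIMSEQ_le_const2) auto
  qed
  then show ?thesis by (simp add: norm_l2_abs[OF u2])
qed

section \<open>Phase-space shifts and Moyal's identity\<close>

abbreviation rho_kernel :: "real ^ ('m::finite + 'm) \<Rightarrow> (real ^ 'm \<Rightarrow> complex) \<Rightarrow> real ^ 'm \<Rightarrow> complex" where
  "rho_kernel z f t \<equiv>
     cis (- pi * (frequency z \<bullet> position z)) * cis (2 * pi * (frequency z \<bullet> t)) * f (t - position z)"

lemma square_integrable_rho:
  fixes x :: "'a::euclidean_space"
  assumes "square_integrable f"
  shows "square_integrable (\<lambda>t. cis a * cis (b * (w \<bullet> t)) * f (t - x))"
proof -
  have [measurable]: "f \<in> borel_measurable borel" using assms by (simp add: square_integrable_def)
  have "square_integrable (\<lambda>t. f (- x + t))" by (rule square_integrable_translate[OF assms])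
  moreover have "(\<lambda>t. cis a * cis (b * (w \<bullet> t)) * f (t - x)) \<in> borel_measurable borel"
    by measurable
  ultimately show ?thesis by (simp add: square_integrable_def norm_mult)
qed

lemma rho_abs:
  assumes f: "square_integrable f"
  shows "rho z (abs_l2 f) = abs_l2 (\<lambda>t. rho_kernel z f t)"
  unfolding rho_def
proof (rule abs_l2_eqI)
  show "AE t in lborel. rho_kernel z (rep_l2 (abs_l2 f)) t
      = rho_kernel z f t"
    using AE_translate[OF rep_abs_l2[OF f], of "- position z"] by eventually_elim simp
qed (intro square_integrable_rho square_integrable_rep f)+

lemma rho_add: "rho z (f + g) = rho z f + rho z g"
proof -
  have "rho z (abs_l2 (rep_l2 f) + abs_l2 (rep_l2 g)) = rho z (abs_l2 (rep_l2 f)) + rho z (abs_l2 (rep_l2 g))"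
    by (simp add: plus_abs square_integrable_rep square_integrable_add rho_abs square_integrable_rho distrib_left)
  then show ?thesis by (simp add: abs_rep_l2)
qed

lemma rho_cscale: "rho z (cscale c f) = cscale c (rho z f)"
proof -
  have "rho z (cscale c (abs_l2 (rep_l2 f))) = cscale c (rho z (abs_l2 (rep_l2 f)))"
    unfolding cscale_abs[OF square_integrable_rep] rho_abs[OF square_integrable_rep]
      rho_abs[OF square_integrable_cmult[OF square_integrable_rep]]
      cscale_abs[OF square_integrable_rho[OF square_integrable_rep]]
    by (simp only: mult_ac)
  then show ?thesis by (simp add: abs_rep_l2)
qed

section \<open>Composition of phase-space shifts, and unitary operators\<close>

definition symplectic_form :: "real ^ ('m::finite + 'm) \<Rightarrow> real ^ ('m + 'm) \<Rightarrow> real" where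
  "symplectic_form a b = frequency a \<bullet> position b - frequency b \<bullet> position a"

lemma symplectic_form_simps:
  "symplectic_form (a + b) c = symplectic_form a c + symplectic_form b c" "symplectic_form c (a + b) = symplectic_form c a + symplectic_form c b"
  "symplectic_form (a - b) c = symplectic_form a c - symplectic_form b c" "symplectic_form c (a - b) = symplectic_form c a - symplectic_form c b"
  "symplectic_form (- a) c = - symplectic_form a c" "symplectic_form c (- a) = - symplectic_form c a"
  "symplectic_form (r *\<^sub>R a) c = r * symplectic_form a c" "symplectic_form c (r *\<^sub>R a) = r * symplectic_form c a"
  "symplectic_form a a = 0" "symplectic_form 0 c = 0" "symplectic_form c 0 = 0"
  by (simp_all add: symplectic_form_def algebra_simps)

lemma symplectic_form_commute: "symplectic_form b a = - symplectic_form a b"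
  by (simp add: symplectic_form_def)

text \<open>The half phase built into \<open>rho\<close> leaves only the antisymmetric part of the
  cocycle. In particular \<open>rho (- z)\<close> inverts \<open>rho z\<close> without a
  phase.\<close>

lemma rho_rho: "rho a (rho b f) = cscale (cis (pi * symplectic_form a b)) (rho (a + b) f)"
proof -
  let ?f = "rep_l2 f"
  have "cis (- pi * (frequency a \<bullet> position a)) * cis (2 * pi * (frequency a \<bullet> t))
      * (cis (- pi * (frequency b \<bullet> position b)) * cis (2 * pi * (frequency b \<bullet> (t - position a))) * ?f (t - position a - position b))
    = cis (pi * symplectic_form a b) * (cis (- pi * (frequency (a + b) \<bullet> position (a + b))) * cis (2 * pi * (frequency (a + b) \<bullet> t)) * ?f (t - position (a + b)))" for t
  proof -
    have l: "cis p * cis q * (cis r * cis s * F) = cis (p + q + r + s) * F" for p q r s and F :: complex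
      by (simp add: cis_mult[symmetric])
    have r: "cis p * (cis q * cis r * F) = cis (p + q + r) * F" for p q r and F :: complex
      by (simp add: cis_mult[symmetric])
    have "- pi * (frequency a \<bullet> position a) + 2 * pi * (frequency a \<bullet> t)
        + - pi * (frequency b \<bullet> position b) + 2 * pi * (frequency b \<bullet> (t - position a))
      = pi * symplectic_form a b + - pi * (frequency (a + b) \<bullet> position (a + b)) + 2 * pi * (frequency (a + b) \<bullet> t)"
      by (simp add: symplectic_form_def inner_add_left inner_add_right inner_diff_right algebra_simps)
    then show ?thesis unfolding l r by (simp add: diff_diff_eq)
  qed
  then have "rho a (rho b (abs_l2 ?f)) = cscale (cis (pi * symplectic_form a b)) (rho (a + b) (abs_l2 ?f))"
    unfolding rho_abs[OF square_integrable_rep] rho_abs[OF square_integrable_rho[OF square_integrable_rep]]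
      cscale_abs[OF square_integrable_rho[OF square_integrable_rep]]
    by (intro arg_cong[where f = abs_l2] ext)
  then show ?thesis by (simp add: abs_rep_l2)
qed

lemma rho_0 [simp]: "rho 0 f = f"
proof -
  have "rho 0 (abs_l2 (rep_l2 f)) = abs_l2 (rep_l2 f)"
    by (subst rho_abs[OF square_integrable_rep]) simp
  then show ?thesis by (simp add: abs_rep_l2)
qed

lemma rho_inverse [simp]: "rho z (rho (- z) f) = f" "rho (- z) (rho z f) = f"
  by (simp_all add: rho_rho symplectic_form_simps)

lemma cinner_rho_rho [simp]: "cinner (rho z f) (rho z g) = cinner f g"
proof -
  let ?r = "\<lambda>f t. rho_kernel z f t"
  have "cinner (rho z (abs_l2 (rep_l2 f))) (rho z (abs_l2 (rep_l2 g))) = (LINT t|lborel. ?r (rep_l2 f) t * cnj (?r (rep_l2 g) t))"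
    by (simp only: rho_abs[OF square_integrable_rep] cinner_abs[OF square_integrable_rho[OF square_integrable_rep] square_integrable_rho[OF square_integrable_rep]])
  also have "\<dots> = (LINT t|lborel. rep_l2 f (- position z + t) * cnj (rep_l2 g (- position z + t)))"
  proof (intro Bochner_Integration.integral_cong refl)
    fix t
    have "?r (rep_l2 f) t * cnj (?r (rep_l2 g) t)
       = (cis (- pi * (frequency z \<bullet> position z)) * cnj (cis (- pi * (frequency z \<bullet> position z))))
        * (cis (2 * pi * (frequency z \<bullet> t)) * cnj (cis (2 * pi * (frequency z \<bullet> t))))
        * (rep_l2 f (t - position z) * cnj (rep_l2 g (t - position z)))"
      by (simp only: complex_cnj_mult mult_ac)
    then show "?r (rep_l2 f) t * cnj (?r (rep_l2 g) t) = rep_l2 f (- position z + t) * cnj (rep_l2 g (- position z + t))"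
      by (simp add: cis_cnj cis_mult)
  qed
  also have "\<dots> = cinner f g"
    unfolding cinner_rep by (rule integral_translate[of "\<lambda>t. rep_l2 f t * cnj (rep_l2 g t)"]) measurable
  finally show ?thesis by (simp add: abs_rep_l2)
qed

lemma norm_rho [simp]: "norm (rho z f) = norm f"
  by (rule norm_eqI) (simp_all only: cinner_rho_rho cinner_self[of f] norm_ge_zero)

lemma bounded_clinearI:
  assumes "\<And>f g. T (f + g) = T f + T g" "\<And>c f. T (cscale c f) = cscale c (T f)"
    "\<And>f. norm (T f) \<le> K * norm f"
  shows "bounded_clinear T"
  unfolding bounded_clinear_def
  using assms by (auto intro!: bounded_linear_intro[where K = K] simp: cscale_of_real[symmetric] mult.commute)

lemma bounded_clinear_rho: "bounded_clinear (rho z)"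
  by (rule bounded_clinearI[where K = 1]) (auto simp: rho_add rho_cscale)

lemma unitary_rho: "unitary (rho z)"
  unfolding unitary_def surj_def using bounded_clinear_rho rho_inverse(1)[symmetric] by (metis cinner_rho_rho)

text \<open>\<open>cadjoint\<close> is a definite description. The inner product is nondegenerate,
  so any map that satisfies the adjoint relation is the one described.\<close>

lemma cadjoint_eqI:
  assumes "\<And>f g. cinner (T f) g = cinner f (T' g)"
  shows "cadjoint T = T'"
  unfolding cadjoint_def
proof (rule the_equality)
  fix S assume "\<forall>f g. cinner (T f) g = cinner f (S g)"
  with assms have "cinner f (S g) = cinner f (T' g)" for f g by simp
  then show "S = T'" by (intro ext cinner_ext_right)
qed (use assms in auto)

lemma unitary_cinner: "unitary U \<Longrightarrow> cinner (U f) (U g) = cinner f g"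
  by (simp add: unitary_def)

lemma unitary_inj:
  assumes "unitary U" shows "inj U"
proof (rule injI)
  fix f g assume "U f = U g"
  then have "cinner (U h) (U f) = cinner (U h) (U g)" for h by simp
  then show "f = g" using unitary_cinner[OF assms] by (intro cinner_ext_right) simp
qed

lemma cadjoint_unitary:
  assumes U: "unitary U" shows "cadjoint U = inv U"
proof (rule cadjoint_eqI)
  fix f g
  have "U (inv U g) = g" using U by (simp add: unitary_def surj_f_inv_f)
  then show "cinner (U f) g = cinner f (inv U g)" using unitary_cinner[OF U, of f "inv U g"] by simp
qed

lemma unitary_cadjoint [simp]:
  assumes "unitary U"
  shows "U (cadjoint U g) = g" "cadjoint U (U f) = f"
  using assms unitary_inj[OF assms] by (simp_all add: cadjoint_unitary unitary_def surj_f_inv_f)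

lemma cinner_cadjoint:
  assumes "unitary U"
  shows "cinner (U f) g = cinner f (cadjoint U g)" "cinner g (U f) = cinner (cadjoint U g) f"
  using unitary_cinner[OF assms, of f "cadjoint U g"] unitary_cinner[OF assms, of "cadjoint U g" f] assms
  by simp_all

lemma unitary_norm: "unitary U \<Longrightarrow> norm (U f) = norm f"
  by (rule norm_eqI) (simp_all only: unitary_cinner cinner_self[of f] norm_ge_zero)

lemma unitary_diff: "unitary U \<Longrightarrow> U (f - g) = U f - U g"
  by (simp add: unitary_def bounded_clinear_def linear_diff bounded_linear.linear)

lemma cadjoint_rho [simp]: "cadjoint (rho z) = rho (- z)"
proof (rule cadjoint_eqI)
  fix f g show "cinner (rho z f) g = cinner f (rho (- z) g)"
    using cinner_rho_rho[of z f "rho (- z) g"] by simp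
qed

lemma cinner_rho_left: "cinner (rho z f) g = cinner f (rho (- z) g)"
  using cinner_cadjoint(1)[OF unitary_rho[of z]] by simp

section \<open>Ambiguity functions and Moyal's identity\<close>

definition amb :: "(real ^ 'm::finite) l2 \<Rightarrow> (real ^ 'm) l2 \<Rightarrow> real ^ ('m + 'm) \<Rightarrow> complex" where
  "amb f g z = cinner f (rho z g)"

lemma amb_integral:
  assumes "square_integrable f" "square_integrable g"
  shows "amb (abs_l2 f) (abs_l2 g) z
    = cis (pi * (frequency z \<bullet> position z)) * fourier (\<lambda>t. f t * cnj (g (t - position z))) (frequency z)"
  unfolding amb_def rho_abs[OF assms(2)] cinner_abs[OF assms(1) square_integrable_rho[OF assms(2)]] fourier_def
  by (subst integral_mult_right_zero[symmetric])
     (auto intro!: Bochner_Integration.integral_cong simp: cis_cnj mult_ac inner_commute)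

lemma amb_measurable [measurable]: "amb f g \<in> borel_measurable borel"
proof -
  have "(\<lambda>z. cis (pi * (frequency z \<bullet> position z)) * fourier (\<lambda>t. rep_l2 f t * cnj (rep_l2 g (t - position z))) (frequency z))
     \<in> borel_measurable borel"
    unfolding fourier_def
    by (intro borel_measurable_times lborel.borel_measurable_lebesgue_integral) measurable
  also have "(\<lambda>z. cis (pi * (frequency z \<bullet> position z)) * fourier (\<lambda>t. rep_l2 f t * cnj (rep_l2 g (t - position z))) (frequency z))
     = amb f g"
    using amb_integral[OF square_integrable_rep[of f] square_integrable_rep[of g]]
    by (simp add: fun_eq_iff abs_rep_l2)
  finally show ?thesis .
qed

text \<open>At a fixed position \<open>x\<close> the ambiguity function is, up to a phase, the
  Fourier transform of \<open>u x\<close>, the product of \<open>f\<close> with the conjugate of a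
  translate of \<open>g\<close>. After Plancherel in the frequency variable, Tonelli's theorem
  separates the two norms.\<close>

lemma Moyal_nn_integral:
  "l2_mass (amb f g) = ennreal ((norm f * norm g)\<^sup>2)"
proof -
  define u where "u x t = rep_l2 f t * cnj (rep_l2 g (t - x))" for x t
  have u_meas [measurable]: "case_prod u \<in> borel_measurable (borel \<Otimes>\<^sub>M borel)" "u x \<in> borel_measurable borel" for x
    unfolding u_def by measurable
  have sq: "square_integrable (\<lambda>t. rep_l2 g (t - x))" for x
    using square_integrable_translate[OF square_integrable_rep[of g], of "- x"] by simp
  have u1: "integrable lborel (u x)" for x
    unfolding u_def by (rule square_integrable_mult_cnj[OF square_integrable_rep sq])
  have "(\<integral>\<^sup>+x. \<integral>\<^sup>+t. ennreal ((cmod (u x t))\<^sup>2) \<partial>lborel \<partial>lborel)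
      = (\<integral>\<^sup>+t. \<integral>\<^sup>+x. ennreal ((cmod (u x t))\<^sup>2) \<partial>lborel \<partial>lborel)"
    by (rule lborel_pair.Fubini'[symmetric]) measurable
  also have "\<dots> = (\<integral>\<^sup>+t. ennreal ((cmod (rep_l2 f t))\<^sup>2) * ennreal ((norm g)\<^sup>2) \<partial>lborel)"
  proof (intro nn_integral_cong)
    fix t
    have "(\<integral>\<^sup>+x. ennreal ((cmod (u x t))\<^sup>2) \<partial>lborel)
        = ennreal ((cmod (rep_l2 f t))\<^sup>2) * (\<integral>\<^sup>+x. ennreal ((cmod (rep_l2 g (t + (-1) *\<^sub>R x)))\<^sup>2) \<partial>lborel)"
      by (simp add: u_def norm_mult power_mult_distrib ennreal_mult nn_integral_cmult)
    also have "(\<integral>\<^sup>+x. ennreal ((cmod (rep_l2 g (t + (-1) *\<^sub>R x)))\<^sup>2) \<partial>lborel) = ennreal ((norm g)\<^sup>2)"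
      unfolding norm_l2_rep by (subst nn_integral_affine[of "\<lambda>x. ennreal ((cmod (rep_l2 g x))\<^sup>2)"]) auto
    finally show "(\<integral>\<^sup>+x. ennreal ((cmod (u x t))\<^sup>2) \<partial>lborel) = ennreal ((cmod (rep_l2 f t))\<^sup>2) * ennreal ((norm g)\<^sup>2)" .
  qed
  also have "\<dots> = ennreal ((norm f * norm g)\<^sup>2)"
    by (subst nn_integral_multc) (simp_all add: norm_l2_rep[symmetric] ennreal_mult[symmetric] power_mult_distrib)
  finally have total: "(\<integral>\<^sup>+x. \<integral>\<^sup>+t. ennreal ((cmod (u x t))\<^sup>2) \<partial>lborel \<partial>lborel) = ennreal ((norm f * norm g)\<^sup>2)" .
  \<comment> \<open>Every \<open>u x\<close> is integrable, but Plancherel also asks for square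
    integrability, which finiteness of the total gives for almost every \<open>x\<close>.\<close>
  then have "AE x in lborel. l2_mass (u x) \<noteq> \<infinity>"
    by (intro nn_integral_PInf_AE) auto
  then have "AE x in lborel. l2_mass (fourier (u x)) = l2_mass (u x)"
  proof eventually_elim
    fix x assume "l2_mass (u x) \<noteq> \<infinity>"
    then have "square_integrable (u x)"
      by (intro square_integrableI) (auto simp: less_top)
    then show "l2_mass (fourier (u x)) = l2_mass (u x)"
      by (rule Plancherel[OF u1])
  qed
  then have "(\<integral>\<^sup>+x. \<integral>\<^sup>+w. ennreal ((cmod (fourier (u x) w))\<^sup>2) \<partial>lborel \<partial>lborel) = ennreal ((norm f * norm g)\<^sup>2)"
    unfolding total[symmetric] by (rule nn_integral_cong_AE)
  moreover have "cmod (amb f g (join x w)) = cmod (fourier (u x) w)" for x w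
    using amb_integral[OF square_integrable_rep[of f] square_integrable_rep[of g], of "join x w"]
    by (simp add: abs_rep_l2 u_def[abs_def] norm_mult)
  ultimately show ?thesis
    by (subst nn_integral_join) simp_all
qed

lemma amb_square_integrable: "square_integrable (amb f g)"
  by (rule square_integrableI) (simp_all add: Moyal_nn_integral)

definition ambl :: "(real ^ 'm::finite) l2 \<Rightarrow> (real ^ 'm) l2 \<Rightarrow> (real ^ ('m + 'm)) l2" where
  "ambl f g = abs_l2 (amb f g)"

lemma norm_ambl: "norm (ambl f g) = norm f * norm g"
proof -
  have "ennreal ((norm (ambl f g))\<^sup>2) = ennreal ((norm f * norm g)\<^sup>2)"
    unfolding ambl_def norm_l2_abs[OF amb_square_integrable] by (rule Moyal_nn_integral)
  then have "(norm (ambl f g))\<^sup>2 = (norm f * norm g)\<^sup>2" by simp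
  then show ?thesis by (simp add: power2_eq_iff_nonneg)
qed

lemma ambl_linear:
  "ambl (f + f') g = ambl f g + ambl f' g" "ambl f (g + g') = ambl f g + ambl f g'"
  "ambl (cscale c f) g = cscale c (ambl f g)" "ambl f (cscale c g) = cscale (cnj c) (ambl f g)"
  unfolding ambl_def plus_abs[OF amb_square_integrable amb_square_integrable] cscale_abs[OF amb_square_integrable]
  by (auto intro!: arg_cong[where f = abs_l2]
      simp: fun_eq_iff amb_def cinner_add_left cinner_add_right rho_add rho_cscale cinner_cscale_left cinner_cscale_right)

text \<open>Polarisation: the diagonal at \<open>f + g\<close> gives
  \<open>B f g + B g f = 0\<close>, and at \<open>f + cscale \<i> g\<close> it gives
  \<open>B g f = B f g\<close>.\<close>

lemma sesquilinear_eq_0: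
  fixes B :: "'a::euclidean_space l2 \<Rightarrow> 'a l2 \<Rightarrow> complex"
  assumes "\<And>f f' g. B (f + f') g = B f g + B f' g" "\<And>f g g'. B f (g + g') = B f g + B f g'"
    and "\<And>c f g. B (cscale c f) g = c * B f g" "\<And>c f g. B f (cscale c g) = cnj c * B f g"
    and diag: "\<And>f. B f f = 0"
  shows "B f g = 0"
proof -
  have "B f g + B g f = 0"
    using diag[of "f + g"] unfolding assms(1,2) by (simp add: diag add.commute)
  moreover have "\<i> * B g f - \<i> * B f g = 0"
    using diag[of "f + cscale \<i> g"] unfolding assms(1-4) by (simp add: diag)
  ultimately show ?thesis
    by (simp add: complex_eq_iff)
qed

theorem Moyal: "cinner (ambl f g) (ambl f' g') = cinner f f' * cinner g' g"
proof -
  \<comment> \<open>\<open>norm_ambl\<close> is the case of equal pairs. It is polarised here in the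
    first arguments, with the windows still equal.\<close>
  have diag: "cinner (ambl f g) (ambl f' g) - cinner f f' * cinner g g = 0" for f f' g :: "(real ^ 'a) l2"
    by (rule sesquilinear_eq_0[of "\<lambda>f f'. cinner (ambl f g) (ambl f' g) - cinner f f' * cinner g g"])
       (simp_all add: ambl_linear cinner_add_left cinner_add_right cinner_cscale_left cinner_cscale_right
          cinner_self norm_ambl power_mult_distrib algebra_simps)
  \<comment> \<open>Now the windows are polarised. \<open>ambl\<close> is conjugate linear in its
    window, so the form is linear in \<open>g'\<close> and conjugate linear in \<open>g\<close>,
    which fixes their order.\<close>
  have "cinner (ambl f g) (ambl f' g') - cinner f f' * cinner g' g = 0"
    by (rule sesquilinear_eq_0[of "\<lambda>g' g. cinner (ambl f g) (ambl f' g') - cinner f f' * cinner g' g"])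
       (simp_all add: ambl_linear cinner_add_left cinner_add_right cinner_cscale_left cinner_cscale_right
          diag[simplified] algebra_simps)
  then show ?thesis by simp
qed

section \<open>Wigner functions and the Weyl correspondence\<close>

text \<open>The parity operator. It appears because the two arguments in the Wigner integral run in
  opposite directions.\<close>

definition reflect :: "'a::euclidean_space l2 \<Rightarrow> 'a l2" where
  "reflect f = abs_l2 (\<lambda>t. rep_l2 f (- t))"

lemma square_integrable_scale:
  fixes t :: "'a::euclidean_space"
  assumes "square_integrable f" "c \<noteq> 0" shows "square_integrable (\<lambda>x. f (t + c *\<^sub>R x))"
proof -
  have "f \<in> borel_measurable borel" "integrable lborel (\<lambda>x. (cmod (f x))\<^sup>2)"
    using assms by (auto simp: square_integrable_def)
  then show ?thesis
    using integrable_affine[OF _ assms(2), of "\<lambda>x. (cmod (f x))\<^sup>2" t] by (auto simp: square_integrable_def)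
qed

lemma square_integrable_reflect: "square_integrable f \<Longrightarrow> square_integrable (\<lambda>t. f (- t))"
  using square_integrable_scale[of f "-1" 0] by simp

lemma reflect_abs: "square_integrable f \<Longrightarrow> reflect (abs_l2 f) = abs_l2 (\<lambda>t. f (- t))"
  unfolding reflect_def using AE_affine[OF rep_abs_l2[of f], of "-1" 0]
  by (intro abs_l2_eqI) (auto intro: square_integrable_reflect square_integrable_rep)

lemma cinner_reflect: "cinner (reflect f) (reflect g) = cinner f g"
proof -
  have "cinner (reflect f) (reflect g) = (LINT t|lborel. rep_l2 f (0 + (-1) *\<^sub>R t) * cnj (rep_l2 g (0 + (-1) *\<^sub>R t)))"
    unfolding reflect_def by (subst cinner_abs) (simp_all add: square_integrable_reflect square_integrable_rep)
  also have "\<dots> = cinner f g"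
    unfolding cinner_rep by (subst integral_affine[of "\<lambda>t. rep_l2 f t * cnj (rep_l2 g t)"]) auto
  finally show ?thesis .
qed

lemma reflect_linear: "reflect (f + g) = reflect f + reflect g" "reflect (cscale c f) = cscale c (reflect f)"
proof -
  have "reflect (abs_l2 (rep_l2 f) + abs_l2 (rep_l2 g)) = reflect (abs_l2 (rep_l2 f)) + reflect (abs_l2 (rep_l2 g))"
    by (simp only: plus_abs square_integrable_rep square_integrable_add reflect_abs square_integrable_reflect)
  then show "reflect (f + g) = reflect f + reflect g" by (simp add: abs_rep_l2)
  have "reflect (cscale c (abs_l2 (rep_l2 f))) = cscale c (reflect (abs_l2 (rep_l2 f)))"
    by (simp only: cscale_abs square_integrable_rep square_integrable_cmult reflect_abs square_integrable_reflect)
  then show "reflect (cscale c f) = cscale c (reflect f)" by (simp add: abs_rep_l2)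
qed

lemma reflect_rho: "reflect (rho z f) = rho (- z) (reflect f)"
proof -
  have "reflect (rho z (abs_l2 (rep_l2 f))) = rho (- z) (reflect (abs_l2 (rep_l2 f)))"
    unfolding reflect_abs[OF square_integrable_rep] rho_abs[OF square_integrable_rep]
      rho_abs[OF square_integrable_reflect[OF square_integrable_rep]] reflect_abs[OF square_integrable_rho[OF square_integrable_rep]]
    by simp
  then show ?thesis by (simp add: abs_rep_l2)
qed

text \<open>The substitution \<open>s = position z + t / 2\<close> turns the cross-Wigner integral into the pairing
  with a phase-space shift of the reflected second function.\<close>

lemma cross_wigner_eq:
  fixes f g :: "(real ^ 'n::finite) l2"
  shows "cross_wigner f g z = of_real (2 ^ CARD('n)) * cinner f (rho (2 *\<^sub>R z) (reflect g))"
proof -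
  let ?x = "position z" and ?w = "frequency z"
  define F where "F s = rep_l2 f s * cnj (cis (- pi * (frequency (2 *\<^sub>R z) \<bullet> position (2 *\<^sub>R z)))
      * cis (2 * pi * (frequency (2 *\<^sub>R z) \<bullet> s)) * rep_l2 g (- (s - position (2 *\<^sub>R z))))" for s
  have [measurable]: "F \<in> borel_measurable borel" unfolding F_def by measurable
  have "cinner f (rho (2 *\<^sub>R z) (reflect g)) = cinner (abs_l2 (rep_l2 f)) (rho (2 *\<^sub>R z) (abs_l2 (\<lambda>t. rep_l2 g (- t))))"
    by (simp add: abs_rep_l2 reflect_def)
  also have "\<dots> = integral\<^sup>L lborel F"
    unfolding rho_abs[OF square_integrable_reflect[OF square_integrable_rep]]
      cinner_abs[OF square_integrable_rep square_integrable_rho[OF square_integrable_reflect[OF square_integrable_rep]]]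
      F_def ..
  finally have c: "cinner f (rho (2 *\<^sub>R z) (reflect g)) = integral\<^sup>L lborel F" .
  have "cross_wigner f g z = (LINT t|lborel. F (?x + (1/2) *\<^sub>R t))"
    unfolding cross_wigner_def
  proof (intro Bochner_Integration.integral_cong refl)
    fix t
    have ph: "cis (- 2 * pi * (t \<bullet> ?w))
      = cnj (cis (- pi * (frequency (2 *\<^sub>R z) \<bullet> position (2 *\<^sub>R z))) * cis (2 * pi * (frequency (2 *\<^sub>R z) \<bullet> (?x + (1/2) *\<^sub>R t))))"
      by (simp add: cis_cnj cis_mult inner_add_right inner_commute algebra_simps)
    have arg: "- (?x + (1/2) *\<^sub>R t - position (2 *\<^sub>R z)) = ?x - (1/2) *\<^sub>R t"
      unfolding linear_cmul[OF linear_position] by (simp add: scaleR_2)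
    show "rep_l2 f (?x + (1/2) *\<^sub>R t) * cnj (rep_l2 g (?x - (1/2) *\<^sub>R t)) * cis (- 2 * pi * (t \<bullet> ?w)) = F (?x + (1/2) *\<^sub>R t)"
      unfolding F_def ph arg by (simp only: complex_cnj_mult mult_ac)
  qed
  also have "\<dots> = of_real (2 ^ CARD('n)) * integral\<^sup>L lborel F"
    by (subst integral_affine) (auto simp: scaleR_conv_of_real power_one_over)
  finally show ?thesis unfolding c .
qed

section \<open>Wigner functions: Moyal's identity, covariance and totality\<close>

definition wigl :: "(real ^ 'n::finite) l2 \<Rightarrow> (real ^ 'n) l2 \<Rightarrow> (real ^ ('n + 'n)) l2" where
  "wigl f g = abs_l2 (cross_wigner f g)"

lemma cross_wigner_amb: "cross_wigner f g = (\<lambda>z. of_real (2 ^ CARD('n)) * amb f (reflect g) (0 + 2 *\<^sub>R z))"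
  for f g :: "(real ^ 'n::finite) l2"
  by (simp add: fun_eq_iff cross_wigner_eq amb_def)

lemma cross_wigner_square_integrable: "square_integrable (cross_wigner f g)"
  unfolding cross_wigner_amb by (intro square_integrable_cmult square_integrable_scale amb_square_integrable) simp

text \<open>Each cross-Wigner function carries a factor \<open>2 ^ CARD('n)\<close>; their product
  cancels the Jacobian of the dilation by 2 on phase space.\<close>

lemma wigl_Moyal:
  fixes f g f' g' :: "(real ^ 'n::finite) l2"
  shows "cinner (wigl f g) (wigl f' g') = cinner f f' * cinner g' g"
proof -
  let ?c = "complex_of_real (2 ^ CARD('n))"
  define H where "H z = amb f (reflect g) z * cnj (amb f' (reflect g') z)" for z
  have [measurable]: "H \<in> borel_measurable borel" unfolding H_def by measurable
  have "cinner (wigl f g) (wigl f' g') = (LINT z|lborel. (?c * ?c) * H (0 + 2 *\<^sub>R z))"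
    unfolding wigl_def cinner_abs[OF cross_wigner_square_integrable cross_wigner_square_integrable]
    unfolding cross_wigner_amb H_def
    by (intro Bochner_Integration.integral_cong refl) (simp only: complex_cnj_mult complex_cnj_complex_of_real mult_ac)
  also have "\<dots> = (?c * ?c) * (LINT z|lborel. H (0 + 2 *\<^sub>R z))"
    by (rule integral_mult_right_zero)
  also have "(LINT z|lborel. H (0 + 2 *\<^sub>R z)) = (1 / 2) ^ (CARD('n) + CARD('n)) *\<^sub>R integral\<^sup>L lborel H"
    by (subst integral_affine) simp_all
  also have "integral\<^sup>L lborel H = cinner (ambl f (reflect g)) (ambl f' (reflect g'))"
    unfolding ambl_def cinner_abs[OF amb_square_integrable amb_square_integrable] H_def ..
  also have "\<dots> = cinner f f' * cinner g' g"
    unfolding Moyal cinner_reflect ..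
  also have "?c * ?c * ((1 / 2) ^ (CARD('n) + CARD('n)) *\<^sub>R (cinner f f' * cinner g' g)) = cinner f f' * cinner g' g"
    by (simp add: scaleR_conv_of_real power_add power_one_over)
  finally show ?thesis .
qed

lemma norm_wigl: "norm (wigl f g) = norm f * norm g"
  by (rule norm_eqI) (simp_all add: wigl_Moyal cinner_self[of f] cinner_self[of g] power_mult_distrib)

lemma wigl_linear:
  "wigl (f + f') g = wigl f g + wigl f' g" "wigl f (g + g') = wigl f g + wigl f g'"
  "wigl (cscale c f) g = cscale c (wigl f g)" "wigl f (cscale c g) = cscale (cnj c) (wigl f g)"
  unfolding wigl_def plus_abs[OF cross_wigner_square_integrable cross_wigner_square_integrable] cscale_abs[OF cross_wigner_square_integrable]
  by (auto intro!: arg_cong[where f = abs_l2]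
      simp: fun_eq_iff cross_wigner_eq cinner_add_left cinner_add_right rho_add rho_cscale reflect_linear
        cinner_cscale_left cinner_cscale_right distrib_left)

text \<open>Together with the shift in \<open>cross_wigner_eq\<close> the two shifts combine into
  one. The reflection reverses the sign of \<open>b\<close>, so translation uses the mean of
  \<open>a\<close> and \<open>b\<close>, and modulation their difference.\<close>

lemma wigl_rho_phase:
  fixes f g :: "(real ^ 'n::finite) l2"
  shows "cross_wigner (rho a f) (rho b g) y
     = cis (- pi * symplectic_form a b) * cis (2 * pi * symplectic_form (a - b) y) * cross_wigner f g (y - (1/2) *\<^sub>R (a + b))"
proof -
  have ar: "- a + (2 *\<^sub>R y + - b) = 2 *\<^sub>R (y - (1/2) *\<^sub>R (a + b))"
    by (simp add: scaleR_diff_right)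
  have "cinner (rho a f) (rho (2 *\<^sub>R y) (reflect (rho b g)))
      = cinner f (rho (- a) (rho (2 *\<^sub>R y) (rho (- b) (reflect g))))"
    by (simp add: cinner_rho_left reflect_rho)
  also have "\<dots> = cnj (cis (pi * symplectic_form (2 *\<^sub>R y) (- b))) * (cnj (cis (pi * symplectic_form (- a) (2 *\<^sub>R y + - b)))
      * cinner f (rho (2 *\<^sub>R (y - (1/2) *\<^sub>R (a + b))) (reflect g)))"
    unfolding rho_rho rho_cscale cinner_cscale_right ar by (simp only: cscale_cscale cinner_cscale_right complex_cnj_mult mult.assoc)
  also have "\<dots> = cis (- pi * symplectic_form a b) * cis (2 * pi * symplectic_form (a - b) y) * cinner f (rho (2 *\<^sub>R (y - (1/2) *\<^sub>R (a + b))) (reflect g))"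
  proof -
    have "- (pi * symplectic_form (2 *\<^sub>R y) (- b)) + - (pi * symplectic_form (- a) (2 *\<^sub>R y + - b)) = - pi * symplectic_form a b + 2 * pi * symplectic_form (a - b) y"
      by (simp only: symplectic_form_simps symplectic_form_commute[of y b]) (simp add: algebra_simps)
    then show ?thesis
      unfolding cis_cnj mult.assoc[symmetric] cis_mult by (simp only:)
  qed
  finally show ?thesis
    unfolding cross_wigner_eq by (simp only: mult_ac)
qed

text \<open>A quarter turn of phase space, which rewrites the Euclidean pairing with
  \<open>q\<close> in the modulation of \<open>rho\<close> as a symplectic pairing.\<close>

definition dual_shift :: "real ^ ('n::finite + 'n) \<Rightarrow> real ^ ('n + 'n)" where
  "dual_shift q = join (- frequency q) (position q)"

lemma symplectic_form_dual_shift: "symplectic_form (dual_shift q) y = q \<bullet> y"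
  by (simp add: symplectic_form_def dual_shift_def inner_phase_space inner_commute)

text \<open>The two shifts have mean \<open>p\<close> and difference \<open>d\<close>, so they act
  on the Wigner function as translation by \<open>p\<close> and modulation by \<open>q\<close>. Up
  to phases, the set of Wigner functions is therefore stable under all shifts of the doubled phase
  space.\<close>

lemma wigl_rho:
  fixes f g :: "(real ^ 'n::finite) l2" and p q :: "real ^ ('n + 'n)"
  defines "d \<equiv> dual_shift q"
  shows "\<exists>c. cmod c = 1 \<and> wigl (rho (p + (1/2) *\<^sub>R d) f) (rho (p - (1/2) *\<^sub>R d) g) = cscale c (rho (join p q) (wigl f g))"
proof -
  let ?a = "p + (1/2) *\<^sub>R d" and ?b = "p - (1/2) *\<^sub>R d"
  have ab: "?a - ?b = d" "(1/2) *\<^sub>R (?a + ?b) = p"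
    by (simp_all add: scaleR_add_right[symmetric] scaleR_add_left[symmetric] del: scaleR_add_right)
  define c where "c = cis (- pi * symplectic_form ?a ?b) * cis (pi * (q \<bullet> p))"
  have "cross_wigner (rho ?a f) (rho ?b g) y
     = c * (rho_kernel (join p q) (cross_wigner f g) y)" for y
    unfolding wigl_rho_phase ab d_def symplectic_form_dual_shift c_def
    by (simp add: cis_mult mult.assoc[symmetric] symplectic_form_dual_shift)
  then have "wigl (rho ?a f) (rho ?b g) = cscale c (rho (join p q) (wigl f g))"
    unfolding wigl_def rho_abs[OF cross_wigner_square_integrable] cscale_abs[OF square_integrable_rho[OF cross_wigner_square_integrable]]
    by (intro arg_cong[where f = abs_l2] ext)
  moreover have "cmod c = 1" by (simp add: c_def norm_mult)
  ultimately show ?thesis by blast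
qed

lemma wigl_rho_diag: "wigl (rho z f) (rho z g) = rho (join z 0) (wigl f g)"
proof -
  have "cross_wigner (rho z f) (rho z g) y
     = rho_kernel (join z 0) (cross_wigner f g) y" for y
    unfolding wigl_rho_phase by (simp add: symplectic_form_simps scaleR_add_right[symmetric] scaleR_2[symmetric])
  then show ?thesis
    unfolding wigl_def rho_abs[OF cross_wigner_square_integrable] by (intro arg_cong[where f = abs_l2] ext)
qed

lemma l2_nonzero_exists: "\<exists>f :: 'a::euclidean_space l2. f \<noteq> 0"
proof -
  let ?g = "\<lambda>x::'a. complex_of_real (exp (- (pi * (norm x)\<^sup>2)))"
  have sq: "square_integrable ?g"
    using gaussian_integrable[of "2 * pi", where 'a = 'a]
    by (simp add: square_integrable_def power2_eq_square exp_add[symmetric] algebra_simps)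
  have "(norm (abs_l2 ?g))\<^sup>2 = (LINT x|(lborel :: 'a measure). exp (- (pi * (norm (0 + sqrt 2 *\<^sub>R x))\<^sup>2)))"
    unfolding norm2_abs[OF sq] by (intro Bochner_Integration.integral_cong)
       (auto simp: power2_eq_square exp_add[symmetric] algebra_simps)
  also have "\<dots> = (1 / sqrt 2) ^ DIM('a)"
    by (subst integral_affine[of "\<lambda>x. exp (- (pi * (norm x)\<^sup>2))"]) (simp_all add: gaussian_integral)
  finally have "abs_l2 ?g \<noteq> 0" by auto
  then show ?thesis by blast
qed

text \<open>Phase-space shifts of \<open>f\<close> and \<open>g\<close> produce all shifts of \<open>wigl f g\<close>, so Moyal's identity
  one level up applies to a function orthogonal to every \<open>wigl f g\<close>.\<close>

lemma wigl_total:
  fixes H :: "(real ^ ('n::finite + 'n)) l2"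
  assumes "\<And>f g. cinner H (wigl f g) = 0"
  shows "H = 0"
proof -
  obtain f :: "(real ^ 'n) l2" where f: "f \<noteq> 0" using l2_nonzero_exists by blast
  have "amb H (wigl f f) \<zeta> = 0" for \<zeta>
  proof -
    obtain a b c where c: "cmod c = 1" "wigl (rho a f) (rho b f) = cscale c (rho (join (position \<zeta>) (frequency \<zeta>)) (wigl f f))"
      using wigl_rho by blast
    have "cnj c * cinner H (rho \<zeta> (wigl f f)) = 0"
      using assms[of "rho a f" "rho b f"] unfolding c(2) cinner_cscale_right by simp
    then show ?thesis using c(1) by (auto simp: amb_def)
  qed
  then have "amb H (wigl f f) = (\<lambda>_. 0)" by (rule ext)
  then have "ambl H (wigl f f) = abs_l2 (\<lambda>_. 0)" by (simp only: ambl_def)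
  then have "norm (ambl H (wigl f f)) = 0" by (simp add: zero_l2_def[symmetric])
  then show ?thesis using f by (simp add: norm_ambl norm_wigl)
qed

section \<open>Quantization and the identification of \<open>HS\<close> with square-integrable
  symbols\<close>

definition quantize :: "(real ^ ('n::finite + 'n)) l2 \<Rightarrow> (real ^ 'n) l2 \<Rightarrow> (real ^ 'n) l2" where
  "quantize H g = (SOME h. \<forall>f. cinner (wigl f g) H = cinner f h)"

text \<open>For fixed \<open>g\<close> the right-hand side is a bounded linear functional of
  \<open>f\<close> by \<open>norm_wigl\<close>, so the Riesz theorem provides the vector that
  \<open>SOME\<close> selects. Every property of \<open>quantize\<close> is derived from this weak
  formula.\<close>

lemma cinner_weyl: "cinner f (quantize H g) = cinner (wigl f g) H"
proof -
  have bl: "bounded_linear (\<lambda>f. cinner (wigl f g) H)"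
  proof (rule bounded_linear_intro[where K = "norm g * norm H"])
    fix f show "norm (cinner (wigl f g) H) \<le> norm f * (norm g * norm H)"
      using cmod_cinner_le[of "wigl f g" H] by (simp add: norm_wigl mult.assoc)
  qed (simp_all add: wigl_linear cinner_add_left cscale_of_real[symmetric] cinner_cscale_left scaleR_conv_of_real)
  have cl: "cinner (wigl (cscale c f) g) H = c * cinner (wigl f g) H" for c f
    by (simp add: wigl_linear cinner_cscale_left)
  obtain h where h: "\<And>f. cinner (wigl f g) H = cinner f h"
    using Riesz_representation[OF bl cl] by blast
  then have "\<exists>h. \<forall>f. cinner (wigl f g) H = cinner f h" by blast
  then have "\<forall>f. cinner (wigl f g) H = cinner f (quantize H g)"
    unfolding quantize_def by (rule someI_ex)
  then show ?thesis by simp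
qed

lemma cinner_weyl_left: "cinner (quantize H g) f = cinner H (wigl f g)"
  by (subst (1 2) cinner_commute) (simp add: cinner_weyl)

lemma bounded_clinear_weyl: "bounded_clinear (quantize H)"
proof (rule bounded_clinearI[where K = "norm H"])
  fix f g c
  show "quantize H (f + g) = quantize H f + quantize H g"
    by (rule cinner_ext_right) (simp add: cinner_weyl wigl_linear cinner_add_left cinner_add_right)
  show "quantize H (cscale c f) = cscale c (quantize H f)"
    by (rule cinner_ext_right) (simp add: cinner_weyl wigl_linear cinner_cscale_left cinner_cscale_right)
  let ?h = "quantize H f"
  have "(norm ?h)\<^sup>2 = cmod (cinner ?h ?h)"
    by (simp add: cinner_self norm_power)
  also have "\<dots> = cmod (cinner (wigl ?h f) H)" by (simp only: cinner_weyl)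
  also have "\<dots> \<le> norm ?h * norm f * norm H"
    using cmod_cinner_le[of "wigl ?h f" H] by (simp only: norm_wigl)
  finally have "norm ?h * norm ?h \<le> norm ?h * (norm H * norm f)"
    by (simp add: power2_eq_square mult_ac)
  then show "norm ?h \<le> norm H * norm f"
    by (cases "norm ?h = 0") auto
qed

lemma weyl_add: "quantize (H + H') = (\<lambda>f. quantize H f + quantize H' f)"
  by (intro ext cinner_ext_right) (simp add: cinner_weyl cinner_add_right)

lemma weyl_cscale: "quantize (cscale c H) = (\<lambda>f. cscale c (quantize H f))"
  by (intro ext cinner_ext_right) (simp add: cinner_weyl cinner_cscale_right)

lemma inj_weyl: "inj quantize"
proof (rule injI)
  fix H H' :: "(real ^ ('a + 'a)) l2" assume eq: "quantize H = quantize H'"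
  have "H - H' = 0"
  proof (rule wigl_total)
    fix f g
    have "cinner H (wigl f g) = cinner H' (wigl f g)"
      unfolding cinner_weyl_left[symmetric] eq ..
    then show "cinner (H - H') (wigl f g) = 0"
      by (simp add: cinner_diff_left)
  qed
  then show "H = H'" by simp
qed

lemma weyl_wigl: "quantize (wigl f g) = f \<otimes>\<^sub>o g"
  unfolding rank_one_def
  by (intro ext cinner_ext_right) (simp add: cinner_weyl wigl_Moyal cinner_cscale_right cinner_commute[of g])

context
  fixes B :: "(real ^ 'n::finite) l2 set"
  assumes B: "orthonormal_basis B"
begin

text \<open>The indices are pairs of basis vectors, which is why \<open>orthonormal_on\<close> and
  \<open>total_on\<close> speak of indexed families and not of sets of vectors.\<close>

lemma wigl_orthonormal: "orthonormal_on (\<lambda>(e, f). wigl f e) (B \<times> B)"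
  using B by (auto simp: orthonormal_on_def orthonormal_basis_def wigl_Moyal)

text \<open>The coefficients of \<open>H\<close> against this family are the matrix coefficients of
  \<open>quantize H\<close> in the basis, so totality follows from injectivity of
  \<open>quantize\<close>.\<close>

lemma wigl_total_on: "total_on (\<lambda>(e, f). wigl f e) (B \<times> B)"
  unfolding total_on_def
proof (intro allI impI)
  fix H :: "(real ^ ('n + 'n)) l2"
  assume H: "\<forall>i\<in>B \<times> B. cinner H (case i of (e, f) \<Rightarrow> wigl f e) = 0"
  have "quantize H = quantize 0"
  proof (rule bounded_clinear_eqI[OF B bounded_clinear_weyl bounded_clinear_weyl])
    fix e assume e: "e \<in> B"
    have zero: "cinner (quantize H e) f = 0" if "f \<in> B" for f
      using H e that by (auto simp: cinner_weyl_left)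
    have "quantize H e = 0"
      using B zero by (auto simp: orthonormal_basis_def)
    moreover have "quantize 0 e = 0"
      by (rule cinner_ext_right) (simp add: cinner_weyl)
    ultimately show "quantize H e = quantize 0 e" by simp
  qed
  then show "H = 0" by (rule injD[OF inj_weyl])
qed

text \<open>Parseval in the Wigner family is a sum over pairs. Its inner sum over \<open>f\<close>
  is Parseval for the vectors \<open>quantize H e\<close> and \<open>quantize H' e\<close>.\<close>

lemma weyl_inner_has_sum:
  "((\<lambda>e. cinner (quantize H e) (quantize H' e)) has_sum cinner H H') B"
proof (rule has_sum_SigmaD)
  show "((\<lambda>p. cinner H (case p of (e, f) \<Rightarrow> wigl f e) * cinner (case p of (e, f) \<Rightarrow> wigl f e) H') has_sum cinner H H') (B \<times> B)"
    by (rule Parseval[OF wigl_orthonormal wigl_total_on])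
  fix e assume "e \<in> B"
  have "((\<lambda>f. cinner (quantize H e) f * cinner f (quantize H' e)) has_sum
      cinner (quantize H e) (quantize H' e)) B"
    using B by (intro Parseval) (auto simp: orthonormal_basis_iff)
  then show "((\<lambda>f. cinner H (case (e, f) of (e, f) \<Rightarrow> wigl f e) * cinner (case (e, f) of (e, f) \<Rightarrow> wigl f e) H') has_sum
      cinner (quantize H e) (quantize H' e)) B"
    by (simp add: cinner_weyl cinner_weyl_left)
qed

lemma weyl_norm_summable: "(\<lambda>e. (norm (quantize H e))\<^sup>2) summable_on B"
  using has_sum_Re[OF weyl_inner_has_sum[of H H]] has_sum_imp_summable
  by (fastforce simp: cinner_self simp del: of_real_power)

text \<open>The squared matrix coefficients of \<open>T\<close> are summable over pairs, so
  Riesz-Fischer in the Wigner family provides a symbol with exactly these coefficients.\<close>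

lemma HS_weyl:
  assumes T: "bounded_clinear T" and summable: "(\<lambda>e. (norm (T e))\<^sup>2) summable_on B"
  shows "T \<in> range quantize"
proof -
  have "(\<lambda>p. (cmod (case p of (e, f) \<Rightarrow> cinner (T e) f))\<^sup>2) summable_on B \<times> B"
  proof (rule summable_on_SigmaI)
    fix e assume "e \<in> B"
    show "((\<lambda>f. (cmod (case (e, f) of (e, f) \<Rightarrow> cinner (T e) f))\<^sup>2) has_sum (norm (T e))\<^sup>2) B"
      using Parseval_norm[of "\<lambda>f. f" B "T e"] B by (simp add: orthonormal_basis_iff)
  qed (use summable in auto)
  then obtain H where H: "\<And>p. p \<in> B \<times> B \<Longrightarrow> cinner H (case p of (e, f) \<Rightarrow> wigl f e) = (case p of (e, f) \<Rightarrow> cinner (T e) f)"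
    using Riesz_Fischer[OF wigl_orthonormal] by metis
  have "T = quantize H"
  proof (rule bounded_clinear_eqI[OF B T bounded_clinear_weyl])
    fix e assume e: "e \<in> B"
    have zero: "cinner (T e - quantize H e) f = 0" if "f \<in> B" for f
      using H[of "(e, f)"] e that by (simp add: cinner_diff_left cinner_weyl_left)
    have "T e - quantize H e = 0"
      using B zero unfolding orthonormal_basis_def by blast
    then show "T e = quantize H e" by simp
  qed
  then show ?thesis by simp
qed

end

text \<open>\<open>HS\<close> asks for some basis with summable squares. One inclusion works with
  whatever basis comes with the operator and the other with any basis, so independence of the basis
  is a by-product.\<close>

lemma HS_eq: "(HS :: ((real ^ 'n::finite) l2 \<Rightarrow> (real ^ 'n) l2) set) = range quantize"
proof
  show "HS \<subseteq> range (quantize :: _ \<Rightarrow> (real ^ 'n) l2 \<Rightarrow> _)"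
    unfolding HS_def using HS_weyl by blast
  obtain B :: "(real ^ 'n) l2 set" where "orthonormal_basis B"
    using orthonormal_basis_exists by blast
  then show "range (quantize :: _ \<Rightarrow> (real ^ 'n) l2 \<Rightarrow> _) \<subseteq> HS"
    unfolding HS_def using bounded_clinear_weyl weyl_norm_summable by blast
qed

lemma hs_inner_weyl: "hs_inner (quantize H) (quantize H') = cinner H H'"
  unfolding hs_inner_def
  using weyl_inner_has_sum[OF someI_ex[OF orthonormal_basis_exists]] by (rule infsumI)

text \<open>\<open>weyl_symbol\<close> is selected by \<open>SOME\<close>; this exhibits a map that
  has all the required properties.\<close>

lemma weyl_map_inv: "weyl_map (inv quantize)"
  unfolding weyl_map_def HS_eq
proof (intro conjI ballI allI)
  note [simp] = inv_f_f[OF inj_weyl]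
  show "inv quantize (\<lambda>f. S f + T f) = inv quantize S + inv quantize T"
    if "S \<in> range quantize" "T \<in> range quantize" for S T :: "(real ^ 'a) l2 \<Rightarrow> (real ^ 'a) l2"
    using that by (auto simp: weyl_add[symmetric])
  show "inv quantize (\<lambda>f. cscale c (T f)) = cscale c (inv quantize T)"
    if "T \<in> range quantize" for c and T :: "(real ^ 'a) l2 \<Rightarrow> (real ^ 'a) l2"
    using that by (auto simp: weyl_cscale[symmetric])
  show "cinner (inv quantize S) (inv quantize T) = hs_inner S T"
    if "S \<in> range quantize" "T \<in> range quantize" for S T :: "(real ^ 'a) l2 \<Rightarrow> (real ^ 'a) l2"
    using that by (auto simp: hs_inner_weyl)
  show "inv quantize ` range quantize = (UNIV :: (real ^ ('a + 'a)) l2 set)"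
    by (simp add: image_image)
  show "inv quantize (f \<otimes>\<^sub>o g) = abs_l2 (cross_wigner f g)" for f g :: "(real ^ 'a) l2"
    by (simp add: weyl_wigl[symmetric] wigl_def[symmetric])
qed

text \<open>Whichever map was selected preserves inner products and sends rank-one operators to
  Wigner functions. Totality of the Wigner functions then determines it on
  \<open>HS\<close>.\<close>

lemma weyl_symbol_weyl: "weyl_symbol (quantize H) = H"
proof -
  have W: "weyl_map (weyl_symbol :: _ \<Rightarrow> (real ^ ('a + 'a)) l2)"
    unfolding weyl_symbol_def by (rule someI[of weyl_map]) (rule weyl_map_inv)
  have "weyl_symbol (quantize H) - H = 0"
  proof (rule wigl_total)
    fix f g
    have "cinner (weyl_symbol (quantize H)) (weyl_symbol (quantize (wigl f g))) = cinner H (wigl f g)"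
      using W by (simp add: weyl_map_def HS_eq hs_inner_weyl)
    moreover have "weyl_symbol (quantize (wigl f g)) = wigl f g"
      using W unfolding weyl_map_def weyl_wigl by (simp add: wigl_def)
    ultimately show "cinner (weyl_symbol (quantize H) - H) (wigl f g) = 0"
      by (simp add: cinner_diff_left)
  qed
  then show ?thesis by simp
qed

lemma weyl_op_eq: "weyl_op = quantize"
  unfolding weyl_op_def[abs_def] HS_eq
  by (intro ext the_equality) (auto simp: weyl_symbol_weyl)

lemma weyl_symbol_rank_one: "weyl_symbol (f \<otimes>\<^sub>o g) = wigl f g"
  by (simp add: weyl_wigl[symmetric] weyl_symbol_weyl)

text \<open>In the weak formula the two shifts of \<open>alpha\<close> move to the two arguments of
  the Wigner function, where equal shifts act as a pure translation.\<close>

lemma alpha_weyl: "alpha z (quantize H) = quantize (rho (join z 0) H)"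
proof (intro ext cinner_ext_right)
  fix f g
  have m: "- join z 0 = join (- z) 0" by (simp add: phase_space_eq_iff)
  have "cinner f (alpha z (quantize H) g) = cinner (rho (- z) f) (quantize H (rho (- z) g))"
    using cinner_rho_left[of "- z" f] by (simp add: alpha_def)
  also have "\<dots> = cinner (rho (- join z 0) (wigl f g)) H"
    by (simp add: cinner_weyl wigl_rho_diag m)
  also have "\<dots> = cinner (wigl f g) (rho (join z 0) H)"
    by (simp add: cinner_rho_left)
  finally show "cinner f (alpha z (quantize H) g) = cinner f (quantize (rho (join z 0) H) g)"
    by (simp add: cinner_weyl)
qed

lemma cohen_diag_weyl:
  "cohen_diag (quantize G) (quantize H) z = cinner H (rho (join z 0) G)"
  by (simp add: cohen_diag_def alpha_weyl hs_inner_weyl)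

section \<open>Chirped Gaussians\<close>

lemma pos_def_inverse:
  fixes P :: "'a::euclidean_space \<Rightarrow> 'a"
  assumes P: "pos_def P"
  obtains Pv where "pos_def Pv" "\<And>x. P (Pv x) = x" "\<And>x. Pv (P x) = x"
proof -
  have lin: "linear P" and sym: "\<And>x y. P x \<bullet> y = x \<bullet> P y" and pos: "\<And>x. x \<noteq> 0 \<Longrightarrow> x \<bullet> P x > 0"
    using P by (auto simp: pos_def_def)
  have "inj P"
    unfolding linear_injective_0[OF lin] using pos by force
  then obtain Pv where Pv: "linear Pv" "\<And>x. Pv (P x) = x" "\<And>x. P (Pv x) = x"
    using linear_injective_isomorphism[OF lin] by metis
  have "pos_def Pv"
    unfolding pos_def_def
  proof (intro conjI allI impI Pv(1))
    show "Pv x \<bullet> y = x \<bullet> Pv y" for x y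
      using sym[of "Pv x" "Pv y"] by (simp add: Pv inner_commute)
    fix x :: 'a assume "x \<noteq> 0"
    then have "Pv x \<noteq> 0" using Pv(3)[of x] linear_0[OF lin] by auto
    from pos[OF this] show "x \<bullet> Pv x > 0" by (simp add: Pv inner_commute)
  qed
  then show thesis using that Pv by blast
qed

lemma pos_defD:
  assumes "pos_def P"
  shows "linear P" "P x \<bullet> y = x \<bullet> P y" "x \<noteq> 0 \<Longrightarrow> x \<bullet> P x > 0"
  using assms by (auto simp: pos_def_def)

text \<open>The exponent is a complex quadratic form with real part from \<open>P\<close> and
  imaginary part from \<open>Q\<close>. A chirp must be allowed because metaplectic images of a
  Gaussian have one in general.\<close>

definition chirped_gaussian :: "('a::euclidean_space \<Rightarrow> 'a) \<Rightarrow> ('a \<Rightarrow> 'a) \<Rightarrow> 'a \<Rightarrow> complex" where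
  "chirped_gaussian P Q x = of_real (exp (- pi * (x \<bullet> P x))) * cis (- pi * (x \<bullet> Q x))"

lemma linear_measurable: "linear Q \<Longrightarrow> (Q :: 'a::euclidean_space \<Rightarrow> 'a) \<in> borel_measurable borel"
  by (intro borel_measurable_continuous_onI linear_continuous_on) (simp add: linear_conv_bounded_linear)

lemma cmod_chirped_gaussian: "cmod (chirped_gaussian P Q x) = exp (- pi * (x \<bullet> P x))"
  by (simp add: chirped_gaussian_def norm_mult)

lemma chirped_gaussian_square_integrable:
  assumes P: "pos_def P" and Q: "linear Q"
  shows "square_integrable (chirped_gaussian P Q)"
proof -
  note [measurable] = pos_def_measurable[OF P] linear_measurable[OF Q]
  have "pos_def (\<lambda>x. 2 *\<^sub>R P x)"
    using P by (auto simp: pos_def_def linear_compose_scale_right)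
  from pos_def_gaussian_integrable[OF this]
  have "integrable lborel (\<lambda>x. (cmod (chirped_gaussian P Q x))\<^sup>2)"
    by (simp add: cmod_chirped_gaussian power2_eq_square exp_add[symmetric] algebra_simps)
  moreover have "chirped_gaussian P Q \<in> borel_measurable borel"
    unfolding chirped_gaussian_def[abs_def] by measurable
  ultimately show ?thesis by (simp add: square_integrable_def)
qed

lemma norm_chirped_gaussian:
  assumes P: "pos_def P" and Q: "linear Q"
  shows "(norm (abs_l2 (chirped_gaussian P Q)))\<^sup>2 = (LINT s|lborel. exp (- pi * (s \<bullet> (2 *\<^sub>R P s))))"
  unfolding norm2_abs[OF chirped_gaussian_square_integrable[OF assms]]
  by (simp add: cmod_chirped_gaussian power2_eq_square exp_add[symmetric] algebra_simps)

text \<open>Centred at the midpoint of the translation, the product of the Gaussian with its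
  conjugate translate has no mixed real term, and the chirps differ by a linear phase only. What
  remains is the Fourier transform of a Gaussian at the frequency \<open>w + Q x\<close>.\<close>

lemma amb_chirped_gaussian:
  fixes z :: "real ^ ('m::finite + 'm)"
  assumes P: "pos_def P" and Pv: "\<And>x. P (Pv x) = x" and Q: "linear Q" and symQ: "\<And>x y. Q x \<bullet> y = x \<bullet> Q y"
  defines "f \<equiv> abs_l2 (chirped_gaussian P Q)"
  defines "x \<equiv> position z" and "w \<equiv> frequency z"
  shows "amb f f z = of_real ((norm f)\<^sup>2) * of_real (exp (- (pi / 2) * (x \<bullet> P x + (w + Q x) \<bullet> Pv (w + Q x))))"
proof -
  let ?g = "chirped_gaussian P Q"
  note [measurable] = pos_def_measurable[OF P] linear_measurable[OF Q]
  have [measurable]: "?g \<in> borel_measurable borel"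
    using chirped_gaussian_square_integrable[OF P Q] by (simp add: square_integrable_def)
  note linP = linear_add[OF pos_defD(1)[OF P]] linear_diff[OF pos_defD(1)[OF P]] linear_cmul[OF pos_defD(1)[OF P]]
  note linQ = linear_add[OF Q] linear_diff[OF Q] linear_cmul[OF Q]
  define y where "y = (1/2) *\<^sub>R x"
  have xy: "x = 2 *\<^sub>R y" by (simp add: y_def)
  have P2: "pos_def (\<lambda>x. 2 *\<^sub>R P x)"
    using P by (auto simp: pos_def_def linear_compose_scale_right)
  \<comment> \<open>Chosen so that \<open>w + Q x\<close> becomes \<open>2 *\<^sub>R P v\<close>,
    the shape of frequency at which \<open>fourier_gaussian\<close> evaluates the transform.\<close>
  define v where "v = (1/2) *\<^sub>R Pv (w + Q x)"
  have v: "2 *\<^sub>R P v = w + Q x" "v \<bullet> (2 *\<^sub>R P v) = (1/2) * ((w + Q x) \<bullet> Pv (w + Q x))"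
    by (simp_all add: v_def linP Pv inner_commute)
  have prod: "?g (y + s) * cnj (?g (y + s - x))
     = of_real (exp (- (pi / 2) * (x \<bullet> P x))) * (of_real (exp (- pi * (s \<bullet> (2 *\<^sub>R P s)))) * cis (- 2 * pi * (s \<bullet> Q x)))" for s
  proof -
    have s: "y + s - x = s - y" by (simp add: xy scaleR_2)
    have e1: "- pi * ((y + s) \<bullet> P (y + s)) + - pi * ((s - y) \<bullet> P (s - y))
        = - (pi / 2) * (x \<bullet> P x) + - pi * (s \<bullet> (2 *\<^sub>R P s))"
      by (simp add: xy linP inner_add_left inner_add_right inner_diff_left inner_diff_right algebra_simps)
    have e2: "- pi * ((y + s) \<bullet> Q (y + s)) + - (- pi * ((s - y) \<bullet> Q (s - y))) = - 2 * pi * (s \<bullet> Q x)"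
      using symQ[of y s] by (simp add: xy linQ inner_add_left inner_add_right inner_diff_left inner_diff_right inner_commute algebra_simps)
    have "?g (y + s) * cnj (?g (y + s - x))
      = of_real (exp (- pi * ((y + s) \<bullet> P (y + s))) * exp (- pi * ((s - y) \<bullet> P (s - y))))
        * (cis (- pi * ((y + s) \<bullet> Q (y + s))) * cis (- (- pi * ((s - y) \<bullet> Q (s - y)))))"
      unfolding s chirped_gaussian_def by (simp only: complex_cnj_mult complex_cnj_complex_of_real cis_cnj of_real_mult mult_ac)
    also have "\<dots> = of_real (exp (- (pi / 2) * (x \<bullet> P x)) * exp (- pi * (s \<bullet> (2 *\<^sub>R P s)))) * cis (- 2 * pi * (s \<bullet> Q x))"
      unfolding exp_add[symmetric] cis_mult e1 e2 ..
    finally show ?thesis by (simp only: of_real_mult mult.assoc)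
  qed
  define F where "F t = ?g t * cnj (?g (t - x)) * cis (- 2 * pi * (t \<bullet> w))" for t
  have [measurable]: "F \<in> borel_measurable borel" unfolding F_def by measurable
  have "fourier (\<lambda>t. ?g t * cnj (?g (t - x))) w = integral\<^sup>L lborel F"
    by (simp add: fourier_def F_def[abs_def])
  also have "\<dots> = (LINT s|lborel. F (y + s))"
    by (rule integral_translate[symmetric]) measurable
  also have "\<dots> = (LINT s|lborel. (of_real (exp (- (pi / 2) * (x \<bullet> P x))) * cis (- 2 * pi * (y \<bullet> w)))
      * (of_real (exp (- pi * (s \<bullet> (2 *\<^sub>R P s)))) * cis (- 2 * pi * (s \<bullet> (2 *\<^sub>R P v)))))"
  proof (intro Bochner_Integration.integral_cong refl)
    fix s
    have e: "cis (- 2 * pi * ((y + s) \<bullet> w)) = cis (- 2 * pi * (y \<bullet> w)) * cis (- 2 * pi * (s \<bullet> w))"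
      "cis (- 2 * pi * (s \<bullet> (w + Q x))) = cis (- 2 * pi * (s \<bullet> w)) * cis (- 2 * pi * (s \<bullet> Q x))"
      unfolding cis_mult by (simp_all add: inner_add_left inner_add_right algebra_simps)
    show "F (y + s) = (of_real (exp (- (pi / 2) * (x \<bullet> P x))) * cis (- 2 * pi * (y \<bullet> w)))
      * (of_real (exp (- pi * (s \<bullet> (2 *\<^sub>R P s)))) * cis (- 2 * pi * (s \<bullet> (2 *\<^sub>R P v))))"
      unfolding F_def prod v(1) e by (simp only: mult_ac)
  qed
  also have "\<dots> = of_real (exp (- (pi / 2) * (x \<bullet> P x))) * cis (- 2 * pi * (y \<bullet> w))
      * fourier (\<lambda>s. of_real (exp (- pi * (s \<bullet> (2 *\<^sub>R P s))))) (2 *\<^sub>R P v)"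
    unfolding fourier_def by (rule integral_mult_right_zero)
  also have "fourier (\<lambda>s. of_real (exp (- pi * (s \<bullet> (2 *\<^sub>R P s))))) (2 *\<^sub>R P v)
      = of_real ((norm f)\<^sup>2 * exp (- pi * ((1/2) * ((w + Q x) \<bullet> Pv (w + Q x)))))"
    unfolding fourier_gaussian[OF P2] v(2) f_def norm_chirped_gaussian[OF P Q] ..
  finally have four: "fourier (\<lambda>t. ?g t * cnj (?g (t - x))) w = of_real (exp (- (pi / 2) * (x \<bullet> P x))) * cis (- 2 * pi * (y \<bullet> w))
      * of_real ((norm f)\<^sup>2 * exp (- pi * ((1/2) * ((w + Q x) \<bullet> Pv (w + Q x)))))" .
  \<comment> \<open>The phase from recentring cancels the half phase of \<open>rho\<close>; the
    ambiguity function is real.\<close>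
  have "cis (pi * (w \<bullet> x)) * cis (- 2 * pi * (y \<bullet> w)) = 1"
    by (simp add: cis_mult xy inner_commute)
  then have drop: "cis (pi * (w \<bullet> x)) * (of_real (exp (- (pi / 2) * (x \<bullet> P x))) * cis (- 2 * pi * (y \<bullet> w)) * K)
     = of_real (exp (- (pi / 2) * (x \<bullet> P x))) * K" for K
    by (simp add: mult_ac)
  have "amb f f z = of_real (exp (- (pi / 2) * (x \<bullet> P x)))
      * of_real ((norm f)\<^sup>2 * exp (- pi * ((1/2) * ((w + Q x) \<bullet> Pv (w + Q x)))))"
    unfolding f_def amb_integral[OF chirped_gaussian_square_integrable[OF P Q] chirped_gaussian_square_integrable[OF P Q]]
      x_def[symmetric] w_def[symmetric] four[unfolded f_def] by (rule drop)
  also have "\<dots> = of_real ((norm f)\<^sup>2) * of_real (exp (- (pi / 2) * (x \<bullet> P x)) * exp (- pi * ((1/2) * ((w + Q x) \<bullet> Pv (w + Q x)))))"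
    by (simp only: of_real_mult mult_ac)
  also have "exp (- (pi / 2) * (x \<bullet> P x)) * exp (- pi * ((1/2) * ((w + Q x) \<bullet> Pv (w + Q x))))
     = exp (- (pi / 2) * (x \<bullet> P x + (w + Q x) \<bullet> Pv (w + Q x)))"
    unfolding exp_add[symmetric] by (simp add: algebra_simps)
  finally show ?thesis .
qed

text \<open>By Moyal's identity, equal normalised ambiguity functions force equality in the
  Cauchy-Schwarz inequality for \<open>h\<close> and \<open>f\<close>.\<close>

lemma amb_determines:
  fixes h f :: "(real ^ 'm::finite) l2"
  assumes h: "\<And>z. amb h h z = of_real ((norm h)\<^sup>2) * E z" and f: "\<And>z. amb f f z = of_real ((norm f)\<^sup>2) * E z"
    and "f \<noteq> 0"
  shows "\<exists>c. h = cscale c f"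
proof -
  let ?n = "complex_of_real ((norm f)\<^sup>2)" and ?m = "complex_of_real ((norm h)\<^sup>2)"
  have n0: "?n \<noteq> 0" using \<open>f \<noteq> 0\<close> by simp
  have "(\<lambda>z. ?n * amb h h z) = (\<lambda>z. ?m * amb f f z)"
    unfolding h f by (simp only: mult_ac)
  then have "cscale ?n (ambl h h) = cscale ?m (ambl f f)"
    unfolding ambl_def cscale_abs[OF amb_square_integrable] by (rule arg_cong)
  then have "cinner (cscale ?n (ambl h h)) (ambl f f) = cinner (cscale ?m (ambl f f)) (ambl f f)"
    by (rule arg_cong)
  then have "?n * (cinner h f * cinner f h) = ?m * (?n * ?n)"
    unfolding cinner_cscale_left Moyal cinner_self[of f] .
  then have "?n * (cinner h f * cinner f h) = ?n * (?m * ?n)"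
    by (simp only: mult_ac)
  then have cs: "cinner h f * cinner f h = ?m * ?n"
    using mult_left_cancel[OF n0] by blast
  \<comment> \<open>The coefficient of the orthogonal projection of \<open>h\<close> onto
    \<open>f\<close>; by \<open>cs\<close> the residual has norm 0.\<close>
  define c where "c = cinner h f / ?n"
  have cc: "cnj c = cinner f h / ?n"
    by (simp add: c_def cinner_commute[of h f])
  have "cinner (h - cscale c f) (h - cscale c f) = ?m - cnj c * cinner h f - c * cinner f h + c * (cnj c * ?n)"
    by (simp only: cinner_diff_left cinner_diff_right cinner_cscale_left cinner_cscale_right cinner_self[of h] cinner_self[of f])
       (simp only: algebra_simps)
  also have "\<dots> = 0"
    using cs n0 unfolding cc by (simp add: c_def field_simps)
  finally have "h - cscale c f = 0"
    using cinner_self_eq_0[of "h - cscale c f"] by simp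
  then show ?thesis by (intro exI[of _ c]) simp
qed

text \<open>The algebra behind the metaplectic image of a Gaussian: the quadratic form of the
  chirped Gaussian with \<open>P = (C R C + R\<^sup>-\<^sup>1)\<^sup>-\<^sup>1\<close> and \<open>Q = P C R\<close>.\<close>

lemma sheared_quadratic_form:
  fixes R Ri C :: "'a::euclidean_space \<Rightarrow> 'a"
  assumes R: "pos_def R" and Ri: "pos_def Ri" "\<And>x. R (Ri x) = x" "\<And>x. Ri (R x) = x"
    and C: "linear C" "\<And>x y. C x \<bullet> y = x \<bullet> C y"
  obtains P Pv Q where "pos_def P" "\<And>x. P (Pv x) = x" "linear Q" "\<And>x y. Q x \<bullet> y = x \<bullet> Q y"
    "\<And>x w. (x + C w) \<bullet> R (x + C w) + w \<bullet> Ri w = x \<bullet> P x + (w + Q x) \<bullet> Pv (w + Q x)"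
proof -
  note lin = linear_add[OF pos_defD(1)[OF R]] linear_add[OF pos_defD(1)[OF Ri(1)]] linear_add[OF C(1)]
  note symR = pos_defD(2)[OF R]
  define N where "N x = C (R (C x)) + Ri x" for x
  have N: "pos_def N"
    unfolding pos_def_def
  proof (intro conjI allI impI)
    show "linear N" unfolding N_def
      using linear_compose[OF linear_compose[OF C(1) pos_defD(1)[OF R]] C(1)] pos_defD(1)[OF Ri(1)]
      by (intro linear_compose_add) (simp_all add: o_def)
    show "N x \<bullet> y = x \<bullet> N y" for x y
      by (simp add: N_def inner_add_left inner_add_right C(2) symR pos_defD(2)[OF Ri(1)])
    fix x :: 'a assume "x \<noteq> 0"
    have "x \<bullet> N x = C x \<bullet> R (C x) + x \<bullet> Ri x"
      by (simp add: N_def inner_add_right C(2))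
    moreover have "C x \<bullet> R (C x) \<ge> 0"
      using pos_defD(3)[OF R, of "C x"] by (cases "C x = 0") auto
    ultimately show "x \<bullet> N x > 0"
      using pos_defD(3)[OF Ri(1) \<open>x \<noteq> 0\<close>] by simp
  qed
  obtain P where P: "pos_def P" "\<And>x. N (P x) = x" "\<And>x. P (N x) = x"
    using pos_def_inverse[OF N] by blast
  define Q where "Q x = P (C (R x))" for x
  have NQ: "N (Q x) = C (R x)" for x by (simp add: Q_def P)
  \<comment> \<open>Leads to a second expression \<open>R C P\<close> for \<open>Q = P C R\<close>;
    comparing the two gives the symmetry of \<open>Q\<close>.\<close>
  have QN: "Q (N x) = R (C x)" for x
  proof -
    have "C (R (N x)) = N (R (C x))" by (simp add: N_def lin Ri)
    then show ?thesis by (simp add: Q_def P)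
  qed
  have Q': "Q x = R (C (P x))" for x using QN[of "P x"] by (simp add: P)
  have linQ: "linear Q" unfolding Q_def
    using linear_compose[OF linear_compose[OF pos_defD(1)[OF R] C(1)] pos_defD(1)[OF P(1)]] by (simp add: o_def)
  have symQ: "Q x \<bullet> y = x \<bullet> Q y" for x y
    by (subst Q') (simp add: Q_def symR C(2) pos_defD(2)[OF P(1)])
  have symN: "N x \<bullet> y = x \<bullet> N y" for x y by (rule pos_defD(2)[OF N])
  have PQ: "P x + Q (C (R x)) = R x" for x
  proof -
    have "N (P x + Q (C (R x))) = N (R x)"
      by (simp add: linear_add[OF pos_defD(1)[OF N]] P NQ) (simp add: N_def Ri)
    then show ?thesis by (metis P(3))
  qed
  have "(x + C w) \<bullet> R (x + C w) + w \<bullet> Ri w = x \<bullet> P x + (w + Q x) \<bullet> N (w + Q x)" for x w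
  proof -
    have a: "Q x \<bullet> N w = w \<bullet> C (R x)"
      by (metis NQ symN inner_commute)
    have b: "w \<bullet> N w = C w \<bullet> R (C w) + w \<bullet> Ri w"
      by (simp add: N_def inner_add_right C(2))
    have c: "x \<bullet> R x = x \<bullet> P x + Q x \<bullet> C (R x)"
      by (subst PQ[of x, symmetric]) (simp add: inner_add_right symQ)
    have d: "C w \<bullet> R x = w \<bullet> C (R x)" by (simp add: C(2))
    have e: "x \<bullet> R (C w) = w \<bullet> C (R x)"
      by (metis d symR inner_commute)
    show ?thesis
      by (simp add: lin linear_add[OF pos_defD(1)[OF N]] NQ inner_add_left inner_add_right a b c d e)
  qed
  then show thesis using that[OF P(1) P(3) linQ symQ] by blast
qed

lemma pos_def_congruence:
  fixes R :: "real ^ 'm \<Rightarrow> real ^ 'm::finite" and A :: "real ^ 'm ^ 'm"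
  assumes R: "pos_def R" and A: "invertible A"
  shows "pos_def (\<lambda>x. transpose A *v R (A *v x))"
  unfolding pos_def_def
proof (intro conjI allI impI)
  show "linear (\<lambda>x. transpose A *v R (A *v x))"
    using linear_compose[OF linear_compose[OF matrix_vector_mul_linear[of A] pos_defD(1)[OF R]] matrix_vector_mul_linear[of "transpose A"]]
    by (simp add: o_def)
  have adj: "(transpose A *v u) \<bullet> v = u \<bullet> (A *v v)" for u v
    by (simp add: transpose_matrix_vector dot_lmul_matrix)
  have adj': "v \<bullet> (transpose A *v u) = (A *v v) \<bullet> u" for u v
    by (metis adj inner_commute)
  show "(transpose A *v R (A *v x)) \<bullet> y = x \<bullet> (transpose A *v R (A *v y))" for x y
    by (simp only: adj adj' pos_defD(2)[OF R])
  fix x :: "real ^ 'm" assume "x \<noteq> 0"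
  then have "A *v x \<noteq> 0"
    using A by (metis invertible_def matrix_vector_mul_assoc matrix_vector_mul_lid matrix_vector_mult_0_right)
  from pos_defD(3)[OF R this] show "x \<bullet> (transpose A *v R (A *v x)) > 0"
    by (simp only: adj')
qed

section \<open>Schwartz decay of chirped Gaussians\<close>

inductive poly_fun :: "('a::euclidean_space \<Rightarrow> complex) \<Rightarrow> bool" where
  const: "poly_fun (\<lambda>_. c)"
| linear: "poly_fun (\<lambda>x. of_real (x \<bullet> v))"
| add: "poly_fun p \<Longrightarrow> poly_fun q \<Longrightarrow> poly_fun (\<lambda>x. p x + q x)"
| mult: "poly_fun p \<Longrightarrow> poly_fun q \<Longrightarrow> poly_fun (\<lambda>x. p x * q x)"

lemma poly_fun_derivative:
  "poly_fun p \<Longrightarrow> \<exists>p'. (\<forall>v. poly_fun (\<lambda>x. p' x v)) \<and> (\<forall>x. (p has_derivative p' x) (at x))"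
proof (induct rule: poly_fun.induct)
  case (const c)
  show ?case by (intro exI[of _ "\<lambda>x v. 0"]) (auto intro: poly_fun.const)
next
  case (linear v)
  show ?case
  proof (intro exI[of _ "\<lambda>x u. of_real (u \<bullet> v)"] conjI allI poly_fun.const)
    show "((\<lambda>x. complex_of_real (x \<bullet> v)) has_derivative (\<lambda>u. of_real (u \<bullet> v))) (at x)" for x
      by (auto intro!: derivative_eq_intros)
  qed
next
  case (add p q)
  then obtain p' q' where "\<forall>v. poly_fun (\<lambda>x. p' x v)" "\<forall>x. (p has_derivative p' x) (at x)"
    "\<forall>v. poly_fun (\<lambda>x. q' x v)" "\<forall>x. (q has_derivative q' x) (at x)" by blast
  then show ?case
    by (intro exI[of _ "\<lambda>x v. p' x v + q' x v"]) (auto intro!: poly_fun.add derivative_intros)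
next
  case (mult p q)
  then obtain p' q' where "\<forall>v. poly_fun (\<lambda>x. p' x v)" "\<forall>x. (p has_derivative p' x) (at x)"
    "\<forall>v. poly_fun (\<lambda>x. q' x v)" "\<forall>x. (q has_derivative q' x) (at x)" by blast
  with mult show ?case
    by (intro exI[of _ "\<lambda>x v. p x * q' x v + p' x v * q x"]) (auto intro!: poly_fun.add poly_fun.mult has_derivative_mult)
qed

text \<open>Exponential bounds combine under sums and products by adding exponents, and a Gaussian
  still dominates them.\<close>

lemma poly_fun_growth:
  "poly_fun p \<Longrightarrow> \<exists>C m. C \<ge> 0 \<and> m \<ge> 0 \<and> (\<forall>x. cmod (p x) \<le> C * exp (m * norm x))"
proof (induct rule: poly_fun.induct)
  case (const c)
  show ?case by (intro exI[of _ "cmod c"] exI[of _ 0]) auto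
next
  case (linear v)
  have "cmod (of_real (x \<bullet> v)) \<le> norm v * exp (1 * norm x)" for x
  proof -
    have "\<bar>x \<bullet> v\<bar> \<le> norm x * norm v" by (rule Cauchy_Schwarz_ineq2)
    also have "\<dots> \<le> exp (norm x) * norm v"
    proof (rule mult_right_mono)
      show "norm x \<le> exp (norm x)" using exp_ge_add_one_self[of "norm x"] by linarith
    qed simp
    finally show ?thesis by (simp add: mult.commute)
  qed
  then show ?case by (intro exI[of _ "norm v"] exI[of _ 1]) auto
next
  case (add p q)
  then obtain C m D k where pq: "C \<ge> 0" "m \<ge> 0" "\<And>x. cmod (p x) \<le> C * exp (m * norm x)"
    "D \<ge> 0" "k \<ge> 0" "\<And>x. cmod (q x) \<le> D * exp (k * norm x)" by blast
  have "cmod (p x + q x) \<le> (C + D) * exp ((m + k) * norm x)" for x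
  proof -
    have "cmod (p x + q x) \<le> C * exp (m * norm x) + D * exp (k * norm x)"
      by (rule norm_triangle_le[OF add_mono[OF pq(3) pq(6)]])
    also have "\<dots> \<le> C * exp ((m + k) * norm x) + D * exp ((m + k) * norm x)"
      using pq by (intro add_mono mult_left_mono) (auto intro!: mult_right_mono)
    finally show ?thesis by (simp add: distrib_right)
  qed
  with pq show ?case by (intro exI[of _ "C + D"] exI[of _ "m + k"]) auto
next
  case (mult p q)
  then obtain C m D k where pq: "C \<ge> 0" "m \<ge> 0" "\<And>x. cmod (p x) \<le> C * exp (m * norm x)"
    "D \<ge> 0" "k \<ge> 0" "\<And>x. cmod (q x) \<le> D * exp (k * norm x)" by blast
  have "cmod (p x * q x) \<le> (C * D) * exp ((m + k) * norm x)" for x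
  proof -
    have "cmod (p x * q x) \<le> (C * exp (m * norm x)) * (D * exp (k * norm x))"
      unfolding norm_mult using pq by (intro mult_mono) auto
    also have "\<dots> = (C * D) * exp ((m + k) * norm x)"
      unfolding distrib_right exp_add by (simp only: mult_ac)
    finally show ?thesis .
  qed
  with pq show ?case by (intro exI[of _ "C * D"] exI[of _ "m + k"]) auto
qed

lemma chirped_gaussian_has_derivative:
  assumes P: "pos_def P" and Q: "linear Q" "\<And>x y. Q x \<bullet> y = x \<bullet> Q y"
  shows "(chirped_gaussian P Q has_derivative
    (\<lambda>v. chirped_gaussian P Q x * (of_real (x \<bullet> (- 2 * pi) *\<^sub>R P v) + \<i> * of_real (x \<bullet> (- 2 * pi) *\<^sub>R Q v)))) (at x)"
proof -
  have bl: "bounded_linear P" "bounded_linear Q"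
    using P Q by (simp_all add: pos_def_def linear_conv_bounded_linear)
  define f where "f x = complex_of_real (- pi * (x \<bullet> P x)) + \<i> * of_real (- pi * (x \<bullet> Q x))" for x
  have eq: "chirped_gaussian P Q = (\<lambda>x. exp (f x))"
    by (simp only: fun_eq_iff chirped_gaussian_def f_def exp_add exp_of_real cis_conv_exp simp_thms)
  have sym: "v \<bullet> P x = x \<bullet> P v" "v \<bullet> Q x = x \<bullet> Q v" for v
    using pos_defD(2)[OF P, of x v] Q(2)[of x v] by (simp_all add: inner_commute)
  have df: "(f has_derivative (\<lambda>v. of_real (x \<bullet> (- 2 * pi) *\<^sub>R P v) + \<i> * of_real (x \<bullet> (- 2 * pi) *\<^sub>R Q v))) (at x)"
    unfolding f_def
    by (rule derivative_eq_intros bounded_linear_imp_has_derivative[OF bl(1)] bounded_linear_imp_has_derivative[OF bl(2)] refl)+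
       (simp add: fun_eq_iff sym algebra_simps)
  have de: "(exp has_derivative (\<lambda>h. exp (f x) * h)) (at (f x))"
    using DERIV_exp[of "f x"] by (simp add: has_field_derivative_def)
  show ?thesis
    unfolding eq by (rule has_derivative_compose[OF df de])
qed

text \<open>The logarithmic derivative of a chirped Gaussian is linear, so each differentiation
  changes only the polynomial factor.\<close>

lemma chirped_gaussian_iterated_derivative:
  assumes P: "pos_def P" and Q: "linear Q" "\<And>x y. Q x \<bullet> y = x \<bullet> Q y" and p: "poly_fun p"
  shows "\<exists>q. poly_fun q \<and> iterated_derivative vs (\<lambda>x. p x * chirped_gaussian P Q x) = (\<lambda>x. q x * chirped_gaussian P Q x)"
proof (induct vs)
  case Nil
  show ?case using p by auto
next
  case (Cons v vs)
  then obtain q where q: "poly_fun q"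
    "iterated_derivative vs (\<lambda>x. p x * chirped_gaussian P Q x) = (\<lambda>x. q x * chirped_gaussian P Q x)" by blast
  obtain q' where q': "\<And>v. poly_fun (\<lambda>x. q' x v)" "\<And>x. (q has_derivative q' x) (at x)"
    using poly_fun_derivative[OF q(1)] by blast
  let ?l = "\<lambda>x v. of_real (x \<bullet> (- 2 * pi) *\<^sub>R P v) + \<i> * of_real (x \<bullet> (- 2 * pi) *\<^sub>R Q v) :: complex"
  have "((\<lambda>x. q x * chirped_gaussian P Q x) has_derivative
      (\<lambda>v. q x * (chirped_gaussian P Q x * ?l x v) + q' x v * chirped_gaussian P Q x)) (at x)" for x
    by (rule has_derivative_mult[OF q'(2) chirped_gaussian_has_derivative[OF P Q]])
  then have "frechet_derivative (\<lambda>x. q x * chirped_gaussian P Q x) (at x)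
      = (\<lambda>v. q x * (chirped_gaussian P Q x * ?l x v) + q' x v * chirped_gaussian P Q x)" for x
    by (rule frechet_derivative_at[symmetric])
  then have "iterated_derivative (v # vs) (\<lambda>x. p x * chirped_gaussian P Q x) = (\<lambda>x. (q x * ?l x v + q' x v) * chirped_gaussian P Q x)"
  proof -
    have alg: "(a * l + b) * c = a * (c * l) + b * c" for a b c l :: complex
      by (simp add: algebra_simps)
    show ?thesis if "\<And>x. frechet_derivative (\<lambda>x. q x * chirped_gaussian P Q x) (at x)
      = (\<lambda>v. q x * (chirped_gaussian P Q x * ?l x v) + q' x v * chirped_gaussian P Q x)"
      unfolding iterated_derivative.simps q(2) alg that ..
  qed
  moreover have "poly_fun (\<lambda>x. q x * ?l x v + q' x v)"
    by (intro poly_fun.intros q q')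
  ultimately show ?case by blast
qed

lemma poly_gaussian_bounded:
  fixes P :: "'a::euclidean_space \<Rightarrow> 'a"
  assumes P: "pos_def P" and q: "poly_fun q"
  shows "bounded (range (\<lambda>x. norm x ^ k *\<^sub>R (q x * chirped_gaussian P Q x)))"
proof -
  obtain a where a: "a > 0" "\<And>x. a * (norm x)\<^sup>2 \<le> x \<bullet> P x"
    using pos_def_lower[OF P] by blast
  obtain C m where C: "C \<ge> 0" "m \<ge> 0" "\<And>x. cmod (q x) \<le> C * exp (m * norm x)"
    using poly_fun_growth[OF q] by blast
  \<comment> \<open>Since \<open>norm x ^ k \<le> exp (real k * norm x)\<close>, the weight adds
    \<open>k\<close> to the exponent \<open>m\<close>. The bound
    \<open>?n\<^sup>2 / (4 * ?b)\<close> is the maximum of \<open>?n * r - ?b * r\<^sup>2\<close>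
    over \<open>r\<close>.\<close>
  let ?n = "real k + m" and ?b = "pi * a"
  have b: "?b > 0" using a by simp
  have "norm (norm x ^ k *\<^sub>R (q x * chirped_gaussian P Q x)) \<le> C * exp (?n\<^sup>2 / (4 * ?b))" for x
  proof -
    let ?r = "norm x"
    have "?r \<le> exp ?r" using exp_ge_add_one_self[of ?r] by linarith
    then have "?r ^ k \<le> exp (real k * ?r)"
      unfolding exp_of_nat_mult by (intro power_mono) auto
    moreover have "exp (- pi * (x \<bullet> P x)) \<le> exp (- ?b * ?r\<^sup>2)"
      using a(2)[of x] by (simp add: mult.assoc)
    ultimately have "norm (?r ^ k *\<^sub>R (q x * chirped_gaussian P Q x)) \<le> exp (real k * ?r) * ((C * exp (m * ?r)) * exp (- ?b * ?r\<^sup>2))"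
      unfolding norm_scaleR norm_mult cmod_chirped_gaussian using C
      by (intro mult_mono) auto
    also have "\<dots> = C * exp (?n * ?r - ?b * ?r\<^sup>2)"
      by (simp add: exp_add[symmetric] algebra_simps)
    also have "?n * ?r - ?b * ?r\<^sup>2 = ?n\<^sup>2 / (4 * ?b) - ?b * (?r - ?n / (2 * ?b))\<^sup>2"
    proof -
      have "n * r - b * r\<^sup>2 = n\<^sup>2 / (4 * b) - b * (r - n / (2 * b))\<^sup>2" if "b > 0" for n r b :: real
        using that by (simp add: power2_eq_square field_simps)
      then show ?thesis using b .
    qed
    also have "C * exp (?n\<^sup>2 / (4 * ?b) - ?b * (?r - ?n / (2 * ?b))\<^sup>2) \<le> C * exp (?n\<^sup>2 / (4 * ?b))"
      using b C(1) by (intro mult_left_mono) auto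
    finally show ?thesis .
  qed
  then show ?thesis by (auto simp: bounded_iff)
qed

lemma schwartz_chirped_gaussian:
  assumes P: "pos_def P" and Q: "linear Q" "\<And>x y. Q x \<bullet> y = x \<bullet> Q y"
  shows "schwartz_function (\<lambda>x. c * chirped_gaussian P Q x)"
  unfolding schwartz_function_def
proof (intro allI conjI)
  fix vs and k :: nat
  obtain q where q: "poly_fun q"
    "iterated_derivative vs (\<lambda>x. c * chirped_gaussian P Q x) = (\<lambda>x. q x * chirped_gaussian P Q x)"
    using chirped_gaussian_iterated_derivative[OF P Q poly_fun.const, of vs c] by blast
  obtain q' where "\<And>x. (q has_derivative q' x) (at x)"
    using poly_fun_derivative[OF q(1)] by blast
  from has_derivative_mult[OF this chirped_gaussian_has_derivative[OF P Q]]
  have "(\<lambda>x. q x * chirped_gaussian P Q x) differentiable at x" for x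
    unfolding differentiable_def by blast
  then show "iterated_derivative vs (\<lambda>x. c * chirped_gaussian P Q x) differentiable_on UNIV"
    unfolding q(2) by (simp add: differentiable_on_def)
  show "bounded (range (\<lambda>x. norm x ^ k *\<^sub>R iterated_derivative vs (\<lambda>x. c * chirped_gaussian P Q x) x))"
    unfolding q(2) by (rule poly_gaussian_bounded[OF P q(1)])
qed

lemma chirped_gaussian_nonzero:
  fixes P :: "'a::euclidean_space \<Rightarrow> 'a"
  assumes "pos_def P" "linear Q"
  shows "abs_l2 (chirped_gaussian P Q) \<noteq> 0"
proof
  assume "abs_l2 (chirped_gaussian P Q) = 0"
  then have "AE x in lborel. chirped_gaussian P Q x = 0"
    using rep_abs_l2[OF chirped_gaussian_square_integrable[OF assms]] rep_zero by (auto elim: eventually_elim2)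
  then have "AE x in (lborel :: 'a measure). False"
    by eventually_elim (simp add: chirped_gaussian_def)
  then show False by (simp add: eventually_False ae_filter_eq_bot_iff)
qed

text \<open>A Gaussian is even, so up to a constant its Wigner function is its own ambiguity
  function at the doubled argument. That is a Gaussian governed by \<open>M\<close> in position and
  by the inverse of \<open>M\<close> in frequency.\<close>

lemma wigl_gaussian:
  fixes M :: "real ^ 'n::finite ^ 'n"
  assumes M: "transpose M = M" "\<forall>t. t \<noteq> 0 \<longrightarrow> 0 < t \<bullet> (M *v t)"
  shows "\<exists>c R. c \<noteq> 0 \<and> pos_def R \<and> wigl (abs_l2 (gaussian M)) (abs_l2 (gaussian M)) = cscale c (abs_l2 (chirped_gaussian R (\<lambda>_. 0)))"
proof -
  have linM: "linear ((*v) M)" by (rule matrix_vector_mul_linear)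
  have PM: "pos_def ((*v) M)"
    unfolding pos_def_def
  proof (intro conjI allI linM)
    show "(M *v x) \<bullet> y = x \<bullet> (M *v y)" for x y
      using dot_lmul_matrix[of x M y] transpose_matrix_vector[of M x] M(1) by simp
  qed (use M(2) in auto)
  obtain Mi where Mi: "pos_def Mi" "\<And>x. M *v (Mi x) = x" "\<And>x. Mi (M *v x) = x"
    using pos_def_inverse[OF PM] by blast
  let ?g = "chirped_gaussian ((*v) M) (\<lambda>_. 0)"
  have lin0: "linear (\<lambda>x::real ^ 'n. 0 :: real ^ 'n)" by (rule module_hom_zero)
  note sq = chirped_gaussian_square_integrable[OF PM lin0]
  define k where "k = complex_of_real (2 powr (real CARD('n) / 4))"
  let ?f = "abs_l2 ?g" and ?phi = "abs_l2 (gaussian M)"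
  have k: "k \<noteq> 0" by (simp add: k_def)
  have "gaussian M = (\<lambda>t. k * ?g t)"
    by (simp add: fun_eq_iff gaussian_def chirped_gaussian_def k_def)
  then have phi: "?phi = cscale k ?f"
    by (simp add: cscale_abs[OF sq])
  have refl: "reflect ?phi = ?phi"
  proof -
    have "(\<lambda>t. ?g (- t)) = ?g"
      by (simp add: fun_eq_iff chirped_gaussian_def linear_neg[OF linM])
    then show ?thesis unfolding phi reflect_linear reflect_abs[OF sq] by (simp only:)
  qed
  \<comment> \<open>The factor 4 comes from the doubled argument, the factor \<open>1/2\<close> from
    the \<open>pi / 2\<close> in the ambiguity function.\<close>
  define R where "R z = 4 *\<^sub>R ((1/2) *\<^sub>R join (M *v position z) (Mi (frequency z)))" for z
  have linMi: "linear Mi" by (rule pos_defD(1)[OF Mi(1)])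
  have R: "pos_def R"
    unfolding pos_def_def
  proof (intro conjI allI impI)
    show "linear R" unfolding R_def
      by (rule linearI) (simp_all add: phase_space_eq_iff linear_add[OF linM] linear_add[OF linMi] linear_cmul[OF linM] linear_cmul[OF linMi] algebra_simps)
    show "R z \<bullet> z' = z \<bullet> R z'" for z z'
      by (simp add: R_def inner_phase_space pos_defD(2)[OF PM] pos_defD(2)[OF Mi(1)])
    fix z :: "real ^ ('n + 'n)" assume "z \<noteq> 0"
    then have "position z \<noteq> 0 \<or> frequency z \<noteq> 0" by (auto simp: phase_space_eq_iff)
    moreover have "position z \<bullet> (M *v position z) \<ge> 0" "frequency z \<bullet> Mi (frequency z) \<ge> 0"
      using pos_defD(3)[OF PM, of "position z"] pos_defD(3)[OF Mi(1), of "frequency z"]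
      by (cases "position z = 0"; cases "frequency z = 0"; simp add: less_imp_le)+
    ultimately show "z \<bullet> R z > 0"
      using pos_defD(3)[OF PM, of "position z"] pos_defD(3)[OF Mi(1), of "frequency z"]
      by (auto simp: R_def inner_phase_space add_pos_nonneg add_nonneg_pos)
  qed
  define c where "c = of_real (2 ^ CARD('n)) * (k * cnj k * of_real ((norm ?f)\<^sup>2))"
  have f0: "?f \<noteq> 0" by (rule chirped_gaussian_nonzero[OF PM lin0])
  have "cross_wigner ?phi ?phi z = c * chirped_gaussian R (\<lambda>_. 0) z" for z
  proof -
    have "cross_wigner ?phi ?phi z = of_real (2 ^ CARD('n)) * (k * cnj k * amb ?f ?f (2 *\<^sub>R z))"
      unfolding cross_wigner_eq refl unfolding phi rho_cscale cinner_cscale_left cinner_cscale_right amb_def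
      by (simp only: mult_ac)
    also have "amb ?f ?f (2 *\<^sub>R z) = of_real ((norm ?f)\<^sup>2) * of_real (exp (- pi * (z \<bullet> R z)))"
      using amb_chirped_gaussian[OF PM Mi(2) lin0, of "2 *\<^sub>R z"]
      by (simp add: R_def inner_phase_space linear_cmul[OF linM] linear_cmul[OF linMi] algebra_simps)
    finally show ?thesis
      by (simp add: c_def chirped_gaussian_def)
  qed
  then have "wigl ?phi ?phi = cscale c (abs_l2 (chirped_gaussian R (\<lambda>_. 0)))"
    unfolding wigl_def cscale_abs[OF chirped_gaussian_square_integrable[OF R module_hom_zero]]
    by (intro arg_cong[where f = abs_l2] ext)
  moreover have "c \<noteq> 0" using k f0 by (simp add: c_def)
  ultimately show ?thesis using R by blast
qed

section \<open>Uniqueness for Laplace transforms\<close>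

text \<open>Real-valued, to fit the Stone-Weierstrass theorem for real function rings. Products are
  not built in; they are covered when \<open>L\<close> is closed under addition.\<close>

inductive_set exponential_span :: "'a::euclidean_space set \<Rightarrow> ('a \<Rightarrow> real) set" for L where
  exp: "l \<in> L \<Longrightarrow> (\<lambda>z. c * exp (z \<bullet> l)) \<in> exponential_span L"
| add: "f \<in> exponential_span L \<Longrightarrow> g \<in> exponential_span L \<Longrightarrow> (\<lambda>z. f z + g z) \<in> exponential_span L"

lemma exponential_span_mult:
  assumes L: "\<And>l l'. l \<in> L \<Longrightarrow> l' \<in> L \<Longrightarrow> l + l' \<in> L"
    and "f \<in> exponential_span L" "g \<in> exponential_span L"
  shows "(\<lambda>z. f z * g z) \<in> exponential_span L"
  using assms(2)
proof induct
  case (exp l c)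
  from assms(3) show ?case
  proof induct
    case (exp l' d)
    have "(\<lambda>z. c * exp (z \<bullet> l) * (d * exp (z \<bullet> l'))) = (\<lambda>z. c * d * exp (z \<bullet> (l + l')))"
      by (simp add: fun_eq_iff inner_add_right exp_add mult_ac)
    then show ?case using exponential_span.exp[OF L[OF \<open>l \<in> L\<close> \<open>l' \<in> L\<close>], of "c * d"] by simp
  next
    case (add f g)
    then show ?case using exponential_span.add by (simp add: distrib_left)
  qed
next
  case (add f h)
  then show ?case using exponential_span.add by (simp add: distrib_right)
qed

lemma exponential_span_continuous: "f \<in> exponential_span L \<Longrightarrow> continuous_on S f"
  by (induct rule: exponential_span.induct) (auto intro!: continuous_intros)

text \<open>The exponentials with exponents in \<open>L\<close> span a point-separating algebra, so by
  Stone-Weierstrass all continuous moments of \<open>\<Phi>\<close>, and in particular its Fourier transform,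
  vanish.\<close>

lemma compact_support_Laplace_unique:
  fixes \<Phi> :: "'a::euclidean_space \<Rightarrow> complex"
  assumes K: "compact K" and supp: "\<And>z. z \<notin> K \<Longrightarrow> \<Phi> z = 0"
    and int: "integrable lborel \<Phi>" and sq: "square_integrable \<Phi>"
    and L: "0 \<in> L" "\<And>l l'. l \<in> L \<Longrightarrow> l' \<in> L \<Longrightarrow> l + l' \<in> L"
    and sep: "\<And>x y. x \<noteq> y \<Longrightarrow> \<exists>l\<in>L. x \<bullet> l \<noteq> y \<bullet> l"
    and zero: "\<And>l. l \<in> L \<Longrightarrow> (LINT z|lborel. \<Phi> z * of_real (exp (z \<bullet> l))) = 0"
  shows "AE z in lborel. \<Phi> z = 0"
proof -
  have [measurable]: "\<Phi> \<in> borel_measurable borel"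
    using int by (auto dest: borel_measurable_integrable)
  \<comment> \<open>\<open>f\<close> may be unbounded, but \<open>\<Phi>\<close> vanishes outside
    \<open>K\<close>, so its bound on \<open>K\<close> suffices.\<close>
  have integ: "integrable lborel (\<lambda>z. \<Phi> z * of_real (f z))" if f: "continuous_on UNIV f" for f :: "'a \<Rightarrow> real"
  proof -
    have [measurable]: "f \<in> borel_measurable borel" using f by (rule borel_measurable_continuous_onI)
    have "bounded (f ` K)"
      using K f by (intro compact_imp_bounded compact_continuous_image) (auto intro: continuous_on_subset)
    then obtain b where b: "\<And>z. z \<in> K \<Longrightarrow> \<bar>f z\<bar> \<le> b" by (auto simp: bounded_iff)
    show ?thesis
    proof (rule Bochner_Integration.integrable_bound)
      show "integrable lborel (\<lambda>z. \<Phi> z * of_real b)" using int by simp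
      show "AE z in lborel. norm (\<Phi> z * of_real (f z)) \<le> norm (\<Phi> z * of_real b)"
      proof (rule AE_I2)
        fix z show "norm (\<Phi> z * of_real (f z)) \<le> norm (\<Phi> z * of_real b)"
          using b[of z] supp[of z] by (cases "z \<in> K") (auto simp: norm_mult intro!: mult_left_mono)
      qed
    qed measurable
  qed
  have span0: "(LINT z|lborel. \<Phi> z * of_real (f z)) = 0" if "f \<in> exponential_span L" for f
    using that
  proof induct
    case (exp l c)
    have "(LINT z|lborel. \<Phi> z * of_real (c * exp (z \<bullet> l))) = (LINT z|lborel. of_real c * (\<Phi> z * of_real (exp (z \<bullet> l))))"
      by (simp add: mult_ac)
    then show ?case using zero[OF exp] by simp
  next
    case (add f g)
    then show ?case
      using integ[OF exponential_span_continuous[OF add(1)]] integ[OF exponential_span_continuous[OF add(3)]]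
      by (simp add: distrib_left)
  qed
  interpret function_ring_on "exponential_span L" K
  proof
    show "(\<lambda>_. c) \<in> exponential_span L" for c
      using exponential_span.exp[OF L(1), of c] by simp
    fix x y :: 'a assume "x \<noteq> y"
    then obtain l where "l \<in> L" "x \<bullet> l \<noteq> y \<bullet> l" using sep by blast
    then show "\<exists>f\<in>exponential_span L. f x \<noteq> f y"
      by (intro bexI[OF _ exponential_span.exp[of l L 1]]) auto
  qed (use K in \<open>auto intro: exponential_span_continuous exponential_span.add exponential_span_mult[OF L(2)]\<close>)
  have cont0: "(LINT z|lborel. \<Phi> z * of_real (h z)) = 0" if h: "continuous_on UNIV h" for h :: "'a \<Rightarrow> real"
  proof (rule ccontr)
    let ?I = "LINT z|lborel. \<Phi> z * of_real (h z)"
    assume "?I \<noteq> 0"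
    define b where "b = (LINT z|lborel. cmod (\<Phi> z))"
    have "b \<ge> 0" by (simp add: b_def)
    \<comment> \<open>An error below \<open>e\<close> on \<open>K\<close> changes the integral by at
      most half of its modulus; \<open>b + 1\<close> keeps the denominator positive.\<close>
    define e where "e = cmod ?I / (b + 1) / 2"
    have "e > 0" using \<open>?I \<noteq> 0\<close> \<open>b \<ge> 0\<close> by (simp add: e_def)
    then obtain g where g: "g \<in> exponential_span L" "\<And>z. z \<in> K \<Longrightarrow> \<bar>h z - g z\<bar> < e"
      using Stone_Weierstrass_basic[OF continuous_on_subset[OF h]] by blast
    have cg: "continuous_on UNIV g" by (rule exponential_span_continuous[OF g(1)])
    have "?I = (LINT z|lborel. \<Phi> z * of_real (h z)) - (LINT z|lborel. \<Phi> z * of_real (g z))"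
      using span0[OF g(1)] by simp
    also have "\<dots> = (LINT z|lborel. \<Phi> z * of_real (h z) - \<Phi> z * of_real (g z))"
      by (rule Bochner_Integration.integral_diff[symmetric]) (intro integ h cg)+
    also have "\<dots> = (LINT z|lborel. \<Phi> z * of_real (h z - g z))"
      by (simp add: right_diff_distrib)
    finally have "cmod ?I \<le> (LINT z|lborel. cmod (\<Phi> z * of_real (h z - g z)))"
      using integral_norm_bound by metis
    also have "\<dots> \<le> (LINT z|lborel. cmod (\<Phi> z) * e)"
    proof (rule integral_mono)
      show "integrable lborel (\<lambda>z. cmod (\<Phi> z * of_real (h z - g z)))"
        by (intro integrable_norm integ continuous_on_diff h cg)
      show "integrable lborel (\<lambda>z. cmod (\<Phi> z) * e)" using int by simp
      show "cmod (\<Phi> z * of_real (h z - g z)) \<le> cmod (\<Phi> z) * e" for z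
        using g(2)[of z] supp[of z] \<open>e > 0\<close>
        by (cases "z \<in> K") (auto simp: norm_mult simp del: of_real_diff intro!: mult_left_mono)
    qed
    also have "\<dots> = b * e" by (simp add: b_def)
    also have "\<dots> \<le> (b + 1) * e" using \<open>e > 0\<close> by simp
    also have "\<dots> = cmod ?I / 2"
    proof -
      have "c * (X / c / 2) = X / 2" if "c > 0" for c X :: real using that by simp
      from this[of "b + 1"] show ?thesis unfolding e_def using \<open>b \<ge> 0\<close> by simp
    qed
    finally show False using \<open>?I \<noteq> 0\<close> by simp
  qed
  have "fourier \<Phi> w = 0" for w
  proof -
    \<comment> \<open>\<open>cont0\<close> concerns real functions, so the character is split into
      cosine and sine.\<close>
    have c: "continuous_on UNIV (\<lambda>t. cos (- 2 * pi * (t \<bullet> w)))" "continuous_on UNIV (\<lambda>t. sin (- 2 * pi * (t \<bullet> w)))"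
      by (intro continuous_intros)+
    have "fourier \<Phi> w = (LINT t|lborel. \<Phi> t * of_real (cos (- 2 * pi * (t \<bullet> w))) + \<i> * (\<Phi> t * of_real (sin (- 2 * pi * (t \<bullet> w)))))"
      unfolding fourier_def by (intro Bochner_Integration.integral_cong refl)
        (simp only: cis_conv_exp exp_Euler cos_of_real sin_of_real, simp add: algebra_simps)
    also have "\<dots> = 0"
      by (subst Bochner_Integration.integral_add)
         (simp_all only: integrable_mult_right integ c integral_mult_right_zero cont0 mult_zero_right add_0_left)
    finally show ?thesis .
  qed
  then have "l2_mass (\<Phi>) = 0"
    using Plancherel[OF int sq] by simp
  then show ?thesis
    by (subst (asm) nn_integral_0_iff_AE) auto
qed

text \<open>The complement of the support is a union of possibly uncountably many open sets on which
  \<open>F\<close> vanishes almost everywhere. Lindelof's theorem reduces it to countably many,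
  whose exceptional null sets can be united.\<close>

lemma AE_l2_support:
  assumes "l2_support F \<subseteq> K" "closed K"
  shows "AE x in lborel. x \<notin> K \<longrightarrow> rep_l2 F x = 0"
proof -
  define \<V> where "\<V> = {V. open V \<and> (AE y in lborel. y \<in> V \<longrightarrow> rep_l2 F y = 0)}"
  obtain \<W> where W: "\<W> \<subseteq> \<V>" "countable \<W>" "\<Union>\<W> = \<Union>\<V>"
    using Lindelof[of \<V>] by (auto simp: \<V>_def)
  have "AE x in lborel. \<forall>V\<in>\<W>. x \<in> V \<longrightarrow> rep_l2 F x = 0"
    using W(1) by (intro AE_ball_countable[THEN iffD2] W(2)) (auto simp: \<V>_def)
  moreover have "x \<in> \<Union>\<W>" if "x \<notin> K" for x
  proof -
    have "x \<notin> l2_support F" using that assms(1) by blast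
    then show ?thesis unfolding W(3) by (auto simp: l2_support_def \<V>_def)
  qed
  ultimately show ?thesis by (auto elim!: eventually_mono)
qed

section \<open>Metaplectic images and lattice samples\<close>

lemma block_matrix_mult:
  "block_matrix A B C D *v z = join (A *v position z + B *v frequency z) (C *v position z + D *v frequency z)"
  by (auto simp: vec_eq_iff block_matrix_def join_def position_def frequency_def matrix_vector_mult_def
      UNIV_Plus_UNIV[symmetric] sum.Plus simp del: UNIV_Plus_UNIV split: sum.split)

lemma symplectic_form_invariant:
  fixes A :: "real ^ ('m::finite + 'm) ^ ('m + 'm)"
  assumes "symplectic A"
  shows "symplectic_form (A *v u) (A *v v) = symplectic_form u v"
proof -
  define J :: "real ^ ('m + 'm) ^ ('m + 'm)" where "J = block_matrix 0 (mat 1) (- mat 1) 0"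
  have m: "(- mat 1) *v x = - x" for x :: "real ^ 'm"
    using matrix_vector_mult_diff_rdistrib[of 0 "mat 1" x] by simp
  \<comment> \<open>\<open>J\<close> represents the form with the opposite sign, which is harmless
    for invariance.\<close>
  have J: "a \<bullet> (J *v b) = - symplectic_form a b" for a b
    by (simp add: J_def block_matrix_mult m inner_phase_space symplectic_form_def inner_commute)
  have "transpose A ** J ** A = J"
    using assms by (simp add: symplectic_def J_def Let_def)
  then have "u \<bullet> (J *v v) = u \<bullet> (transpose A *v (J *v (A *v v)))"
    by (metis matrix_vector_mul_assoc)
  also have "\<dots> = (A *v u) \<bullet> (J *v (A *v v))"
    by (metis dot_lmul_matrix inner_commute transpose_matrix_vector)
  finally show ?thesis by (simp add: J)
qed

text \<open>The ambiguity function of \<open>h = cadjoint U g\<close> is that of \<open>g\<close>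
  composed with \<open>A\<close>, hence a Gaussian in the pulled-back form.
  \<open>sheared_quadratic_form\<close> recognises this as the form of a chirped Gaussian, and
  \<open>amb_determines\<close> identifies \<open>h\<close> up to a scalar.\<close>

lemma metaplectic_gaussian:
  fixes A :: "real ^ ('m::finite + 'm) ^ ('m + 'm)" and A1 A2 :: "real ^ 'm ^ 'm"
    and U :: "(real ^ 'm) l2 \<Rightarrow> (real ^ 'm) l2"
  assumes symp: "symplectic A" and A: "A = block_matrix A1 A2 0 (transpose (matrix_inv A1))"
    and U: "metaplectic A U" and R: "pos_def R"
  shows "invertible A1"
    and "\<exists>k P Q. pos_def P \<and> linear Q \<and> (\<forall>x y. Q x \<bullet> y = x \<bullet> Q y) \<and>
      cadjoint U (abs_l2 (chirped_gaussian R (\<lambda>_. 0))) = cscale k (abs_l2 (chirped_gaussian P Q))"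
proof -
  define D where "D = transpose (matrix_inv A1)"
  define B1 where "B1 = matrix_inv A1"
  have pA: "position (A *v z) = A1 *v position z + A2 *v frequency z"
    and fA: "frequency (A *v z) = D *v frequency z" for z
    by (simp_all add: A block_matrix_mult D_def)
  have h1: "(A1 *v x) \<bullet> (D *v w) = x \<bullet> w" for x w
    using symplectic_form_invariant[OF symp, of "join x 0" "join 0 w"]
    by (simp add: symplectic_form_def pA fA inner_commute)
  have h2: "(A2 *v w) \<bullet> (D *v w') = (D *v w) \<bullet> (A2 *v w')" for w w'
    using symplectic_form_invariant[OF symp, of "join 0 w" "join 0 w'"]
    by (simp add: symplectic_form_def pA fA inner_commute)
  \<comment> \<open>\<open>matrix_inv\<close> is a total function, so the block form alone does not
    say that \<open>A1\<close> is invertible. The symplectic pairing of \<open>A1 *v x\<close> with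
    \<open>D *v x\<close> shows it.\<close>
  have "x = 0" if "A1 *v x = 0" for x
    using h1[of x x] that by simp
  then show inv: "invertible A1"
    unfolding invertible_left_inverse matrix_left_invertible_ker by blast
  have A1B1: "A1 *v (B1 *v y) = y" and B1A1: "B1 *v (A1 *v y) = y" for y
    using someI_ex[OF inv[unfolded invertible_def]]
    by (simp_all add: B1_def matrix_inv_def matrix_vector_mul_assoc)
  have h1': "y \<bullet> (D *v w) = (B1 *v y) \<bullet> w" for y w
    using h1[of "B1 *v y" w] by (simp add: A1B1)
  have adj: "(transpose A1 *v u) \<bullet> v = u \<bullet> (A1 *v v)" for u v
    by (simp add: transpose_matrix_vector dot_lmul_matrix)
  \<comment> \<open>Writes the position of \<open>A *v z\<close> as \<open>A1 *v (x + C w)\<close>,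
    a shear followed by \<open>A1\<close>. The symplectic relation between \<open>A2\<close> and
    \<open>D\<close> makes \<open>C\<close> symmetric.\<close>
  define C where "C w = B1 *v (A2 *v w)" for w
  have linC: "linear C" unfolding C_def
    using linear_compose[OF matrix_vector_mul_linear[of A2] matrix_vector_mul_linear[of B1]] by (simp add: o_def)
  have symC: "C w \<bullet> w' = w \<bullet> C w'" for w w'
    unfolding C_def by (metis h1' h2 inner_commute)
  obtain Ri where Ri: "pos_def Ri" "\<And>x. R (Ri x) = x" "\<And>x. Ri (R x) = x"
    using pos_def_inverse[OF R] by blast
  \<comment> \<open>\<open>R\<close> and its inverse in the coordinates pulled back along
    \<open>A1\<close> and \<open>D\<close>; they remain mutually inverse because \<open>D\<close> is
    the inverse transpose of \<open>A1\<close>.\<close>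
  define R' where "R' x = transpose A1 *v R (A1 *v x)" for x
  define Ri' where "Ri' w = B1 *v Ri (D *v w)" for w
  have posR': "pos_def R'" unfolding R'_def by (rule pos_def_congruence[OF R inv])
  have formRi': "w \<bullet> Ri' w' = (D *v w) \<bullet> Ri (D *v w')" for w w'
    unfolding Ri'_def by (metis h1' inner_commute)
  have DA: "D *v (transpose A1 *v y) = y" for y
  proof -
    have "v \<bullet> (D *v (transpose A1 *v y)) = v \<bullet> y" for v
      by (metis h1' adj A1B1 inner_commute)
    then show ?thesis using vector_eq_ldot by blast
  qed
  have AD: "transpose A1 *v (D *v w) = w" for w
  proof -
    have "v \<bullet> (transpose A1 *v (D *v w)) = v \<bullet> w" for v
      by (metis h1 adj inner_commute)
    then show ?thesis using vector_eq_ldot by blast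
  qed
  have posRi': "pos_def Ri'"
    unfolding pos_def_def
  proof (intro conjI allI impI)
    show "linear Ri'" unfolding Ri'_def
      using linear_compose[OF linear_compose[OF matrix_vector_mul_linear[of D] pos_defD(1)[OF Ri(1)]] matrix_vector_mul_linear[of B1]]
      by (simp add: o_def)
    show "Ri' x \<bullet> y = x \<bullet> Ri' y" for x y
      using formRi'[of y x] formRi'[of x y] pos_defD(2)[OF Ri(1), of "D *v x" "D *v y"]
      by (simp add: inner_commute)
    fix x :: "real ^ 'm" assume "x \<noteq> 0"
    then have "D *v x \<noteq> 0" using AD[of x] by auto
    from pos_defD(3)[OF Ri(1) this] show "x \<bullet> Ri' x > 0" by (simp add: formRi')
  qed
  have RRi': "R' (Ri' w) = w" "Ri' (R' w) = w" for w
    unfolding R'_def Ri'_def A1B1 Ri AD DA B1A1 by (rule refl)+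
  obtain P Pv Q where P: "pos_def P" "\<And>x. P (Pv x) = x" and Q: "linear Q" "\<And>x y. Q x \<bullet> y = x \<bullet> Q y"
    and form: "\<And>x w. (x + C w) \<bullet> R' (x + C w) + w \<bullet> Ri' w = x \<bullet> P x + (w + Q x) \<bullet> Pv (w + Q x)"
    using sheared_quadratic_form[OF posR' posRi' RRi' linC symC] by blast
  define g where "g = abs_l2 (chirped_gaussian R (\<lambda>_. 0))"
  define f where "f = abs_l2 (chirped_gaussian P Q)"
  define h where "h = cadjoint U g"
  define E where "E z = complex_of_real (exp (- (pi / 2) * (position z \<bullet> P (position z)
      + (frequency z + Q (position z)) \<bullet> Pv (frequency z + Q (position z)))))" for z
  have uU: "unitary U" and "\<And>\<xi>. U \<circ> rho \<xi> \<circ> cadjoint U = rho (A *v \<xi>)"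
    using U by (auto simp: metaplectic_def)
  then have UU: "U (rho \<xi> (cadjoint U g)) = rho (A *v \<xi>) g" for \<xi>
    by (metis comp_apply)
  have Uh: "U h = g" by (simp add: h_def uU)
  have nh: "norm h = norm g" using unitary_norm[OF uU, of h] by (simp add: Uh)
  have "amb h h z = of_real ((norm h)\<^sup>2) * E z" for z
  proof -
    let ?x = "position z" and ?w = "frequency z"
    have "amb h h z = amb g g (A *v z)"
      using unitary_cinner[OF uU, of h "rho z h"] UU[of z] by (simp add: amb_def Uh h_def[symmetric])
    also have "\<dots> = of_real ((norm g)\<^sup>2) * of_real (exp (- (pi / 2) *
        (position (A *v z) \<bullet> R (position (A *v z)) + frequency (A *v z) \<bullet> Ri (frequency (A *v z)))))"
      using amb_chirped_gaussian[OF R Ri(2) module_hom_zero, of "A *v z"] by (simp add: g_def)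
    also have "position (A *v z) = A1 *v (?x + C ?w)"
      by (simp add: pA C_def matrix_vector_right_distrib A1B1)
    also have "(A1 *v (?x + C ?w)) \<bullet> R (A1 *v (?x + C ?w)) = (?x + C ?w) \<bullet> R' (?x + C ?w)"
      unfolding R'_def by (metis adj inner_commute)
    also have "frequency (A *v z) \<bullet> Ri (frequency (A *v z)) = ?w \<bullet> Ri' ?w"
      by (simp add: fA formRi')
    finally show ?thesis unfolding form E_def nh .
  qed
  moreover have "amb f f z = of_real ((norm f)\<^sup>2) * E z" for z
    unfolding f_def E_def by (rule amb_chirped_gaussian[OF P Q])
  moreover have "f \<noteq> 0" unfolding f_def by (rule chirped_gaussian_nonzero[OF P(1) Q(1)])
  ultimately obtain k where "h = cscale k f" using amb_determines by blast
  then show "\<exists>k P Q. pos_def P \<and> linear Q \<and> (\<forall>x y. Q x \<bullet> y = x \<bullet> Q y) \<and>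
      cadjoint U (abs_l2 (chirped_gaussian R (\<lambda>_. 0))) = cscale k (abs_l2 (chirped_gaussian P Q))"
    using P(1) Q unfolding h_def f_def g_def by blast
qed

text \<open>If \<open>x - y\<close> is orthogonal to the images of all lattice points, unit vectors
  for \<open>n\<close> and linearity make it orthogonal to every \<open>T (B *v t)\<close>, hence to
  itself. Full rank of the lattice enters through invertibility of \<open>B\<close>.\<close>

lemma lattice_separates:
  fixes B :: "real ^ 'k ^ 'k::finite" and T :: "real ^ 'k \<Rightarrow> real ^ 'k"
  assumes T: "linear T" "surj T" and B: "invertible B" and "x \<noteq> y"
  shows "\<exists>n :: int ^ 'k. x \<bullet> T (B *v (\<chi> i. of_int (n $ i))) \<noteq> y \<bullet> T (B *v (\<chi> i. of_int (n $ i)))"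
proof (rule ccontr)
  assume "\<not> ?thesis"
  then have eq: "(x - y) \<bullet> T (B *v (\<chi> i. of_int (n $ i))) = 0" for n :: "int ^ 'k"
    by (simp add: inner_diff_left)
  define m where "m t = (x - y) \<bullet> T (B *v t)" for t
  have lin: "linear m" unfolding m_def
    using linear_compose[OF matrix_vector_mul_linear[of B] T(1)]
    by (intro linearI) (simp_all add: o_def linear_add[OF T(1)] linear_cmul[OF T(1)] matrix_vector_right_distrib
        matrix_vector_mult_scaleR inner_add_right)
  have "(\<chi> j. real_of_int ((axis i 1 :: int ^ 'k) $ j)) = axis i 1" for i
    by (simp add: vec_eq_iff axis_def)
  then have ax: "m (axis i 1) = 0" for i
    using eq[of "axis i 1"] by (simp add: m_def)
  have "m t = 0" for t
  proof -
    have "t = (\<Sum>i\<in>UNIV. t $ i *\<^sub>R axis i 1)"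
      using basis_expansion[of t] by (simp add: scalar_mult_eq_scaleR)
    then have "m t = (\<Sum>i\<in>UNIV. t $ i *\<^sub>R m (axis i 1))"
      by (metis (no_types, lifting) linear_sum[OF lin] linear_cmul[OF lin] sum.cong)
    then show ?thesis by (simp add: ax)
  qed
  moreover obtain s where "T s = x - y" using T(2) by (metis surjD)
  moreover obtain t where "B *v t = s"
    using B by (metis invertible_def matrix_vector_mul_assoc matrix_vector_mul_lid)
  ultimately have "(x - y) \<bullet> (x - y) = 0" by (metis m_def)
  then show False using \<open>x \<noteq> y\<close> by simp
qed

text \<open>Sampling against shifts of a Gaussian is, up to nonzero factors, evaluating the Laplace
  transform of \<open>F\<close> times the Gaussian.\<close>

lemma gaussian_samples_determine:
  fixes F :: "(real ^ 'm::finite) l2" and \<Lambda> K :: "(real ^ 'm) set"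
  assumes R: "pos_def R" and A1: "invertible A1" and lat: "full_rank_lattice \<Lambda>"
    and K: "compact K" and supp: "AE x in lborel. x \<notin> K \<longrightarrow> rep_l2 F x = 0"
    and zero: "\<And>b. b \<in> \<Lambda> \<Longrightarrow> cinner F (rho (join (A1 *v b) 0) (abs_l2 (chirped_gaussian R (\<lambda>_. 0)))) = 0"
  shows "F = 0"
proof -
  let ?E = "chirped_gaussian R (\<lambda>_. 0)"
  have linR: "linear R" by (rule pos_defD(1)[OF R])
  note sqE = chirped_gaussian_square_integrable[OF R module_hom_zero]
  obtain B :: "real ^ 'm ^ 'm" where B: "invertible B" "\<Lambda> = range (\<lambda>n :: int ^ 'm. B *v (\<chi> i. of_int (n $ i)))"
    using lat by (auto simp: full_rank_lattice_def)
  \<comment> \<open>The exponent produced by the sample at \<open>b\<close>: with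
    \<open>v = A1 *v b\<close>, the mixed term of
    \<open>- pi * ((z - v) \<bullet> R (z - v))\<close> is \<open>z \<bullet> T b\<close>.\<close>
  define T where "T b = (2 * pi) *\<^sub>R R (A1 *v b)" for b
  have linT: "linear T" unfolding T_def
    using linear_compose[OF matrix_vector_mul_linear[of A1] linR] by (intro linear_compose_scale_right) (simp add: o_def)
  have surjT: "surj T"
  proof -
    obtain Ri where Ri: "\<And>x. R (Ri x) = x" using pos_def_inverse[OF R] by blast
    have "\<exists>b. A1 *v b = v" for v
      using A1 by (metis invertible_def matrix_vector_mul_assoc matrix_vector_mul_lid)
    then obtain G where G: "\<And>v. A1 *v G v = v" by metis
    have "T (G (Ri ((1 / (2 * pi)) *\<^sub>R y))) = y" for y
      by (simp add: T_def G Ri)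
    then show ?thesis by (rule surjI)
  qed
  define L where "L = T ` \<Lambda>"
  have L0: "0 \<in> L"
  proof -
    have "(0 :: real ^ 'm) = B *v (\<chi> i. of_int ((0 :: int ^ 'm) $ i))"
      by (simp add: zero_vec_def[symmetric])
    then have "0 \<in> \<Lambda>" unfolding B(2) by blast
    then show ?thesis unfolding L_def using linear_0[OF linT] by (metis imageI)
  qed
  have Ladd: "l + l' \<in> L" if ll: "l \<in> L" "l' \<in> L" for l l'
  proof -
    obtain n n' :: "int ^ 'm" where n: "l = T (B *v (\<chi> i. of_int (n $ i)))" "l' = T (B *v (\<chi> i. of_int (n' $ i)))"
      using ll unfolding L_def B(2) by blast
    have "(\<chi> i. of_int ((n + n') $ i)) = (\<chi> i. of_int (n $ i)) + (\<chi> i. real_of_int (n' $ i))"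
      by (simp add: vec_eq_iff)
    then have "l + l' = T (B *v (\<chi> i. of_int ((n + n') $ i)))"
      by (simp add: n matrix_vector_right_distrib linear_add[OF linT])
    then show ?thesis unfolding L_def B(2) by blast
  qed
  have Lsep: "\<exists>l\<in>L. x \<bullet> l \<noteq> y \<bullet> l" if "x \<noteq> y" for x y
    using lattice_separates[OF linT surjT B(1) that] unfolding L_def B(2) by blast
  have [measurable]: "K \<in> sets borel" "?E \<in> borel_measurable borel"
    using K sqE by (auto simp: square_integrable_def compact_imp_closed)
  \<comment> \<open>The indicator turns vanishing almost everywhere outside \<open>K\<close> into
    vanishing everywhere, as \<open>compact_support_Laplace_unique\<close> asks.\<close>
  define \<Phi> where "\<Phi> z = indicator K z * (rep_l2 F z * ?E z)" for z
  have [measurable]: "\<Phi> \<in> borel_measurable borel" unfolding \<Phi>_def[abs_def] by measurable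
  have E1: "cmod (?E z) \<le> 1" for z
  proof -
    have "z \<bullet> R z \<ge> 0" using pos_defD(3)[OF R, of z] by (cases "z = 0") auto
    then show ?thesis by (simp add: cmod_chirped_gaussian)
  qed
  have cnjE: "cnj (?E z) = ?E z" for z by (simp add: chirped_gaussian_def)
  have int0: "integrable lborel (\<lambda>z. rep_l2 F z * ?E z)"
    using square_integrable_mult_cnj[OF square_integrable_rep[of F] sqE] by (simp add: cnjE)
  have intP: "integrable lborel \<Phi>"
    by (rule Bochner_Integration.integrable_bound[OF int0]) (simp, auto simp: \<Phi>_def norm_mult indicator_def)
  have sqP: "square_integrable \<Phi>"
    unfolding square_integrable_def
  proof
    show "integrable lborel (\<lambda>z. (cmod (\<Phi> z))\<^sup>2)"
    proof (rule Bochner_Integration.integrable_bound)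
      show "integrable lborel (\<lambda>z. (cmod (rep_l2 F z))\<^sup>2)"
        using square_integrable_rep[of F] by (simp add: square_integrable_def)
      have "cmod (\<Phi> z) \<le> cmod (rep_l2 F z)" for z
        using mult_left_mono[OF E1[of z] norm_ge_zero[of "rep_l2 F z"]] by (auto simp: \<Phi>_def norm_mult indicator_def)
      then show "AE z in lborel. norm ((cmod (\<Phi> z))\<^sup>2) \<le> norm ((cmod (rep_l2 F z))\<^sup>2)"
        by (auto intro!: power_mono)
    qed simp
  qed simp
  have "AE z in lborel. \<Phi> z = 0"
  proof (rule compact_support_Laplace_unique[OF K _ intP sqP L0 Ladd Lsep])
    fix l assume "l \<in> L"
    then obtain b where b: "b \<in> \<Lambda>" "l = T b" by (auto simp: L_def)
    define v where "v = A1 *v b"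
    have shift: "?E (z - v) = of_real (exp (- pi * (v \<bullet> R v))) * (?E z * of_real (exp (z \<bullet> l)))" for z
    proof -
      have "- pi * ((z - v) \<bullet> R (z - v)) = - pi * (v \<bullet> R v) + (- pi * (z \<bullet> R z) + z \<bullet> l)"
        using pos_defD(2)[OF R, of v z]
        by (simp add: b(2) T_def v_def[symmetric] linear_diff[OF linR] inner_diff_left inner_diff_right inner_commute algebra_simps)
      then have "exp (- pi * ((z - v) \<bullet> R (z - v))) = exp (- pi * (v \<bullet> R v)) * (exp (- pi * (z \<bullet> R z)) * exp (z \<bullet> l))"
        by (simp only: exp_add)
      moreover have "?E y = of_real (exp (- pi * (y \<bullet> R y)))" for y
        by (simp add: chirped_gaussian_def)
      ultimately show ?thesis by (simp only: of_real_mult)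
    qed
    have "cinner (abs_l2 (rep_l2 F)) (rho (join v 0) (abs_l2 ?E)) = 0"
      using zero[OF b(1)] by (simp add: abs_rep_l2 v_def)
    then have "0 = (LINT z|lborel. rep_l2 F z * ?E (z - v))"
      unfolding rho_abs[OF sqE] cinner_abs[OF square_integrable_rep square_integrable_rho[OF sqE]] by (simp add: cnjE)
    also have "\<dots> = (LINT z|lborel. of_real (exp (- pi * (v \<bullet> R v))) * (\<Phi> z * of_real (exp (z \<bullet> l))))"
    proof (rule integral_cong_AE)
      show "AE z in lborel. rep_l2 F z * ?E (z - v) = of_real (exp (- pi * (v \<bullet> R v))) * (\<Phi> z * of_real (exp (z \<bullet> l)))"
        using supp unfolding shift
        by eventually_elim (auto simp: \<Phi>_def indicator_def)
    qed simp_all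
    also have "\<dots> = of_real (exp (- pi * (v \<bullet> R v))) * (LINT z|lborel. \<Phi> z * of_real (exp (z \<bullet> l)))"
      by (rule integral_mult_right_zero)
    finally show "(LINT z|lborel. \<Phi> z * of_real (exp (z \<bullet> l))) = 0" by simp
  qed (auto simp: \<Phi>_def)
  \<comment> \<open>The Gaussian has no zeros and can be divided out.\<close>
  then have "AE z in lborel. rep_l2 F z = rep_l2 0 z"
    using supp rep_zero
    by eventually_elim (auto simp: \<Phi>_def indicator_def chirped_gaussian_def split: if_splits)
  then show ?thesis by (rule l2_eqI)
qed

theorem theorem1p3:
  fixes A :: "real ^ (('n::finite + 'n) + ('n + 'n)) ^ (('n + 'n) + ('n + 'n))"
    and A1 A2 :: "real ^ ('n + 'n) ^ ('n + 'n)"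
    and U :: "(real ^ ('n + 'n)) l2 \<Rightarrow> (real ^ ('n + 'n)) l2"
    and K \<Lambda> :: "(real ^ ('n + 'n)) set"
    and M :: "real ^ 'n ^ 'n"
  assumes "symplectic A"
    and "A = block_matrix A1 A2 0 (transpose (matrix_inv A1))"
    and "metaplectic A U"
    and "compact K"
    and "invertible M" and "transpose M = M" and "\<forall>t. t \<noteq> 0 \<longrightarrow> 0 < t \<bullet> (M *v t)"
    and "full_rank_lattice \<Lambda>"
  shows "identifiable (P_space U K) \<Lambda>
           (symbol_action (cadjoint U) (abs_l2 (gaussian M) \<otimes>\<^sub>o abs_l2 (gaussian M)))"
proof -
  define S where "S = symbol_action (cadjoint U) (abs_l2 (gaussian M) \<otimes>\<^sub>o abs_l2 (gaussian M))"
  obtain c R where c: "c \<noteq> 0" and R: "pos_def R"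
    and w: "wigl (abs_l2 (gaussian M)) (abs_l2 (gaussian M)) = cscale c (abs_l2 (chirped_gaussian R (\<lambda>_. 0)))"
    using wigl_gaussian[OF assms(6,7)] by blast
  define g where "g = abs_l2 (chirped_gaussian R (\<lambda>_. 0))"
  have U: "unitary U" and "\<And>\<xi>. U \<circ> rho \<xi> \<circ> cadjoint U = rho (A *v \<xi>)"
    using assms(3) by (auto simp: metaplectic_def)
  then have UU: "U (rho \<xi> (cadjoint U f)) = rho (A *v \<xi>) f" for \<xi> f
    by (metis comp_apply)
  define G where "G = cadjoint U (cscale c g)"
  have S: "S = quantize G"
    by (simp add: S_def symbol_action_def weyl_op_eq weyl_symbol_rank_one w G_def g_def)
  note invA1 = metaplectic_gaussian(1)[OF assms(1-3) R]
  obtain k P Q where P: "pos_def P" and Q: "linear Q" "\<And>x y. Q x \<bullet> y = x \<bullet> Q y"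
    and g: "cadjoint U g = cscale k (abs_l2 (chirped_gaussian P Q))"
    using metaplectic_gaussian(2)[OF assms(1-3) R] unfolding g_def by blast
  \<comment> \<open>\<open>cadjoint U\<close> enters as the inverse of \<open>U\<close>, so its
    homogeneity is obtained from that of \<open>U\<close>.\<close>
  have "U (cscale c (cadjoint U g)) = cscale c g"
    using U by (simp add: unitary_def bounded_clinear_def unitary_cadjoint(1)[OF U])
  then have "G = cscale c (cadjoint U g)"
    unfolding G_def by (metis unitary_cadjoint(2)[OF U])
  then have "G = abs_l2 (\<lambda>x. (c * k) * chirped_gaussian P Q x)"
    by (simp add: g cscale_abs[OF chirped_gaussian_square_integrable[OF P Q(1)], symmetric])
  then have schwartz: "S \<in> schwartz_operators"
    unfolding schwartz_operators_def S HS_eq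
    using schwartz_chirped_gaussian[OF P Q] by (auto simp: weyl_symbol_weyl)
  have T: "\<exists>H. T = quantize H \<and> l2_support (U H) \<subseteq> K" if "T \<in> P_space U K" for T
    using that by (auto simp: P_space_def HS_eq A_weyl_symbol_def weyl_symbol_weyl)
  have bounded: "bounded (cohen_diag S T ` \<Lambda>)" if TP: "T \<in> P_space U K" for T
  proof -
    obtain H where "T = quantize H" using T[OF TP] by blast
    then have "cmod (cohen_diag S T z) \<le> norm H * norm G" for z
      using cmod_cinner_le[of H "rho (join z 0) G"] by (simp add: S cohen_diag_weyl)
    then show ?thesis by (auto simp: bounded_iff)
  qed
  have inj: "inj_on (\<lambda>T. restrict (cohen_diag S T) \<Lambda>) (P_space U K)"
  proof (rule inj_onI)
    fix T1 T2 assume "T1 \<in> P_space U K" "T2 \<in> P_space U K"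
      and eq: "restrict (cohen_diag S T1) \<Lambda> = restrict (cohen_diag S T2) \<Lambda>"
    then obtain H1 H2 where H1: "T1 = quantize H1" "l2_support (U H1) \<subseteq> K"
      and H2: "T2 = quantize H2" "l2_support (U H2) \<subseteq> K"
      using T by meson
    \<comment> \<open>Samples are linear in the symbol and the support condition survives
      differences, so injectivity reduces to the vanishing of one function.\<close>
    have "U (H1 - H2) = 0"
    proof (rule gaussian_samples_determine[OF R invA1 assms(8,4)])
      show "AE x in lborel. x \<notin> K \<longrightarrow> rep_l2 (U (H1 - H2)) x = 0"
        using AE_l2_support[OF H1(2) compact_imp_closed[OF assms(4)]]
          AE_l2_support[OF H2(2) compact_imp_closed[OF assms(4)]] rep_minus[of "U H1" "U H2"]
        unfolding unitary_diff[OF U] by eventually_elim simp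
      fix b assume b: "b \<in> \<Lambda>"
      have Ab: "A *v join b 0 = join (A1 *v b) 0"
        by (simp add: assms(2) block_matrix_mult)
      have "cohen_diag S T1 b = cohen_diag S T2 b"
        using fun_cong[OF eq, of b] b by simp
      then have "cinner (H1 - H2) (rho (join b 0) G) = 0"
        by (simp add: S H1(1) H2(1) cohen_diag_weyl cinner_diff_left)
      then have "cinner (U (H1 - H2)) (U (rho (join b 0) (cadjoint U (cscale c g)))) = 0"
        by (simp add: unitary_cinner[OF U] G_def)
      \<comment> \<open>The intertwining relation \<open>UU\<close> absorbs the adjoint inside
        \<open>G\<close>, so the pairing involves the plain Gaussian \<open>g\<close> and not its
        metaplectic image.\<close>
      then have "cnj c * cinner (U (H1 - H2)) (rho (join (A1 *v b) 0) g) = 0"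
        unfolding UU Ab rho_cscale cinner_cscale_right .
      then show "cinner (U (H1 - H2)) (rho (join (A1 *v b) 0) (abs_l2 (chirped_gaussian R (\<lambda>_. 0)))) = 0"
        using c by (simp add: g_def)
    qed
    then have "norm (H1 - H2) = 0" using unitary_norm[OF U, of "H1 - H2"] by simp
    then show "T1 = T2" by (simp add: H1(1) H2(1))
  qed
  show ?thesis
    unfolding identifiable_def S_def[symmetric]
    using schwartz bounded inj by (auto simp: P_space_def)
qed

end
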